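(* Let $\Gamma$ be a finitely presented group generated by a finite symmetric set $S$. Let $(\Gamma_n)$ be an arbitrary sequence of subgroups of finite index in $\Gamma$. Then at least one of the following holds: 1) the sequence $\mathrm{Sch}(\Gamma,\Gamma_n,S)$ is not dispersive; 2) $\mathrm{RG}(\Gamma,(\Gamma_n))=0$ (in particular the limit exists); 3) there exists some $n$ such that $\Gamma_n$ decomposes as a non-trivial amalgamated product.
   Context: **Rank gradient.** With $d(H)$ the minimal number of generators of $H$, $\mathrm{RG}(\Gamma,(\Gamma_n))=\lim_{n\to\infty}\frac{d(\Gamma_n)-1}{|\Gamma:\Gamma_n|}$ when this limit exists. **Non-trivial amalgamated product.** A group $H$ decomposes as a non-trivial amalgamated product if there are subgroups $H_1,\dots,H_k\le H$ all containing a fixed subgroup $L$ such that $H\cong *_L H_i$ (the amalgamated product of the $H_i$ over $L$, induced by the inclusions) and $L$ has index at least $3$ in at least two of the $H_i$. **Schreier graphs.** For finite index $H\le\Gamma$, $\mathrm{Sch}(\Gamma,H,S)$ has vertex set $\Gamma/H$ and an edge labeled $s$ from $\gamma H$ to $s\gamma H$ for each $s\in S$. The corresponding finite action is the action of $\Gamma$ on $\Gamma/H$ with uniform measure. **Weak containment limits.** Consider p.m.p. actions $f$ of $\Gamma$ on $(X,\mu)$, either a standard Borel probability space or a finite set with uniform measure. For $r,k\in\mathbb{N}$ and a Borel coloring $\varphi:X\to\{1,\dots,k\}$, take a $\mu$-random $x$ and consider the $r$-ball around $x$ in the Schreier graph of its orbit (edges $y\to f_s(y)$ labeled $s\in S$),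 rooted at $x$, with its edge labels and the vertex coloring given by $\varphi$; this gives a probability measure on the finite set of rooted, $S$-edge-labeled, $k$-vertex-colored balls of radius at most $r$. Let $Q^k_{f,r}$ be the closure in total variation of the set of all measures obtained from Borel $k$-colorings. A sequence $f_n$ converges to $f$ in the weak containment topology if $Q^k_{f_n,r}\to Q^k_{f,r}$ in the Hausdorff distance (with respect to total variation) for all $r,k$. **Strong ergodicity.** A p.m.p. action $f$ of $\Gamma$ on $(X,\mu)$ is strongly ergodic if for every sequence of measurable sets $A_n\subseteq X$ with $\lim_n\mu(f_\gamma A_n\triangle A_n)=0$ for all $\gamma\in\Gamma$, one has $\lim_n\mu(A_n)(1-\mu(A_n))=0$. **Dispersive.** Let $f_n$ be the action of $\Gamma$ on $\Gamma/\Gamma_n$. The sequence $\mathrm{Sch}(\Gamma,\Gamma_n,S)$ is dispersive if for every subsequential weak containment limit $f$ of $(f_n)$, $f$ has no strongly ergodic, ergodic component of positive measure, i.e. there is no $f$-invariant measurable set $Y$ with $\mu(Y)>0$ such that the restriction of $f$ to $Y$ with normalized measure is ergodic and strongly ergodic. *)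

theory Defs
  imports
    "HOL-Analysis.Analysis"
    "HOL-Probability.Probability"
    "HOL-Algebra.Group_Action"
    "HOL-Algebra.Generated_Groups"
    "HOL-Algebra.Left_Coset"
begin

section \<open>Groups given by generators and relations\<close>

text \<open>
  The congruence on the free monoid of words over the alphabet \<open>A\<close> generated by a set \<open>R\<close> of
  pairs of words, and the quotient monoid. Free groups modulo relators and amalgamated products
  are both instances; inverses are enforced by the relations.
\<close>

inductive_set word_cong :: "'x set \<Rightarrow> ('x list \<times> 'x list) set \<Rightarrow> ('x list \<times> 'x list) set"
  for A :: "'x set" and R :: "('x list \<times> 'x list) set" where
  step: "\<lbrakk>(u, v) \<in> R; u \<in> lists A; v \<in> lists A; p \<in> lists A; q \<in> lists A\<rbrakk>
      \<Longrightarrow> (p @ u @ q, p @ v @ q) \<in> word_cong A R"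
| refl: "w \<in> lists A \<Longrightarrow> (w, w) \<in> word_cong A R"
| sym: "(u, v) \<in> word_cong A R \<Longrightarrow> (v, u) \<in> word_cong A R"
| trans: "\<lbrakk>(u, v) \<in> word_cong A R; (v, w) \<in> word_cong A R\<rbrakk> \<Longrightarrow> (u, w) \<in> word_cong A R"

definition word_quotient :: "'x set \<Rightarrow> ('x list \<times> 'x list) set \<Rightarrow> 'x list set monoid" where
  "word_quotient A R =
     \<lparr>carrier = lists A // word_cong A R,
      mult = (\<lambda>X Y. word_cong A R `` {x @ y |x y. x \<in> X \<and> y \<in> Y}),
      one = word_cong A R `` {[]}\<rparr>"

text \<open>
  The group with presentation \<open>\<langle>x\<^sub>0, \<dots>, x\<^sub>m\<^sub>-\<^sub>1 | R\<rangle>\<close>; the letter \<open>(i, True)\<close> stands for \<open>x\<^sub>i\<close> and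
  \<open>(i, False)\<close> for its inverse.
\<close>

definition presented_group :: "nat \<Rightarrow> (nat \<times> bool) list set \<Rightarrow> (nat \<times> bool) list set monoid" where
  "presented_group m R =
     word_quotient ({..<m} \<times> UNIV)
       ({([(i, b), (i, \<not> b)], []) |i b. i < m} \<union> {(r, []) |r. r \<in> R})"

definition finitely_presented :: "('a, 'm) monoid_scheme \<Rightarrow> bool" where
  "finitely_presented G \<longleftrightarrow>
     (\<exists>m R. finite R \<and> R \<subseteq> lists ({..<m} \<times> UNIV) \<and> G \<cong> presented_group m R)"

text \<open>
  The abstract amalgamated product over \<open>L\<close> of the subgroups \<open>Hs 0, \<dots>, Hs (k - 1)\<close> of \<open>G\<close>; the
  index in a letter \<open>(i, h)\<close> makes the union of the factors disjoint.
\<close>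

definition amalgamated_product ::
    "('a, 'm) monoid_scheme \<Rightarrow> 'a set \<Rightarrow> nat \<Rightarrow> (nat \<Rightarrow> 'a set) \<Rightarrow> (nat \<times> 'a) list set monoid" where
  "amalgamated_product G L k Hs =
     word_quotient (SIGMA i:{..<k}. Hs i)
       ({([(i, \<one>\<^bsub>G\<^esub>)], []) |i. i < k}
        \<union> {([(i, g), (i, h)], [(i, g \<otimes>\<^bsub>G\<^esub> h)]) |i g h. i < k \<and> g \<in> Hs i \<and> h \<in> Hs i}
        \<union> {([(i, l)], [(j, l)]) |i j l. i < k \<and> j < k \<and> l \<in> L})"

definition word_value :: "('a, 'm) monoid_scheme \<Rightarrow> (nat \<times> 'a) list \<Rightarrow> 'a" where
  "word_value G w = foldr (\<lambda>(i, h) g. h \<otimes>\<^bsub>G\<^esub> g) w \<one>\<^bsub>G\<^esub>"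

text \<open>
  \<open>word_value\<close> is constant on the congruence classes of the amalgamated product, so \<open>the_elem\<close> yields
  the homomorphism induced by the inclusions of the factors.
\<close>

definition amalgam_map :: "('a, 'm) monoid_scheme \<Rightarrow> (nat \<times> 'a) list set \<Rightarrow> 'a" where
  "amalgam_map G X = the_elem (word_value G ` X)"

definition nontrivial_amalgamated_product :: "('a, 'm) monoid_scheme \<Rightarrow> bool" where
  "nontrivial_amalgamated_product H \<longleftrightarrow>
     (\<exists>k Hs L.
        (\<forall>i<k. subgroup (Hs i) H \<and> L \<subseteq> Hs i) \<and> subgroup L H \<and>
        amalgam_map H \<in> iso (amalgamated_product H L k Hs) H \<and>
        (\<exists>i<k. \<exists>j<k. i \<noteq> j \<and>
           (\<forall>l\<in>{i, j}. infinite (lcosets\<^bsub>H\<lparr>carrier := Hs l\<rparr>\<^esub> L)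
                      \<or> 3 \<le> card (lcosets\<^bsub>H\<lparr>carrier := Hs l\<rparr>\<^esub> L))))"


section \<open>Rank gradient\<close>

definition finite_index :: "('a, 'm) monoid_scheme \<Rightarrow> 'a set \<Rightarrow> bool" where
  "finite_index G H \<longleftrightarrow> subgroup H G \<and> finite (lcosets\<^bsub>G\<^esub> H)"

text \<open>Only meaningful for finitely generated \<open>H\<close>.\<close>

definition min_generators :: "('a, 'm) monoid_scheme \<Rightarrow> 'a set \<Rightarrow> nat" where
  "min_generators G H = (LEAST d. \<exists>A. finite A \<and> A \<subseteq> H \<and> card A = d \<and> generate G A = H)"

definition has_rank_gradient ::
    "('a, 'm) monoid_scheme \<Rightarrow> (nat \<Rightarrow> 'a set) \<Rightarrow> real \<Rightarrow> bool" where
  "has_rank_gradient G H c \<longleftrightarrow>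
     (\<lambda>n. (real (min_generators G (H n)) - 1) / real (card (lcosets\<^bsub>G\<^esub> (H n)))) \<longlonglongrightarrow> c"


section \<open>Probability measure preserving actions\<close>

definition standard_borel :: "'x measure \<Rightarrow> bool" where
  "standard_borel M \<longleftrightarrow>
     (\<exists>T. completely_metrizable_space T \<and> second_countable T \<and> topspace T = space M \<and>
          sets M = sigma_sets (space M) {U. openin T U})"

definition pmp_action ::
    "('a, 'm) monoid_scheme \<Rightarrow> 'x measure \<Rightarrow> ('a \<Rightarrow> 'x \<Rightarrow> 'x) \<Rightarrow> bool" where
  "pmp_action G M f \<longleftrightarrow>
     prob_space M \<and> group_action G (space M) f \<and>
     (\<forall>g\<in>carrier G. f g \<in> measurable M M \<and> distr M M (f g) = M)"

definition coset_space :: "('a, 'm) monoid_scheme \<Rightarrow> 'a set \<Rightarrow> 'a set measure" where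
  "coset_space G H = uniform_count_measure (lcosets\<^bsub>G\<^esub> H)"

definition coset_action :: "('a, 'm) monoid_scheme \<Rightarrow> 'a set \<Rightarrow> 'a \<Rightarrow> 'a set \<Rightarrow> 'a set" where
  "coset_action G H g = (\<lambda>C\<in>lcosets\<^bsub>G\<^esub> H. g <#\<^bsub>G\<^esub> C)"

definition invariant_set ::
    "('a, 'm) monoid_scheme \<Rightarrow> 'x measure \<Rightarrow> ('a \<Rightarrow> 'x \<Rightarrow> 'x) \<Rightarrow> 'x set \<Rightarrow> bool" where
  "invariant_set G M f A \<longleftrightarrow> A \<in> sets M \<and> (\<forall>g\<in>carrier G. f g ` A = A)"

definition ergodic ::
    "('a, 'm) monoid_scheme \<Rightarrow> 'x measure \<Rightarrow> ('a \<Rightarrow> 'x \<Rightarrow> 'x) \<Rightarrow> bool" where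
  "ergodic G M f \<longleftrightarrow> (\<forall>A. invariant_set G M f A \<longrightarrow> measure M A = 0 \<or> measure M A = 1)"

definition strongly_ergodic ::
    "('a, 'm) monoid_scheme \<Rightarrow> 'x measure \<Rightarrow> ('a \<Rightarrow> 'x \<Rightarrow> 'x) \<Rightarrow> bool" where
  "strongly_ergodic G M f \<longleftrightarrow>
     (\<forall>A :: nat \<Rightarrow> 'x set.
        range A \<subseteq> sets M \<and>
        (\<forall>g\<in>carrier G. (\<lambda>n. measure M (sym_diff (f g ` A n) (A n))) \<longlonglongrightarrow> 0)
        \<longrightarrow> (\<lambda>n. measure M (A n) * (1 - measure M (A n))) \<longlonglongrightarrow> 0)"

definition normalized_restriction :: "'x measure \<Rightarrow> 'x set \<Rightarrow> 'x measure" where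
  "normalized_restriction M Y = restrict_space (uniform_measure M Y) Y"

definition restrict_action :: "('a \<Rightarrow> 'x \<Rightarrow> 'x) \<Rightarrow> 'x set \<Rightarrow> 'a \<Rightarrow> 'x \<Rightarrow> 'x" where
  "restrict_action f Y g = restrict (f g) Y"


section \<open>Weak containment topology\<close>

record ('v, 's) rooted_graph =
  verts :: "'v set"
  edges :: "('v \<times> 's \<times> 'v) set"
  centre :: 'v
  colour :: "'v \<Rightarrow> nat"

definition rooted_iso :: "('v, 's) rooted_graph \<Rightarrow> ('w, 's) rooted_graph \<Rightarrow> bool" where
  "rooted_iso B C \<longleftrightarrow>
     (\<exists>h. bij_betw h (verts B) (verts C) \<and>
          edges C = (\<lambda>(v, s, w). (h v, s, h w)) ` edges B \<and>
          centre C = h (centre B) \<and>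
          (\<forall>v\<in>verts B. colour C (h v) = colour B v))"

definition schreier_edges ::
    "'s set \<Rightarrow> 'x set \<Rightarrow> ('s \<Rightarrow> 'x \<Rightarrow> 'x) \<Rightarrow> ('x \<times> 's \<times> 'x) set" where
  "schreier_edges S X f = {(y, s, f s y) |y s. y \<in> X \<and> s \<in> S}"

primrec ball_verts :: "('x \<times> 's \<times> 'x) set \<Rightarrow> 'x \<Rightarrow> nat \<Rightarrow> 'x set" where
  "ball_verts E x 0 = {x}"
| "ball_verts E x (Suc r) =
     ball_verts E x r \<union>
     {z. \<exists>y\<in>ball_verts E x r. \<exists>s. (y, s, z) \<in> E \<or> (z, s, y) \<in> E}"

definition schreier_ball ::
    "'s set \<Rightarrow> 'x set \<Rightarrow> ('s \<Rightarrow> 'x \<Rightarrow> 'x) \<Rightarrow> ('x \<Rightarrow> nat) \<Rightarrow> nat \<Rightarrow> 'x \<Rightarrow> ('x, 's) rooted_graph" where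
  "schreier_ball S X f \<phi> r x =
     (let E = schreier_edges S X f; V = ball_verts E x r in
        \<lparr>verts = V, edges = {(y, s, z) \<in> E. y \<in> V \<and> z \<in> V}, centre = x, colour = \<phi>\<rparr>)"

text \<open>
  To compare balls in actions on different spaces, the isomorphism class of a (finite) ball is
  represented by the set of all its copies with vertices in \<open>nat\<close>.
\<close>

definition ball_type ::
    "'s set \<Rightarrow> 'x set \<Rightarrow> ('s \<Rightarrow> 'x \<Rightarrow> 'x) \<Rightarrow> ('x \<Rightarrow> nat) \<Rightarrow> nat \<Rightarrow> 'x
     \<Rightarrow> (nat, 's) rooted_graph set" where
  "ball_type S X f \<phi> r x = {C. rooted_iso (schreier_ball S X f \<phi> r x) C}"

text \<open>
  For finite \<open>S\<close>, fixed \<open>r\<close> and \<open>k\<close> colours only finitely many ball types occur, so their discrete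
  distribution can be taken on the whole type.
\<close>

definition local_statistics ::
    "'s set \<Rightarrow> 'x measure \<Rightarrow> ('s \<Rightarrow> 'x \<Rightarrow> 'x) \<Rightarrow> ('x \<Rightarrow> nat) \<Rightarrow> nat
     \<Rightarrow> (nat, 's) rooted_graph set measure" where
  "local_statistics S M f \<phi> r = distr M (count_space UNIV) (ball_type S (space M) f \<phi> r)"

definition tv_dist :: "'b measure \<Rightarrow> 'b measure \<Rightarrow> real" where
  "tv_dist P Q = (SUP A\<in>sets P. \<bar>measure P A - measure Q A\<bar>)"

definition hausdorff_distance :: "('b \<Rightarrow> 'b \<Rightarrow> real) \<Rightarrow> 'b set \<Rightarrow> 'b set \<Rightarrow> real" where
  "hausdorff_distance d A B =
     max (SUP a\<in>A. INF b\<in>B. d a b) (SUP b\<in>B. INF a\<in>A. d a b)"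

definition colour_statistics ::
    "'s set \<Rightarrow> 'x measure \<Rightarrow> ('s \<Rightarrow> 'x \<Rightarrow> 'x) \<Rightarrow> nat \<Rightarrow> nat
     \<Rightarrow> (nat, 's) rooted_graph set measure set" where
  "colour_statistics S M f k r =
     {P. prob_space P \<and> sets P = UNIV \<and>
         (\<forall>\<epsilon>>0. \<exists>\<phi> \<in> measurable M (count_space {1..k}).
                    tv_dist P (local_statistics S M f \<phi> r) < \<epsilon>)}"

text \<open>
  The actions may live on spaces of different types. The condition \<open>k \<ge> 1\<close> only excludes the case
  without any colouring.
\<close>

definition weakly_converges ::
    "'s set \<Rightarrow> (nat \<Rightarrow> 'x measure) \<Rightarrow> (nat \<Rightarrow> 's \<Rightarrow> 'x \<Rightarrow> 'x)
     \<Rightarrow> 'y measure \<Rightarrow> ('s \<Rightarrow> 'y \<Rightarrow> 'y) \<Rightarrow> bool" where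
  "weakly_converges S Ms fs M f \<longleftrightarrow>
     (\<forall>r. \<forall>k\<ge>1.
        (\<lambda>n. hausdorff_distance tv_dist
               (colour_statistics S (Ms n) (fs n) k r) (colour_statistics S M f k r))
        \<longlonglongrightarrow> 0)"

text \<open>
  The limit actions range over standard Borel spaces with underlying set of reals. Every standard
  Borel space, in particular every finite one, is Borel isomorphic to one of these, and weak
  convergence, ergodicity and strong ergodicity are isomorphism invariant.
\<close>

definition dispersive ::
    "('a, 'm) monoid_scheme \<Rightarrow> 'a set \<Rightarrow> (nat \<Rightarrow> 'a set) \<Rightarrow> bool" where
  "dispersive G S H \<longleftrightarrow>
     (\<forall>\<sigma> :: nat \<Rightarrow> nat. \<forall>(M :: real measure) f.
        strict_mono \<sigma> \<and> standard_borel M \<and> pmp_action G M f \<and>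
        weakly_converges S (\<lambda>n. coset_space G (H (\<sigma> n))) (\<lambda>n. coset_action G (H (\<sigma> n))) M f
        \<longrightarrow> \<not> (\<exists>Y. invariant_set G M f Y \<and> 0 < measure M Y \<and>
                 ergodic G (normalized_restriction M Y) (restrict_action f Y) \<and>
                 strongly_ergodic G (normalized_restriction M Y) (restrict_action f Y)))"

end

theory Submission
  imports Defs "HOL-Library.Diagonal_Subsequence" "HOL-Library.Sublist"
begin

text \<open>
  Suppose the sequence is dispersive but the rank gradient is not \<open>0\<close>. Along a subsequence the number of
  generators is at least a fixed multiple of the index, and a further subsequence of the coset actions
  converges weakly. In a limit without strongly ergodic components the space can be coloured, with finitely many
  small and almost invariant colour classes: refining almost invariant colourings lowers the expected
  measure of the class of a random point to \<open>0\<close>, because a positive infimum would produce a strongly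
  ergodic component. By weak convergence the cosets of \<open>H = \<Gamma>n n\<close> have colourings of the same kind.
  Cover the presentation complex of \<open>\<Gamma>\<close> according to \<open>H\<close> and cut it along the colour classes: the Schreier
  generators at the cosets close to another colour generate a subgroup \<open>L\<close>, adding those at one colour
  class gives \<open>H\<^sub>j\<close>, and \<open>H\<close> is the amalgam of the \<open>H\<^sub>j\<close> over \<open>L\<close>. If it is trivial, all but one of the
  \<open>H\<^sub>j\<close> contain \<open>L\<close> with index at most \<open>2\<close>, so \<open>H\<close> is generated by \<open>L\<close>, one \<open>H\<^sub>j\<close> and a
  bounded number of further elements, which are too few relative to the index unless the index stays bounded.
  But on a bounded number of cosets a colour class of small enough density is empty.
\<close>

section \<open>Amalgam decompositions from partitions of a coset space\<close>


text \<open>Two requirements shape the proof. First, the number of colours has to stay bounded while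
  the coset spaces vary, because each factor may cost one more generator. Weak convergence provides
  this: a single colouring of the limit is copied to all late finite systems, and its number of
  colours \<open>K\<close> enters the estimate only as an additive constant. The density
  \<open>t\<close> depends on \<open>\<epsilon>\<close> alone and precedes \<open>K\<close>; the
  density \<open>u\<close> of the last step is chosen after the bound on the index. Second,
  dispersiveness speaks only about limits that exist, so compactness has to be proved. Every
  statistic that the finite systems keep producing must be realised in the limit, and every
  colouring of the limit must reappear at all late stages. To this end countably many rounded
  statistics are made to stabilise along a subsequence, and for each of them a colouring is recorded
  as a coordinate of a symbolic model. Further coordinates separate \<open>x\<close> from
  \<open>g x\<close>, since the local statistics also see stabilizers.\<close>

lemma word_cong_lists:
  "(u, v) \<in> word_cong A R \<Longrightarrow> u \<in> lists A \<and> v \<in> lists A"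
  by (induction rule: word_cong.induct) auto

lemma word_cong_append_context:
  assumes "(u, v) \<in> word_cong A R" "p \<in> lists A" "q \<in> lists A"
  shows "(p @ u @ q, p @ v @ q) \<in> word_cong A R"
  using assms
proof (induction rule: word_cong.induct)
  case (step u v p' q')
  then have "((p @ p') @ u @ (q' @ q), (p @ p') @ v @ (q' @ q)) \<in> word_cong A R"
    by (intro word_cong.step) auto
  then show ?case by simp
next
  case (refl w)
  then show ?case by (intro word_cong.refl) auto
qed (blast intro: word_cong.sym word_cong.trans)+

lemma word_cong_append:
  assumes "(u, v) \<in> word_cong A R" "(u', v') \<in> word_cong A R"
  shows "(u @ u', v @ v') \<in> word_cong A R"
proof -
  have "(u @ u', v @ u') \<in> word_cong A R"
    using word_cong_append_context[OF assms(1), of "[]" u'] word_cong_lists[OF assms(2)] by simp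
  moreover have "(v @ u', v @ v') \<in> word_cong A R"
    using word_cong_append_context[OF assms(2), of v "[]"] word_cong_lists[OF assms(1)] by simp
  ultimately show ?thesis by (rule word_cong.trans)
qed

lemma word_cong_rule:
  "\<lbrakk>(u, v) \<in> R; u \<in> lists A; v \<in> lists A\<rbrakk> \<Longrightarrow> (u, v) \<in> word_cong A R"
  using word_cong.step[of u v R A "[]" "[]"] by simp

lemma equiv_word_cong: "equiv (lists A) (word_cong A R)"
  by (auto simp: equiv_def refl_on_def sym_def trans_def
      intro: word_cong.refl word_cong.sym word_cong.trans dest: word_cong_lists)

lemma word_quotient_mult:
  assumes "u \<in> lists A" "v \<in> lists A"
  shows "(word_cong A R `` {u}) \<otimes>\<^bsub>word_quotient A R\<^esub> (word_cong A R `` {v}) = word_cong A R `` {u @ v}"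
proof -
  have "word_cong A R `` {x @ y |x y. x \<in> word_cong A R `` {u} \<and> y \<in> word_cong A R `` {v}}
      = word_cong A R `` {u @ v}" (is "?l = ?r")
  proof
    show "?l \<subseteq> ?r" by (auto intro: word_cong.trans word_cong_append)
    show "?r \<subseteq> ?l" using assms by (blast intro: word_cong.refl)
  qed
  then show ?thesis by (simp add: word_quotient_def)
qed

section \<open>Finitely presented groups through evaluation of words\<close>

lemma finitely_presented_words:
  assumes "group G" "finitely_presented G"
  obtains A :: "(nat \<times> bool) set" and R ev where
    "finite A" "finite R" "R \<subseteq> lists A \<times> lists A"
    "\<And>u v. u \<in> lists A \<Longrightarrow> v \<in> lists A \<Longrightarrow> ev (u @ v) = ev u \<otimes>\<^bsub>G\<^esub> ev v"
    "ev ` lists A = carrier G"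
    "\<And>u v. u \<in> lists A \<Longrightarrow> v \<in> lists A \<Longrightarrow> ev u = ev v \<longleftrightarrow> (u, v) \<in> word_cong A R"
proof -
  interpret group G by fact
  obtain m R\<^sub>0 \<theta> where R\<^sub>0: "finite R\<^sub>0" "R\<^sub>0 \<subseteq> lists ({..<m} \<times> UNIV)"
    and \<theta>: "\<theta> \<in> iso G (presented_group m R\<^sub>0)"
    using assms(2) unfolding finitely_presented_def is_iso_def by blast
  define A where "A = {..<m} \<times> (UNIV :: bool set)"
  define R where "R = {([(i, b), (i, \<not> b)], [] :: (nat \<times> bool) list) |i b. i < m} \<union> {(r, []) |r. r \<in> R\<^sub>0}"
  have Q: "presented_group m R\<^sub>0 = word_quotient A R"
    by (simp add: presented_group_def A_def R_def)
  have car: "carrier (word_quotient A R) = lists A // word_cong A R"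
    by (simp add: word_quotient_def)
  have bij: "bij_betw \<theta> (carrier G) (lists A // word_cong A R)"
    and hom: "\<And>x y. x \<in> carrier G \<Longrightarrow> y \<in> carrier G \<Longrightarrow> \<theta> (x \<otimes>\<^bsub>G\<^esub> y) = \<theta> x \<otimes>\<^bsub>word_quotient A R\<^esub> \<theta> y"
    using \<theta> unfolding iso_def hom_def Q car by auto
  define ev where "ev w = inv_into (carrier G) \<theta> (word_cong A R `` {w})" for w
  have cl: "word_cong A R `` {w} \<in> lists A // word_cong A R" if "w \<in> lists A" for w
    using that by (rule quotientI)
  have ev_in: "ev w \<in> carrier G" and \<theta>_ev: "\<theta> (ev w) = word_cong A R `` {w}" if "w \<in> lists A" for w
    using cl[OF that] bij inv_into_into[of "word_cong A R `` {w}" \<theta> "carrier G"]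
      f_inv_into_f[of "word_cong A R `` {w}" \<theta> "carrier G"]
    by (auto simp: ev_def bij_betw_def)
  have inj: "inj_on \<theta> (carrier G)" using bij by (rule bij_betw_imp_inj_on)
  show ?thesis
  proof
    show "finite A" by (simp add: A_def)
    have "{([(i, b), (i, \<not> b)], [] :: (nat \<times> bool) list) |i b. i < m}
        = (\<lambda>(i, b). ([(i, b), (i, \<not> b)], [])) ` A"
      by (auto simp: A_def)
    moreover have "{(r, [] :: (nat \<times> bool) list) |r. r \<in> R\<^sub>0} = (\<lambda>r. (r, [])) ` R\<^sub>0" by auto
    ultimately show "finite R" using R\<^sub>0(1) \<open>finite A\<close> by (simp add: R_def)
    show "R \<subseteq> lists A \<times> lists A" using R\<^sub>0(2) by (auto simp: R_def A_def)
    show "ev (u @ v) = ev u \<otimes>\<^bsub>G\<^esub> ev v" if "u \<in> lists A" "v \<in> lists A" for u v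
      using that hom[OF ev_in ev_in, OF that] word_quotient_mult[OF that, of R]
        ev_in[of "u @ v"] \<theta>_ev[of "u @ v"] \<theta>_ev[of u] \<theta>_ev[of v] inj ev_in[of u] ev_in[of v]
      by (intro inj_onD[OF inj]) auto
    show "ev ` lists A = carrier G"
    proof
      show "carrier G \<subseteq> ev ` lists A"
      proof
        fix x assume "x \<in> carrier G"
        then have "\<theta> x \<in> lists A // word_cong A R" using bij by (auto simp: bij_betw_def)
        then obtain w where "w \<in> lists A" "\<theta> x = word_cong A R `` {w}" by (rule quotientE)
        then show "x \<in> ev ` lists A"
          using inj_onD[OF inj, of x "ev w"] \<open>x \<in> carrier G\<close> ev_in \<theta>_ev by auto
      qed
    qed (use ev_in in auto)
    show "ev u = ev v \<longleftrightarrow> (u, v) \<in> word_cong A R" if "u \<in> lists A" "v \<in> lists A" for u v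
      using eq_equiv_class_iff[OF equiv_word_cong that, of R] \<theta>_ev[of u] \<theta>_ev[of v] that
        inj_onD[OF inj, of "ev u" "ev v"] ev_in by metis
  qed
qed

text \<open>One predecessor is chosen per point, once and for all; unfolding these choices gives
  words of which every tail is again the word of a point. Such a coherent family is a spanning tree
  rooted at \<open>x\<^sub>0\<close>.\<close>

lemma descending_words:
  fixes d :: "'x \<Rightarrow> nat"
  assumes step: "\<And>x. x \<in> X \<Longrightarrow> x \<noteq> x\<^sub>0 \<Longrightarrow> \<exists>a y. y \<in> X \<and> d y < d x \<and> P a y x"
  obtains w where "w x\<^sub>0 = []"
    "\<And>x. x \<in> X \<Longrightarrow> x \<noteq> x\<^sub>0 \<Longrightarrow> \<exists>a y. y \<in> X \<and> d y < d x \<and> P a y x \<and> w x = a # w y"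
proof -
  obtain a y where ay: "\<And>x. x \<in> X \<Longrightarrow> x \<noteq> x\<^sub>0 \<Longrightarrow> y x \<in> X \<and> d (y x) < d x \<and> P (a x) (y x) x"
    using step by metis
  define F where "F f x = (if x = x\<^sub>0 \<or> x \<notin> X then [] else a x # f (y x))" for f x
  define w where "w = wfrec (Wellfounded.measure d) F"
  have w: "w x = F (cut w (Wellfounded.measure d) x) x" for x
    unfolding w_def by (rule wfrec) simp
  show ?thesis
  proof
    show "w x\<^sub>0 = []" by (subst w) (simp add: F_def)
    show "\<exists>a y. y \<in> X \<and> d y < d x \<and> P a y x \<and> w x = a # w y" if "x \<in> X" "x \<noteq> x\<^sub>0" for x
      by (intro exI[of _ "a x"] exI[of _ "y x"], use ay[OF that] in simp, subst w)
        (use that ay[OF that] in \<open>simp add: F_def cut_def\<close>)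
  qed
qed

text \<open>All that is kept of a presentation. In the application the cancelling pairs of letters
  are ordinary members of \<open>R\<close>, so formal inverses need no separate treatment.\<close>

locale word_presented_group = group G for G (structure) +
  fixes A :: "'x set" and R :: "('x list \<times> 'x list) set" and ev :: "'x list \<Rightarrow> 'a"
  assumes fin_A: "finite A" and fin_R: "finite R" and R_lists: "R \<subseteq> lists A \<times> lists A"
    and ev_append: "\<And>u v. u \<in> lists A \<Longrightarrow> v \<in> lists A \<Longrightarrow> ev (u @ v) = ev u \<otimes> ev v"
    and ev_surj: "ev ` lists A = carrier G"
    and ev_eq_iff: "\<And>u v. u \<in> lists A \<Longrightarrow> v \<in> lists A \<Longrightarrow> ev u = ev v \<longleftrightarrow> (u, v) \<in> word_cong A R"
begin

lemma ev_closed [simp]: "u \<in> lists A \<Longrightarrow> ev u \<in> carrier G"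
  using ev_surj by blast

lemma ev_Nil [simp]: "ev [] = \<one>"
  using ev_append[of "[]" "[]"] ev_closed[of "[]"] by (simp add: l_cancel_one')

lemma ev_Cons: "a \<in> A \<Longrightarrow> u \<in> lists A \<Longrightarrow> ev (a # u) = ev [a] \<otimes> ev u"
  using ev_append[of "[a]" u] by simp

text \<open>A path reading the relator \<open>u = p @ s\<close> from \<open>x\<close> ends at \<open>ev u \<triangleright> x\<close>, and the vertex after the suffix \<open>s\<close> is
  \<open>ev s \<triangleright> x\<close>; hence the starting points of all relator cycles through a vertex arise from it by the
  translations collected here.\<close>

definition relator_suffixes :: "'x list set" where
  "relator_suffixes = {s. \<exists>(u, v)\<in>R. suffix s u \<or> suffix s v}"

definition relator_shifts :: "'a set" where
  "relator_shifts = (\<lambda>s. inv (ev s)) ` relator_suffixes"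

lemma relator_suffixes_lists: "relator_suffixes \<subseteq> lists A"
  using R_lists by (fastforce simp: relator_suffixes_def suffix_def)

lemma finite_relator_shifts: "finite relator_shifts"
proof -
  have "relator_suffixes = (\<Union>(u, v)\<in>R. {s. suffix s u} \<union> {s. suffix s v})"
    by (auto simp: relator_suffixes_def)
  moreover have "finite {s. suffix s u}" for u :: "'x list"
    by (metis List.finite_set set_suffixes_eq)
  ultimately have "finite relator_suffixes" using fin_R by auto
  then show ?thesis by (auto simp: relator_shifts_def)
qed

lemma relator_shifts_carrier: "relator_shifts \<subseteq> carrier G"
  using relator_suffixes_lists unfolding relator_shifts_def
  by (auto intro!: m_closed inv_closed ev_closed simp del: in_lists_conv_set)

end

section \<open>Schreier coset graphs with coloured vertices\<close>

locale coset_partition = word_presented_group G A R ev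
  for G (structure) and A :: "'x set" and R and ev +
  fixes H :: "'a set" and k :: nat and part :: "'a set \<Rightarrow> nat"
  assumes H: "subgroup H G" and fin_cosets: "finite (lcosets H)"
    and part: "\<And>x. x \<in> lcosets H \<Longrightarrow> part x < k"
begin

abbreviation translate :: "'a \<Rightarrow> 'a set \<Rightarrow> 'a set" (infixl "\<triangleright>" 60) where
  "g \<triangleright> x \<equiv> l_coset G g x"

lemma H_sub: "H \<subseteq> carrier G" using subgroup.subset[OF H] .

lemma H_coset: "H \<in> lcosets H"
  using lcos_mult_one[OF H_sub] by (auto simp: LCOSETS_def)

lemma coset_sub: "x \<in> lcosets H \<Longrightarrow> x \<subseteq> carrier G"
  using subgroup.lcosets_carrier[OF H is_group] .

lemma act_coset [simp]: "g \<in> carrier G \<Longrightarrow> x \<in> lcosets H \<Longrightarrow> g \<triangleright> x \<in> lcosets H"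
  by (auto simp: LCOSETS_def lcos_m_assoc[OF H_sub])

lemma act_act: "g \<in> carrier G \<Longrightarrow> h \<in> carrier G \<Longrightarrow> x \<in> lcosets H \<Longrightarrow> g \<triangleright> (h \<triangleright> x) = (g \<otimes> h) \<triangleright> x"
  using lcos_m_assoc[OF coset_sub] .

lemma act_one: "x \<in> lcosets H \<Longrightarrow> \<one> \<triangleright> x = x"
  using lcos_mult_one[OF coset_sub] .

lemma stabilizer_H: "g \<in> carrier G \<Longrightarrow> g \<triangleright> H = H \<longleftrightarrow> g \<in> H"
  by (metis H coset_join3 lcos_self subgroup.subset subset_iff)

text \<open>A vertex is compared with the starting points of the relator cycles through it, not with
  its neighbours. Outside \<open>boundary\<close> it has the colour of all these starting points,
  which keeps a relator inside one factor up to elements of \<open>core\<close>.\<close>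

definition boundary :: "'a set set" where
  "boundary = {x \<in> lcosets H. \<exists>g\<in>relator_shifts. part (g \<triangleright> x) \<noteq> part x}"

lemma ev_append_act:
  "u \<in> lists A \<Longrightarrow> v \<in> lists A \<Longrightarrow> x \<in> lcosets H \<Longrightarrow> ev (u @ v) \<triangleright> x = ev u \<triangleright> (ev v \<triangleright> x)"
  by (simp add: ev_append act_act del: in_lists_conv_set)

lemma ev_inverse_word:
  assumes "u \<in> lists A"
  obtains v where "v \<in> lists A" "ev v = inv (ev u)"
  using ev_surj ev_closed[OF assms] inv_closed by (metis imageE)

text \<open>The first letter of a word is the last edge of its path from \<open>H\<close>. The depth
  \<open>d\<close> provides a well-founded descent to the root.\<close>

definition tree_words :: "('a set \<Rightarrow> nat) \<Rightarrow> ('a set \<Rightarrow> 'x list) \<Rightarrow> bool" where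
  "tree_words d w \<longleftrightarrow> w H = [] \<and> (\<forall>x\<in>lcosets H. w x \<in> lists A \<and> ev (w x) \<triangleright> H = x) \<and>
     (\<forall>x\<in>lcosets H. x \<noteq> H \<longrightarrow> (\<exists>a\<in>A. \<exists>y\<in>lcosets H. d y < d x \<and> w x = a # w y))"

lemma tree_words_exist: "\<exists>w d. tree_words d w"
proof -
  define reach where "reach x n \<longleftrightarrow> (\<exists>u\<in>lists A. length u = n \<and> ev u \<triangleright> H = x)" for x n
  define d where "d x = (LEAST n. reach x n)" for x
  have ex: "\<exists>n. reach x n" if x: "x \<in> lcosets H" for x
  proof -
    obtain g where "g \<in> carrier G" "x = g \<triangleright> H" using x by (auto simp: LCOSETS_def)
    moreover obtain u where "u \<in> lists A" "g = ev u" using ev_surj \<open>g \<in> carrier G\<close> by (metis imageE)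
    ultimately have "reach x (length u)" unfolding reach_def by (intro bexI[of _ u]) simp_all
    then show ?thesis ..
  qed
  have step: "\<exists>a y. y \<in> lcosets H \<and> d y < d x \<and> a \<in> A \<and> ev [a] \<triangleright> y = x"
    if x: "x \<in> lcosets H" "x \<noteq> H" for x
  proof -
    have "reach x (d x)" unfolding d_def using ex[OF x(1)] by (rule LeastI_ex)
    then obtain u where u: "u \<in> lists A" "length u = d x" "ev u \<triangleright> H = x"
      unfolding reach_def by blast
    have "u \<noteq> []"
    proof
      assume "u = []"
      then have "x = H" using u(3) by (simp add: act_one[OF H_coset])
      then show False using x(2) by simp
    qed
    \<comment> \<open>The head is the last edge of a shortest path to \<open>x\<close>; without it a
      path to the previous vertex remains, of smaller length.\<close>
    then obtain a v where uv: "u = a # v" "a \<in> A" "v \<in> lists A" using u(1) by (cases u) auto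
    have "reach (ev v \<triangleright> H) (length v)"
      unfolding reach_def by (rule bexI[of _ v]) (use uv(3) in simp_all)
    then have "d (ev v \<triangleright> H) \<le> length v" unfolding d_def by (rule Least_le)
    then have "d (ev v \<triangleright> H) < d x" using u(2) uv(1) by simp
    moreover have "ev [a] \<triangleright> (ev v \<triangleright> H) = x"
      using ev_append_act[of "[a]" v H] uv u(3) H_coset by simp
    moreover have "ev v \<triangleright> H \<in> lcosets H" using uv(3) H_coset by (intro act_coset ev_closed)
    ultimately show ?thesis using uv(2) by blast
  qed
  obtain w where w: "w H = []"
    "\<And>x. x \<in> lcosets H \<Longrightarrow> x \<noteq> H \<Longrightarrow>
      \<exists>a y. y \<in> lcosets H \<and> d y < d x \<and> (a \<in> A \<and> ev [a] \<triangleright> y = x) \<and> w x = a # w y"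
    by (rule descending_words[of "lcosets H" H d "\<lambda>a y x. a \<in> A \<and> ev [a] \<triangleright> y = x"])
      (use step in blast)+
  have act: "w x \<in> lists A \<and> ev (w x) \<triangleright> H = x" if "x \<in> lcosets H" for x
    using that
  proof (induction "d x" arbitrary: x rule: less_induct)
    case less
    show ?case
    proof (cases "x = H")
      case True
      then show ?thesis using w(1) act_one[OF H_coset] by simp
    next
      case False
      then obtain a y where ay: "y \<in> lcosets H" "d y < d x" "a \<in> A" "ev [a] \<triangleright> y = x" "w x = a # w y"
        using w(2)[OF less.prems] by blast
      then show ?thesis using less.hyps[OF ay(2,1)] ev_append_act[of "[a]" "w y" H] H_coset by simp
    qed
  qed
  have "\<exists>a\<in>A. \<exists>y\<in>lcosets H. d y < d x \<and> w x = a # w y" if "x \<in> lcosets H" "x \<noteq> H" for x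
    using w(2)[OF that] by blast
  then have "tree_words d w" unfolding tree_words_def using w(1) act by simp
  then show ?thesis by blast
qed

definition tree_word :: "'a set \<Rightarrow> 'x list" where
  "tree_word = (SOME w. \<exists>d. tree_words d w)"

lemma tree_words_tree_word: "\<exists>d. tree_words d tree_word"
  unfolding tree_word_def using tree_words_exist by (rule someI_ex)

lemma tree_word_H [simp]: "tree_word H = []"
  and tree_word_lists: "x \<in> lcosets H \<Longrightarrow> tree_word x \<in> lists A"
  and tree_word_act: "x \<in> lcosets H \<Longrightarrow> ev (tree_word x) \<triangleright> H = x"
  using tree_words_tree_word unfolding tree_words_def by blast+

text \<open>Descent in the depth: removing the first letter of \<open>tree_word x\<close> moves one
  edge towards the root.\<close>

lemma tree_word_induct [consumes 1, case_names root step]: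
  assumes "x \<in> lcosets H" "P H"
    and step: "\<And>a y. a \<in> A \<Longrightarrow> y \<in> lcosets H \<Longrightarrow> ev [a] \<triangleright> y \<in> lcosets H \<Longrightarrow>
          tree_word (ev [a] \<triangleright> y) = a # tree_word y \<Longrightarrow> P y \<Longrightarrow> P (ev [a] \<triangleright> y)"
  shows "P x"
proof -
  obtain d where "tree_words d tree_word" using tree_words_tree_word by blast
  then have d: "\<And>x. x \<in> lcosets H \<Longrightarrow> x \<noteq> H \<Longrightarrow>
      \<exists>a\<in>A. \<exists>y\<in>lcosets H. d y < d x \<and> tree_word x = a # tree_word y"
    by (simp add: tree_words_def)
  from assms(1) show ?thesis
  proof (induction "d x" arbitrary: x rule: less_induct)
    case less
    show ?case
    proof (cases "x = H")
      case False
      then obtain a y where ay: "a \<in> A" "y \<in> lcosets H" "d y < d x" "tree_word x = a # tree_word y"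
        using d less.prems by blast
      have "ev [a] \<triangleright> y = x"
        using ev_append_act[of "[a]" "tree_word y" H] ay tree_word_lists[OF ay(2)] tree_word_act[OF ay(2)]
          tree_word_act[OF less.prems] H_coset by simp
      then show ?thesis using step[of a y] ay less by auto
    qed (use assms(2) in simp)
  qed
qed

text \<open>A Schreier transversal, as tails of tree words are tree words; the edges of the tree
  therefore have trivial \<open>edge_elt\<close>.\<close>

definition transversal :: "'a set \<Rightarrow> 'a" where
  "transversal x = ev (tree_word x)"

lemma transversal_closed [simp]: "x \<in> lcosets H \<Longrightarrow> transversal x \<in> carrier G"
  by (simp add: transversal_def tree_word_lists del: in_lists_conv_set)

lemma transversal_H [simp]: "transversal H = \<one>"
  by (simp add: transversal_def)

lemma transversal_act: "x \<in> lcosets H \<Longrightarrow> transversal x \<triangleright> H = x"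
  by (simp add: transversal_def tree_word_act)

text \<open>The Schreier generator of the edge labelled \<open>a\<close> at \<open>x\<close>.\<close>

definition edge_elt :: "'x \<Rightarrow> 'a set \<Rightarrow> 'a" where
  "edge_elt a x = inv (transversal (ev [a] \<triangleright> x)) \<otimes> ev [a] \<otimes> transversal x"

text \<open>Acting on the base vertex \<open>H\<close>, the three factors lead to \<open>x\<close>,
  on to its image under \<open>g\<close>, and back to \<open>H\<close>.\<close>

lemma cocycle_in_H:
  assumes "g \<in> carrier G" "x \<in> lcosets H"
  shows "inv (transversal (g \<triangleright> x)) \<otimes> g \<otimes> transversal x \<in> H"
proof -
  have gx: "g \<triangleright> x \<in> lcosets H" using assms by simp
  have "(inv (transversal (g \<triangleright> x)) \<otimes> g \<otimes> transversal x) \<triangleright> H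
      = inv (transversal (g \<triangleright> x)) \<triangleright> (transversal (g \<triangleright> x) \<triangleright> H)"
    using assms gx by (simp add: act_act[symmetric] transversal_act H_coset)
  also have "\<dots> = H"
    using gx act_one[OF H_coset] by (simp add: act_act H_coset)
  finally show ?thesis using assms gx by (simp add: stabilizer_H)
qed

lemma edge_elt_in_H: "a \<in> A \<Longrightarrow> x \<in> lcosets H \<Longrightarrow> edge_elt a x \<in> H"
  unfolding edge_elt_def by (rule cocycle_in_H) auto

section \<open>The factors, the amalgamated subgroup and their relations\<close>

definition core :: "'a set" where
  "core = generate G {edge_elt a x |a x. a \<in> A \<and> x \<in> boundary}"

text \<open>The edges at boundary vertices of every colour are included, so that \<open>core\<close>
  lies in each factor, even in one whose colour does not occur.\<close>

definition factor :: "nat \<Rightarrow> 'a set" where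
  "factor j = generate G {edge_elt a x |a x. a \<in> A \<and> x \<in> lcosets H \<and> (x \<in> boundary \<or> part x = j)}"

lemma boundary_cosets: "boundary \<subseteq> lcosets H" by (auto simp: boundary_def)

lemma core_subset_factor: "core \<subseteq> factor j"
  unfolding core_def factor_def using boundary_cosets by (intro mono_generate) auto

lemma factor_subgroup: "subgroup (factor j) G"
  unfolding factor_def using edge_elt_in_H H_sub by (intro generate_is_subgroup) auto

lemma core_subgroup: "subgroup core G"
  unfolding core_def using edge_elt_in_H H_sub boundary_cosets
  by (intro generate_is_subgroup) (auto 4 4)

lemma factor_H: "factor j \<subseteq> H"
  unfolding factor_def using edge_elt_in_H by (intro generate_subgroup_incl[OF _ H]) auto

abbreviation letters :: "(nat \<times> 'a) set" where
  "letters \<equiv> SIGMA j:{..<k}. factor j"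

definition amalgam_rules :: "((nat \<times> 'a) list \<times> (nat \<times> 'a) list) set" where
  "amalgam_rules = {([(i, \<one>)], []) |i. i < k}
        \<union> {([(i, g), (i, h)], [(i, g \<otimes> h)]) |i g h. i < k \<and> g \<in> factor i \<and> h \<in> factor i}
        \<union> {([(i, l)], [(j, l)]) |i j l. i < k \<and> j < k \<and> l \<in> core}"

definition amalgam_cong :: "(nat \<times> 'a) list \<Rightarrow> (nat \<times> 'a) list \<Rightarrow> bool" (infix "\<sim>" 50) where
  "u \<sim> v \<longleftrightarrow> (u, v) \<in> word_cong letters amalgam_rules"

lemma amalgam_rule: "(u, v) \<in> amalgam_rules \<Longrightarrow> u \<in> lists letters \<Longrightarrow> v \<in> lists letters \<Longrightarrow> u \<sim> v"
  unfolding amalgam_cong_def by (rule word_cong_rule)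

lemma cong_refl: "u \<in> lists letters \<Longrightarrow> u \<sim> u"
  unfolding amalgam_cong_def by (rule word_cong.refl)

lemma cong_sym: "u \<sim> v \<Longrightarrow> v \<sim> u"
  unfolding amalgam_cong_def by (rule word_cong.sym)

lemma cong_trans [trans]: "u \<sim> v \<Longrightarrow> v \<sim> w \<Longrightarrow> u \<sim> w"
  unfolding amalgam_cong_def by (rule word_cong.trans)

lemma cong_append: "u \<sim> v \<Longrightarrow> u' \<sim> v' \<Longrightarrow> u @ u' \<sim> v @ v'"
  unfolding amalgam_cong_def by (rule word_cong_append)

text \<open>Words act from the right end, so the last letter is the first edge of the path.\<close>

fun path_word :: "'x list \<Rightarrow> 'a set \<Rightarrow> (nat \<times> 'a) list" where
  "path_word [] x = []"
| "path_word (a # u) x = (part (ev u \<triangleright> x), edge_elt a (ev u \<triangleright> x)) # path_word u x"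

lemma factor_one: "\<one> \<in> factor j" using subgroup.one_closed[OF factor_subgroup] .
lemma factor_mult: "g \<in> factor j \<Longrightarrow> h \<in> factor j \<Longrightarrow> g \<otimes> h \<in> factor j"
  using subgroup.m_closed[OF factor_subgroup] .
lemma factor_inv: "g \<in> factor j \<Longrightarrow> inv g \<in> factor j"
  using subgroup.m_inv_closed[OF factor_subgroup] .

lemma edge_elt_factor:
  "a \<in> A \<Longrightarrow> x \<in> lcosets H \<Longrightarrow> x \<in> boundary \<or> part x = j \<Longrightarrow> edge_elt a x \<in> factor j"
  unfolding factor_def by (rule generate.incl) blast

lemma edge_elt_core: "a \<in> A \<Longrightarrow> x \<in> boundary \<Longrightarrow> edge_elt a x \<in> core"
  unfolding core_def by (rule generate.incl) blast

lemma path_word_lists: "u \<in> lists A \<Longrightarrow> x \<in> lcosets H \<Longrightarrow> path_word u x \<in> lists letters"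
  by (induction u) (auto intro!: edge_elt_factor part act_coset ev_closed)

lemma path_word_append:
  "u \<in> lists A \<Longrightarrow> v \<in> lists A \<Longrightarrow> x \<in> lcosets H \<Longrightarrow>
    path_word (u @ v) x = path_word u (ev v \<triangleright> x) @ path_word v x"
  by (induction u) (auto simp: ev_append_act simp del: in_lists_conv_set)

lemma word_value_Nil [simp]: "word_value G [] = \<one>"
  and word_value_Cons [simp]: "word_value G ((i, h) # p) = h \<otimes> word_value G p"
  by (simp_all add: word_value_def)

lemma word_value_H: "p \<in> lists letters \<Longrightarrow> word_value G p \<in> H"
  using factor_H subgroup.one_closed[OF H] subgroup.m_closed[OF H]
  by (induction p) (auto simp: subset_iff)

lemma word_value_closed: "p \<in> lists letters \<Longrightarrow> word_value G p \<in> carrier G"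
  using word_value_H H_sub by blast

lemma word_value_append:
  "p \<in> lists letters \<Longrightarrow> q \<in> lists letters \<Longrightarrow> word_value G (p @ q) = word_value G p \<otimes> word_value G q"
proof (induction p)
  case (Cons l p)
  then obtain j g where l: "l = (j, g)" "g \<in> factor j" by (cases l) auto
  then show ?case using Cons word_value_closed factor_H[of j] H_sub
    by (auto simp: m_assoc subset_iff simp del: in_lists_conv_set)
qed (simp add: word_value_closed)

text \<open>The transversal elements of consecutive edges cancel, and only those at the two ends
  remain.\<close>

lemma word_value_path_word:
  assumes "u \<in> lists A" "x \<in> lcosets H"
  shows "word_value G (path_word u x) = inv (transversal (ev u \<triangleright> x)) \<otimes> ev u \<otimes> transversal x"
  using assms(1)
proof (induction u rule: list.induct)
  case Nil
  then show ?case using assms(2) by (simp add: act_one)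
next
  case (Cons a u)
  from Cons.prems have u: "a \<in> A" "u \<in> lists A" by simp_all
  define y where "y = ev u \<triangleright> x"
  have y: "y \<in> lcosets H" using u assms(2) by (simp add: y_def del: in_lists_conv_set)
  have a: "ev [a] \<in> carrier G" by (rule ev_closed) (use u in simp)
  have uc: "ev u \<in> carrier G" using u(2) by (rule ev_closed)
  have ay: "ev [a] \<triangleright> y \<in> lcosets H" using a y by simp
  have eq: "ev (a # u) \<triangleright> x = ev [a] \<triangleright> y"
    using ev_append_act[of "[a]" u x] u assms(2) by (simp add: y_def)
  have "word_value G (path_word (a # u) x)
     = (inv (transversal (ev [a] \<triangleright> y)) \<otimes> ev [a] \<otimes> transversal y) \<otimes> (inv (transversal y) \<otimes> ev u \<otimes> transversal x)"
    using Cons.IH[OF u(2)] by (simp add: edge_elt_def y_def)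
  also have "\<dots> = inv (transversal (ev [a] \<triangleright> y)) \<otimes> (ev [a] \<otimes> ev u) \<otimes> transversal x"
  proof -
    have "(p \<otimes> q \<otimes> r) \<otimes> (inv r \<otimes> s \<otimes> t) = p \<otimes> (q \<otimes> s) \<otimes> t"
      if "p \<in> carrier G" "q \<in> carrier G" "r \<in> carrier G" "s \<in> carrier G" "t \<in> carrier G" for p q r s t
      using that by (simp add: m_assoc) (simp add: m_assoc[symmetric])
    then show ?thesis using a ay y uc assms(2) by simp
  qed
  finally show ?case using eq ev_Cons[OF u] by simp
qed

lemma amalgam_one: "j < k \<Longrightarrow> [(j, \<one>)] \<sim> []"
  by (rule amalgam_rule) (auto simp: amalgam_rules_def factor_one)

lemma amalgam_merge: "j < k \<Longrightarrow> g \<in> factor j \<Longrightarrow> h \<in> factor j \<Longrightarrow> [(j, g), (j, h)] \<sim> [(j, g \<otimes> h)]"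
  by (rule amalgam_rule) (auto simp: amalgam_rules_def factor_mult)

lemma amalgam_transfer: "i < k \<Longrightarrow> j < k \<Longrightarrow> g \<in> core \<Longrightarrow> [(i, g)] \<sim> [(j, g)]"
  using core_subset_factor by (intro amalgam_rule) (auto simp: amalgam_rules_def)

text \<open>A letter from \<open>core\<close> may be moved to the factor \<open>j\<close>, the
  others are there already, and then all of them multiply together. Up to congruence such words are
  thus determined by their value.\<close>

lemma collapse_word:
  assumes "j < k"
  shows "p \<in> lists letters \<Longrightarrow> (\<And>i g. (i, g) \<in> set p \<Longrightarrow> i = j \<or> g \<in> core) \<Longrightarrow>
    word_value G p \<in> factor j \<and> p \<sim> [(j, word_value G p)]"
proof (induction p)
  case Nil
  show ?case using cong_sym[OF amalgam_one[OF assms]] by (simp add: factor_one)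
next
  case (Cons l p)
  obtain i g where l: "l = (i, g)" by (cases l)
  have ig: "i < k" "g \<in> factor i" and p: "p \<in> lists letters" using Cons.prems(1) l by auto
  have IH: "word_value G p \<in> factor j" "p \<sim> [(j, word_value G p)]"
    using Cons.IH[OF p] Cons.prems(2) by (meson list.set_intros(2))+
  have or: "i = j \<or> g \<in> core" using Cons.prems(2) l by auto
  have g: "g \<in> factor j" using or ig core_subset_factor by auto
  have "[(i, g)] \<sim> [(j, g)]"
    using or amalgam_transfer[OF ig(1) assms] cong_refl[of "[(j, g)]"] assms g by auto
  from cong_append[OF this IH(2)]
  have "l # p \<sim> [(j, g), (j, word_value G p)]" by (simp add: l)
  also have "\<dots> \<sim> [(j, g \<otimes> word_value G p)]"
    using assms g IH(1) by (rule amalgam_merge)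
  finally show ?case using g IH(1) by (simp add: l factor_mult)
qed

lemma path_word_letter:
  "l \<in> set (path_word u x) \<Longrightarrow> \<exists>s a. suffix s u \<and> a \<in> set u \<and> l = (part (ev s \<triangleright> x), edge_elt a (ev s \<triangleright> x))"
proof (induction u)
  case (Cons a u)
  then show ?case by (auto intro: suffix_ConsI)
qed simp

text \<open>Going back along \<open>s\<close> is one of the translations in
  \<open>relator_shifts\<close>, and outside \<open>boundary\<close> these preserve the
  colour.\<close>

lemma relator_position:
  assumes "(u, v) \<in> R" "suffix s u \<or> suffix s v" "x \<in> lcosets H"
  shows "part (ev s \<triangleright> x) = part x \<or> ev s \<triangleright> x \<in> boundary"
proof (rule disjCI)
  assume "ev s \<triangleright> x \<notin> boundary"
  have s: "s \<in> relator_suffixes" using assms by (auto simp: relator_suffixes_def)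
  then have sl: "s \<in> lists A" using relator_suffixes_lists by blast
  then have "inv (ev s) \<triangleright> (ev s \<triangleright> x) = x" using assms(3)
    by (simp add: act_act act_one del: in_lists_conv_set)
  moreover have "inv (ev s) \<in> relator_shifts" using s by (simp add: relator_shifts_def)
  moreover have "ev s \<triangleright> x \<in> lcosets H" using sl assms(3) by (simp del: in_lists_conv_set)
  ultimately show "part (ev s \<triangleright> x) = part x"
    using \<open>ev s \<triangleright> x \<notin> boundary\<close> unfolding boundary_def by (simp (no_asm_use)) metis
qed

text \<open>Read from \<open>x\<close>, either side of a relator has its letters in the factor of
  \<open>part x\<close> or in \<open>core\<close>. So it collapses to a single letter of that
  factor, and the two letters agree because the values of \<open>u\<close> and \<open>v\<close>
  do.\<close>

lemma path_word_relator:
  assumes "(u, v) \<in> R" "x \<in> lcosets H"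
  shows "path_word u x \<sim> path_word v x"
proof -
  have uv: "u \<in> lists A" "v \<in> lists A" using assms(1) R_lists by auto
  have px: "part x < k" using part assms(2) by simp
  have *: "path_word w x \<sim> [(part x, word_value G (path_word w x))]" if w: "w = u \<or> w = v" for w
  proof -
    have wl: "w \<in> lists A" using w uv by auto
    have "i = part x \<or> g \<in> core" if ig: "(i, g) \<in> set (path_word w x)" for i g
    proof -
      obtain s a where s: "suffix s w" "a \<in> set w" "i = part (ev s \<triangleright> x)" "g = edge_elt a (ev s \<triangleright> x)"
        using path_word_letter[OF ig] by auto
      show ?thesis using relator_position[OF assms(1) _ assms(2), of s] s w wl edge_elt_core by auto
    qed
    then show ?thesis using collapse_word[OF px path_word_lists[OF wl assms(2)]] by blast
  qed
  have "ev u = ev v" using ev_eq_iff[OF uv] word_cong_rule[OF assms(1) uv] by simp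
  then have "word_value G (path_word u x) = word_value G (path_word v x)"
    using word_value_path_word uv assms(2) by simp
  moreover have "path_word v x \<sim> [(part x, word_value G (path_word v x))]" by (rule *) simp
  moreover have "path_word u x \<sim> [(part x, word_value G (path_word u x))]" by (rule *) simp
  ultimately show ?thesis by (metis cong_sym cong_trans)
qed

text \<open>Homotopy invariance of paths in the covering complex: applying a relator inside a word
  changes only the letters along that relator, and these by a congruence.\<close>

lemma path_word_cong:
  assumes "u \<in> lists A" "v \<in> lists A" "ev u = ev v" "x \<in> lcosets H"
  shows "path_word u x \<sim> path_word v x"
proof -
  have "(u, v) \<in> word_cong A R" using assms ev_eq_iff by blast
  then show ?thesis using assms(4)
  proof (induction arbitrary: x rule: word_cong.induct)
    case (step u v p q)
    \<comment> \<open>Both sides of the relator end at the same vertex, so the prefix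
      \<open>p\<close> contributes the same letters in both cases.\<close>
    have "ev u = ev v" using ev_eq_iff[OF step(2,3)] word_cong_rule[OF step(1-3)] by simp
    have q: "ev q \<triangleright> x \<in> lcosets H" using step by (simp del: in_lists_conv_set)
    have "path_word (p @ w @ q) x = path_word p (ev w \<triangleright> (ev q \<triangleright> x)) @ path_word w (ev q \<triangleright> x) @ path_word q x"
      if "w \<in> lists A" for w
      using that step by (simp add: path_word_append ev_append_act append_in_lists_conv del: in_lists_conv_set)
    moreover have "path_word p (ev v \<triangleright> (ev q \<triangleright> x)) @ path_word u (ev q \<triangleright> x) @ path_word q x
        \<sim> path_word p (ev v \<triangleright> (ev q \<triangleright> x)) @ path_word v (ev q \<triangleright> x) @ path_word q x"
      using step q by (intro cong_append path_word_relator cong_refl path_word_lists act_coset ev_closed)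
    ultimately show ?case using step \<open>ev u = ev v\<close> by simp
  next
    case (refl w)
    then show ?case by (intro cong_refl path_word_lists)
  qed (blast intro: cong_sym cong_trans)+
qed

text \<open>Along an edge of the tree the transversal grows by exactly that edge, so each letter is
  the unit of its factor.\<close>

lemma tree_path_word: "x \<in> lcosets H \<Longrightarrow> path_word (tree_word x) H \<sim> []"
proof (induction rule: tree_word_induct)
  case root
  show ?case by (simp add: cong_refl)
next
  case (step a y)
  have y: "ev (tree_word y) \<triangleright> H = y" using step by (simp add: tree_word_act)
  have a: "ev [a] \<in> carrier G" using step by simp
  have "transversal (ev [a] \<triangleright> y) = ev [a] \<otimes> transversal y"
    using step ev_Cons[OF _ tree_word_lists] by (simp add: transversal_def)
  then have "edge_elt a y = \<one>"
    using a step by (simp add: edge_elt_def m_assoc)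
  then have "path_word (tree_word (ev [a] \<triangleright> y)) H = [(part y, \<one>)] @ path_word (tree_word y) H"
    using step y by simp
  also have "\<dots> \<sim> [] @ []"
    using step part by (intro cong_append amalgam_one)
  finally show ?case by simp
qed

text \<open>The loop runs along the tree to \<open>x\<close>, crosses the edge, and returns by any
  word whose value is inverse to that of the tree path to its end. Both outer pieces are congruent
  to the empty word; at a boundary vertex the remaining letter is moved from its own colour to
  \<open>j\<close>.\<close>

lemma closed_path_edge:
  assumes "j < k" "a \<in> A" "x \<in> lcosets H" "x \<in> boundary \<or> part x = j"
  shows "\<exists>w\<in>lists A. ev w \<in> H \<and> [(j, edge_elt a x)] \<sim> path_word w H"
proof -
  define z where "z = ev [a] \<triangleright> x"
  have a: "ev [a] \<in> carrier G" "[a] \<in> lists A" using assms by auto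
  have z: "z \<in> lcosets H" using a assms by (simp add: z_def)
  note twz = tree_word_lists[OF z] and twx = tree_word_lists[OF assms(3)]
  obtain w where w: "w \<in> lists A" "ev w = inv (transversal z)"
    using ev_inverse_word[OF twz] unfolding transversal_def by metis
  have "ev (w @ tree_word z) = ev []"
    using w twz z unfolding transversal_def[symmetric] by (simp add: ev_append transversal_def[symmetric] del: in_lists_conv_set)
  then have "path_word (w @ tree_word z) H \<sim> path_word [] H"
    using w twz H_coset by (intro path_word_cong) auto
  then have "path_word w z @ path_word (tree_word z) H \<sim> []"
    using path_word_append[OF w(1) twz H_coset] tree_word_act[OF z] by simp
  moreover have "path_word w z @ path_word (tree_word z) H \<sim> path_word w z @ []"
    using tree_path_word[OF z] path_word_lists[OF w(1) z] by (intro cong_append cong_refl)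
  then have "path_word w z \<sim> path_word w z @ path_word (tree_word z) H"
    using cong_sym by fastforce
  ultimately have wz: "path_word w z \<sim> []" by (rule cong_trans[rotated])
  have split: "path_word (w @ [a] @ tree_word x) H
      = path_word w z @ [(part x, edge_elt a x)] @ path_word (tree_word x) H"
    using w(1) twx a H_coset assms(3) tree_word_act[OF assms(3)]
    by (simp add: path_word_append ev_append_act z_def del: in_lists_conv_set append_Cons append_Nil)
      (simp add: act_one)
  have fac: "edge_elt a x \<in> factor (part x)" "edge_elt a x \<in> factor j" "part x < k"
    using assms edge_elt_factor part by auto
  have "[(j, edge_elt a x)] \<sim> [(part x, edge_elt a x)]"
    using assms(4)
  proof
    assume "x \<in> boundary"
    then show ?thesis using amalgam_transfer assms edge_elt_core fac by simp
  next
    assume "part x = j"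
    then show ?thesis using fac by (auto intro: cong_refl)
  qed
  also have "\<dots> = [] @ [(part x, edge_elt a x)] @ []" by simp
  also have "\<dots> \<sim> path_word w z @ [(part x, edge_elt a x)] @ path_word (tree_word x) H"
    using fac by (intro cong_append cong_sym[OF wz] cong_refl
        cong_sym[OF tree_path_word[OF assms(3)]]) auto
  finally have "[(j, edge_elt a x)] \<sim> path_word (w @ [a] @ tree_word x) H"
    using split by simp
  moreover have "ev (w @ [a] @ tree_word x) = ev w \<otimes> (ev [a] \<otimes> ev (tree_word x))"
    using w(1) twx a(2) by (simp only: ev_append append_in_lists_conv simp_thms)
  then have "ev (w @ [a] @ tree_word x) = edge_elt a x"
    using w(2) a(1) assms(3) z unfolding edge_elt_def z_def[symmetric]
    by (simp add: m_assoc transversal_def[symmetric])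
  ultimately show ?thesis
    using w(1) twx a(2) edge_elt_in_H[OF assms(2,3)]
    by (intro bexI[of _ "w @ [a] @ tree_word x"]) auto
qed

lemma path_word_closed_append:
  assumes "w \<in> lists A" "w' \<in> lists A" "ev w' \<in> H"
  shows "path_word (w @ w') H = path_word w H @ path_word w' H"
  using path_word_append[OF assms(1,2) H_coset] stabilizer_H[of "ev w'"] assms by auto

text \<open>Induction over the generation of the factor: edge generators come from loops, products
  from concatenated loops, and inverses from a loop with inverse value.\<close>

lemma closed_path_letter:
  assumes "j < k" "g \<in> factor j"
  shows "\<exists>w\<in>lists A. ev w \<in> H \<and> [(j, g)] \<sim> path_word w H"
  using assms(2)[unfolded factor_def]
proof (induction rule: generate.induct)
  case one
  show ?case using amalgam_one[OF assms(1)] subgroup.one_closed[OF H]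
    by (intro bexI[of _ "[]"]) auto
next
  case (incl h)
  then show ?case using closed_path_edge[OF assms(1)] by blast
next
  case (inv h)
  then have "h \<in> factor j" unfolding factor_def by (rule generate.incl)
  then have hf: "h \<in> factor j" "inv h \<in> factor j" "h \<in> carrier G"
    using factor_inv factor_H H_sub by blast+
  obtain w where w: "w \<in> lists A" "ev w \<in> H" "[(j, h)] \<sim> path_word w H"
    using inv closed_path_edge[OF assms(1)] by blast
  obtain v where v: "v \<in> lists A" "ev v = inv (ev w)" using ev_inverse_word[OF w(1)] .
  have "ev v \<in> H" using v w subgroup.m_inv_closed[OF H] by simp
  have "path_word (v @ w) H \<sim> path_word [] H"
    using v w H_coset by (intro path_word_cong) (auto simp: ev_append simp del: in_lists_conv_set)
  then have vw: "path_word v H @ path_word w H \<sim> []"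
    using path_word_closed_append[OF v(1) w(1,2)] by simp
  have pl: "path_word v H \<in> lists letters" "[(j, inv h)] \<in> lists letters" "[(j, h)] \<in> lists letters"
    using path_word_lists[OF v(1) H_coset] assms(1) hf by auto
  \<comment> \<open>Uniqueness of inverses modulo the congruence: \<open>path_word v H\<close>
    cancels the letter of \<open>h\<close> from the left, and the letter of \<open>inv h\<close>
    cancels it from the right.\<close>
  have "[(j, inv h)] = [] @ [(j, inv h)]" by simp
  also have "\<dots> \<sim> (path_word v H @ path_word w H) @ [(j, inv h)]"
    by (intro cong_append cong_sym[OF vw] cong_refl pl)
  also have "\<dots> = path_word v H @ (path_word w H @ [(j, inv h)])" by simp
  also have "\<dots> \<sim> path_word v H @ ([(j, h)] @ [(j, inv h)])"
    by (intro cong_append cong_sym[OF w(3)] cong_refl pl)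
  also have "\<dots> \<sim> path_word v H @ [(j, \<one>)]"
    using amalgam_merge[OF assms(1) hf(1,2)] hf(3) by (intro cong_append cong_refl pl) simp
  also have "\<dots> \<sim> path_word v H @ []"
    by (intro cong_append cong_refl pl amalgam_one assms(1))
  finally show ?case using v(1) \<open>ev v \<in> H\<close> by auto
next
  case (eng h1 h2)
  then obtain w1 w2 where w: "w1 \<in> lists A" "ev w1 \<in> H" "[(j, h1)] \<sim> path_word w1 H"
     "w2 \<in> lists A" "ev w2 \<in> H" "[(j, h2)] \<sim> path_word w2 H" by blast
  have "[(j, h1 \<otimes> h2)] \<sim> [(j, h1)] @ [(j, h2)]"
    using eng(1,2) amalgam_merge[OF assms(1)] unfolding factor_def
    by (simp add: cong_sym)
  also have "\<dots> \<sim> path_word w1 H @ path_word w2 H"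
    by (intro cong_append w)
  also have "\<dots> = path_word (w1 @ w2) H" using path_word_closed_append w by simp
  finally show ?case
    using w subgroup.m_closed[OF H] by (intro bexI[of _ "w1 @ w2"]) (auto simp: ev_append simp del: in_lists_conv_set)
qed

lemma closed_path_exists:
  "p \<in> lists letters \<Longrightarrow> \<exists>w\<in>lists A. ev w \<in> H \<and> p \<sim> path_word w H"
proof (induction p)
  case Nil
  show ?case using subgroup.one_closed[OF H] by (intro bexI[of _ "[]"]) (auto intro: cong_refl)
next
  case (Cons l p)
  obtain w1 where w1: "w1 \<in> lists A" "ev w1 \<in> H" "p \<sim> path_word w1 H" using Cons by auto
  obtain w2 where w2: "w2 \<in> lists A" "ev w2 \<in> H" "[l] \<sim> path_word w2 H"
  proof -
    have "fst l < k" "snd l \<in> factor (fst l)" using Cons.prems by auto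
    from closed_path_letter[OF this] that show thesis by auto
  qed
  have "l # p \<sim> path_word (w2 @ w1) H"
    using cong_append[OF w2(3) w1(3)] path_word_closed_append w1 w2 by simp
  then show ?case using w1 w2 subgroup.m_closed[OF H]
    by (intro bexI[of _ "w2 @ w1"]) (auto simp: ev_append simp del: in_lists_conv_set)
qed

lemma word_value_closed_path:
  "w \<in> lists A \<Longrightarrow> ev w \<in> H \<Longrightarrow> word_value G (path_word w H) = ev w"
  using word_value_path_word[OF _ H_coset, of w] stabilizer_H[of "ev w"] by (simp del: in_lists_conv_set)

lemma word_value_cong: "p \<sim> q \<Longrightarrow> word_value G p = word_value G q"
  unfolding amalgam_cong_def
proof (induction rule: word_cong.induct)
  case (step u v p q)
  have "word_value G u = word_value G v"
    using step(1) factor_H H_sub core_subset_factor unfolding amalgam_rules_def by (fastforce simp: subset_iff)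
  then show ?case using step(2-) by (simp add: word_value_append append_in_lists_conv del: in_lists_conv_set)
qed auto

text \<open>For injectivity both words are replaced by words of closed paths. Equal values mean that
  these paths evaluate to the same group element, and \<open>path_word_cong\<close> applies. For
  surjectivity an element of \<open>H\<close> is read along any word that evaluates to it.\<close>

lemma amalgam_map_iso:
  "amalgam_map (G\<lparr>carrier := H\<rparr>) \<in> iso (amalgamated_product (G\<lparr>carrier := H\<rparr>) core k factor) (G\<lparr>carrier := H\<rparr>)"
proof -
  let ?C = "word_cong letters amalgam_rules"
  let ?f = "amalgam_map (G\<lparr>carrier := H\<rparr>)"
  have Q: "amalgamated_product (G\<lparr>carrier := H\<rparr>) core k factor = word_quotient letters amalgam_rules"
    by (simp add: amalgamated_product_def amalgam_rules_def)
  have car: "carrier (word_quotient letters amalgam_rules) = lists letters // ?C"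
    by (simp add: word_quotient_def)
  have val: "?f (?C `` {p}) = word_value G p" if "p \<in> lists letters" for p
  proof -
    have "word_value (G\<lparr>carrier := H\<rparr>) = word_value G"
      by (simp add: word_value_def fun_eq_iff)
    moreover have "word_value G ` (?C `` {p}) = {word_value G p}"
    proof -
      have "word_value G q = word_value G p" if "q \<in> ?C `` {p}" for q
        using that word_value_cong[of p q] by (simp add: amalgam_cong_def)
      moreover have "p \<in> ?C `` {p}" using cong_refl[OF \<open>p \<in> lists letters\<close>] by (simp add: amalgam_cong_def)
      ultimately show ?thesis by blast
    qed
    ultimately show ?thesis by (simp add: amalgam_map_def)
  qed
  have "?f \<in> hom (word_quotient letters amalgam_rules) (G\<lparr>carrier := H\<rparr>)"
  proof (rule homI)
    fix x assume "x \<in> carrier (word_quotient letters amalgam_rules)"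
    then obtain p where "p \<in> lists letters" "x = ?C `` {p}" unfolding car by (rule quotientE)
    then show "?f x \<in> carrier (G\<lparr>carrier := H\<rparr>)" using val[of p] word_value_H[of p] by simp
  next
    fix x y assume "x \<in> carrier (word_quotient letters amalgam_rules)"
      "y \<in> carrier (word_quotient letters amalgam_rules)"
    then obtain p q where "p \<in> lists letters" "x = ?C `` {p}" "q \<in> lists letters" "y = ?C `` {q}"
      unfolding car by (metis quotientE)
    then show "?f (x \<otimes>\<^bsub>word_quotient letters amalgam_rules\<^esub> y) = ?f x \<otimes>\<^bsub>G\<lparr>carrier := H\<rparr>\<^esub> ?f y"
      using val[of "p @ q"] val[of p] val[of q] word_quotient_mult[of p letters q amalgam_rules]
      by (simp add: word_value_append append_in_lists_conv del: in_lists_conv_set)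
  qed
  moreover have "inj_on ?f (lists letters // ?C)"
  proof (rule inj_onI)
    fix x y assume "x \<in> lists letters // ?C" "y \<in> lists letters // ?C" and eq: "?f x = ?f y"
    then obtain p q where pq: "p \<in> lists letters" "x = ?C `` {p}" "q \<in> lists letters" "y = ?C `` {q}"
      by (metis quotientE)
    obtain w v where w: "w \<in> lists A" "ev w \<in> H" "p \<sim> path_word w H"
      and v: "v \<in> lists A" "ev v \<in> H" "q \<sim> path_word v H"
      using closed_path_exists pq by metis
    have "ev w = ev v"
      using eq val pq word_value_cong[OF w(3)] word_value_cong[OF v(3)]
        word_value_closed_path[OF w(1,2)] word_value_closed_path[OF v(1,2)] by simp
    then have "p \<sim> q"
      using path_word_cong[OF w(1) v(1) _ H_coset] w(3) v(3) by (metis cong_sym cong_trans)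
    then show "x = y" using pq equiv_class_eq[OF equiv_word_cong] unfolding amalgam_cong_def by metis
  qed
  moreover have "?f ` (lists letters // ?C) = H"
  proof
    show "?f ` (lists letters // ?C) \<subseteq> H"
    proof
      fix h assume "h \<in> ?f ` (lists letters // ?C)"
      then obtain x where x: "x \<in> lists letters // ?C" "h = ?f x" by blast
      from x(1) obtain p where "p \<in> lists letters" "x = ?C `` {p}" by (rule quotientE)
      then show "h \<in> H" using val[of p] word_value_H[of p] x(2) by simp
    qed
    show "H \<subseteq> ?f ` (lists letters // ?C)"
    proof
      fix h assume h: "h \<in> H"
      then obtain w where w: "w \<in> lists A" "ev w = h" using ev_surj H_sub by (metis imageE subsetD)
      have "?f (?C `` {path_word w H}) = h"
        using val[OF path_word_lists[OF w(1) H_coset]] word_value_closed_path[of w] w h by simp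
      then show "h \<in> ?f ` (lists letters // ?C)"
        using quotientI[OF path_word_lists[OF w(1) H_coset]] by (metis imageI)
    qed
  qed
  ultimately show ?thesis by (simp add: iso_def bij_betw_def Q car)
qed

section \<open>Generators of a subgroup without a non-trivial splitting\<close>

lemma small_index_coset:
  assumes "finite (lcosets\<^bsub>(G\<lparr>carrier := factor j\<rparr>)\<^esub> core)" "card (lcosets\<^bsub>(G\<lparr>carrier := factor j\<rparr>)\<^esub> core) < 3"
  shows "\<exists>g\<in>factor j. factor j \<subseteq> core \<union> (g \<triangleright> core)"
proof (cases "factor j \<subseteq> core")
  case True
  then show ?thesis using factor_one by auto
next
  case False
  then obtain g where g: "g \<in> factor j" "g \<notin> core" by auto
  let ?C = "lcosets\<^bsub>(G\<lparr>carrier := factor j\<rparr>)\<^esub> core"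
  have fc: "x \<in> factor j \<Longrightarrow> x \<in> carrier G" for x using factor_H H_sub by blast
  have mem: "x \<triangleright> core \<in> ?C" "x \<in> x \<triangleright> core" if "x \<in> factor j" for x
    using that lcos_self[OF fc[OF that] core_subgroup] by (auto simp: LCOSETS_def)
  have one: "\<one> \<triangleright> core = core" using lcos_mult_one subgroup.subset[OF core_subgroup] by blast
  have "x \<in> core \<union> (g \<triangleright> core)" if x: "x \<in> factor j" for x
  proof (rule ccontr)
    assume "x \<notin> core \<union> (g \<triangleright> core)"
    then have "card {core, g \<triangleright> core, x \<triangleright> core} = 3"
      using mem[OF x] mem[OF g(1)] g(2) by (auto simp: card_insert_if)
    moreover have "{core, g \<triangleright> core, x \<triangleright> core} \<subseteq> ?C" using mem g x factor_one one by (metis bot.extremum insert_subset)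
    ultimately show False using card_mono[OF assms(1)] assms(2) by (metis not_le)
  qed
  then have "factor j \<subseteq> core \<union> (g \<triangleright> core)" ..
  then show ?thesis using g(1) by blast
qed

text \<open>A factor of index at most 2 over \<open>core\<close> is generated by \<open>core\<close>
  and one coset representative; these representatives account for the summand \<open>k\<close>. The
  generators of the one remaining factor include those of \<open>core\<close>.\<close>

theorem few_generators:
  assumes not: "\<not> nontrivial_amalgamated_product (G\<lparr>carrier := H\<rparr>)"
  shows "\<exists>j<k. min_generators G H \<le> card A * (card {x \<in> lcosets H. part x = j} + card boundary) + k"
proof -
  define big where "big l \<longleftrightarrow> infinite (lcosets\<^bsub>(G\<lparr>carrier := factor l\<rparr>)\<^esub> core) \<or> 3 \<le> card (lcosets\<^bsub>(G\<lparr>carrier := factor l\<rparr>)\<^esub> core)" for l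
  have "\<not> (\<exists>i<k. \<exists>j<k. i \<noteq> j \<and> big i \<and> big j)"
  proof
    assume "\<exists>i<k. \<exists>j<k. i \<noteq> j \<and> big i \<and> big j"
    then have "\<exists>i<k. \<exists>j<k. i \<noteq> j \<and> (\<forall>l\<in>{i, j}. infinite (lcosets\<^bsub>G\<lparr>carrier := H\<rparr>\<lparr>carrier := factor l\<rparr>\<^esub> core)
                      \<or> 3 \<le> card (lcosets\<^bsub>G\<lparr>carrier := H\<rparr>\<lparr>carrier := factor l\<rparr>\<^esub> core))"
      by (simp add: big_def)
    moreover have "subgroup (factor i) (G\<lparr>carrier := H\<rparr>)" for i
      using subgroup_incl[OF factor_subgroup H factor_H] .
    moreover have "subgroup core (G\<lparr>carrier := H\<rparr>)"
      using subgroup_incl[OF core_subgroup H] core_subset_factor factor_H by blast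
    ultimately have "nontrivial_amalgamated_product (G\<lparr>carrier := H\<rparr>)"
      unfolding nontrivial_amalgamated_product_def using amalgam_map_iso core_subset_factor by blast
    then show False using not by simp
  qed
  \<comment> \<open>If no factor is large, any index serves as \<open>j\<close>, so \<open>k\<close>
    has to be positive.\<close>
  moreover have "part H < k" using part H_coset by simp
  ultimately obtain j where j: "j < k" "\<And>i. i < k \<Longrightarrow> i \<noteq> j \<Longrightarrow> \<not> big i" by metis
  then have "\<forall>i. i < k \<and> i \<noteq> j \<longrightarrow> (\<exists>g\<in>factor i. factor i \<subseteq> core \<union> (g \<triangleright> core))"
    using small_index_coset unfolding big_def by (metis not_le)
  then obtain g where g: "\<And>i. i < k \<Longrightarrow> i \<noteq> j \<Longrightarrow> g i \<in> factor i \<and> factor i \<subseteq> core \<union> (g i \<triangleright> core)"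
    by metis
  define E where "E = {edge_elt a x |a x. a \<in> A \<and> x \<in> lcosets H \<and> (x \<in> boundary \<or> part x = j)}"
  define Y where "Y = E \<union> g ` ({..<k} - {j})"
  have E_eq: "E = (\<lambda>(a, x). edge_elt a x) ` (A \<times> (boundary \<union> {x \<in> lcosets H. part x = j}))"
    using boundary_cosets by (auto simp: E_def)
  have fin_b: "finite boundary" using fin_cosets boundary_cosets finite_subset by blast
  have fin_E: "finite E" unfolding E_eq using fin_A fin_b fin_cosets by auto
  have YH: "Y \<subseteq> H" using g factor_H edge_elt_in_H unfolding Y_def E_def by fastforce
  have "card E \<le> card (A \<times> (boundary \<union> {x \<in> lcosets H. part x = j}))"
    unfolding E_eq using fin_A fin_b fin_cosets by (intro card_image_le) auto
  also have "\<dots> \<le> card A * (card {x \<in> lcosets H. part x = j} + card boundary)"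
    using card_Un_le[of boundary "{x \<in> lcosets H. part x = j}"] by (simp add: card_cartesian_product add.commute)
  finally have cE: "card E \<le> card A * (card {x \<in> lcosets H. part x = j} + card boundary)" .
  have "card (g ` ({..<k} - {j})) \<le> k"
    using card_image_le[of "{..<k} - {j}" g] card_mono[of "{..<k}" "{..<k} - {j}"] by simp
  then have cY: "card Y \<le> card A * (card {x \<in> lcosets H. part x = j} + card boundary) + k"
    using cE card_Un_le[of E "g ` ({..<k} - {j})"] unfolding Y_def by linarith
  let ?K = "generate G Y"
  have K: "subgroup ?K G" using generate_is_subgroup YH H_sub by blast
  have fj: "factor j \<subseteq> ?K"
    unfolding factor_def Y_def E_def by (rule mono_generate) blast
  have fi: "factor i \<subseteq> ?K" if "i < k" for i
  proof (cases "i = j")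
    case False
    have "g i \<in> ?K" using that False by (intro generate.incl) (auto simp: Y_def)
    then have "g i \<triangleright> core \<subseteq> ?K"
      using fj core_subset_factor[of j] subgroup.m_closed[OF K] by (auto simp: l_coset_def)
    then show ?thesis using g[OF that False] fj core_subset_factor[of j] by blast
  qed (use fj in simp)
  have wv: "word_value G p \<in> ?K" if "p \<in> lists letters" for p
    using that
  proof (induction p rule: list.induct)
    case (Cons l p)
    obtain i h where l: "l = (i, h)" by (cases l)
    have "h \<in> ?K" using Cons.prems fi[of i] unfolding l by auto
    moreover have "word_value G p \<in> ?K" using Cons by simp
    ultimately show ?case unfolding l word_value_Cons by (rule generate.eng)
  qed (simp add: generate.one)
  have "?K = H"
  proof
    show "?K \<subseteq> H" using generate_subgroup_incl[OF YH H] .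
    show "H \<subseteq> ?K"
    proof
      fix h assume h: "h \<in> H"
      then obtain w where w: "w \<in> lists A" "ev w = h" using ev_surj H_sub by (metis imageE subsetD)
      then show "h \<in> ?K"
        using wv[OF path_word_lists[OF w(1) H_coset]] word_value_closed_path[of w] h by simp
    qed
  qed
  moreover have "finite Y" using fin_E by (simp add: Y_def)
  ultimately have "\<exists>A. finite A \<and> A \<subseteq> H \<and> card A = card Y \<and> generate G A = H"
    using YH by (intro exI[of _ Y]) simp
  then have "min_generators G H \<le> card Y"
    unfolding min_generators_def by (rule Least_le)
  then show "\<exists>j<k. min_generators G H \<le> card A * (card {x \<in> lcosets H. part x = j} + card boundary) + k"
    using cY j(1) by (intro exI[of _ j]) linarith
qed

end

text \<open>\<open>m\<close> and \<open>F\<close> come from one presentation of \<open>G\<close> and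
  are fixed before \<open>H\<close>, \<open>k\<close> and \<open>part\<close>; this uniformity lets
  one bound serve a whole sequence of subgroups.\<close>

theorem finitely_presented_few_generators:
  assumes "group G" "finitely_presented G"
  obtains m :: nat and F where "finite F" "F \<subseteq> carrier G"
    "\<And>H k part. finite_index G H \<Longrightarrow> (\<And>x. x \<in> lcosets\<^bsub>G\<^esub> H \<Longrightarrow> part x < k) \<Longrightarrow>
       \<not> nontrivial_amalgamated_product (G\<lparr>carrier := H\<rparr>) \<Longrightarrow>
       \<exists>j<k. min_generators G H \<le> m * (card {x \<in> lcosets\<^bsub>G\<^esub> H. part x = j}
           + card {x \<in> lcosets\<^bsub>G\<^esub> H. \<exists>g\<in>F. part (l_coset G g x) \<noteq> part x}) + k"
proof -
  obtain A R ev where AR: "finite (A :: (nat \<times> bool) set)" "finite R" "R \<subseteq> lists A \<times> lists A"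
    "\<And>u v. u \<in> lists A \<Longrightarrow> v \<in> lists A \<Longrightarrow> ev (u @ v) = ev u \<otimes>\<^bsub>G\<^esub> ev v"
    "ev ` lists A = carrier G"
    "\<And>u v. u \<in> lists A \<Longrightarrow> v \<in> lists A \<Longrightarrow> ev u = ev v \<longleftrightarrow> (u, v) \<in> word_cong A R"
    by (rule finitely_presented_words[OF assms]) blast
  interpret W: word_presented_group G A R ev
    using assms(1) AR by (intro word_presented_group.intro word_presented_group_axioms.intro)
  show ?thesis
  proof (rule that[of W.relator_shifts "card A"])
    show "finite W.relator_shifts" by (rule W.finite_relator_shifts)
    show "W.relator_shifts \<subseteq> carrier G" by (rule W.relator_shifts_carrier)
  next
    fix H k and part :: "'a set \<Rightarrow> nat"
    assume H: "finite_index G H" and part: "\<And>x. x \<in> lcosets\<^bsub>G\<^esub> H \<Longrightarrow> part x < k"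
      and not: "\<not> nontrivial_amalgamated_product (G\<lparr>carrier := H\<rparr>)"
    interpret C: coset_partition G A R ev H k part
      using H part by (intro coset_partition.intro coset_partition_axioms.intro W.word_presented_group_axioms)
        (auto simp: finite_index_def)
    show "\<exists>j<k. min_generators G H \<le> card A * (card {x \<in> lcosets\<^bsub>G\<^esub> H. part x = j}
           + card {x \<in> lcosets\<^bsub>G\<^esub> H. \<exists>g\<in>W.relator_shifts. part (l_coset G g x) \<noteq> part x}) + k"
      using C.few_generators[OF not] by (simp add: C.boundary_def)
  qed
qed

section \<open>Limits of finitely supported distributions\<close>

text \<open>Bolzano-Weierstrass for one index after the other, followed by a diagonal
  sequence.\<close>

lemma bounded_diagonal_subsequence:
  fixes a :: "'j \<Rightarrow> nat \<Rightarrow> real"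
  assumes "countable C" and bd: "\<And>j n. j \<in> C \<Longrightarrow> \<bar>a j n\<bar> \<le> B j"
  shows "\<exists>\<sigma>::nat \<Rightarrow> nat. strict_mono \<sigma> \<and> (\<forall>j\<in>C. convergent (\<lambda>n. a j (\<sigma> n)))"
proof (cases "C = {}")
  case True
  then show ?thesis using strict_mono_id by auto
next
  case False
  define c where "c = from_nat_into C"
  have c: "c k \<in> C" for k unfolding c_def using False by (rule from_nat_into)
  interpret subseqs "\<lambda>k s. convergent (\<lambda>n. a (c k) (s n))"
  proof
    fix k and s :: "nat \<Rightarrow> nat" assume "strict_mono s"
    have "bounded (range (\<lambda>n. a (c k) (s n)))"
      unfolding bounded_iff using bd[OF c[of k]] by (auto intro!: exI[of _ "B (c k)"])
    from bounded_imp_convergent_subsequence[OF this]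
    obtain l r where "strict_mono (r :: nat \<Rightarrow> nat)" "((\<lambda>n. a (c k) (s n)) \<circ> r) \<longlonglongrightarrow> l" by blast
    then show "\<exists>r. strict_mono r \<and> convergent (\<lambda>n. a (c k) ((s \<circ> r) n))"
      by (auto simp: convergent_def o_def)
  qed
  have *: "convergent (\<lambda>n. a (c k) ((diagseq \<circ> (+) (Suc k)) n))" for k
  proof (rule diagseq_holds)
    fix r s :: "nat \<Rightarrow> nat" and k assume "strict_mono r" "convergent (\<lambda>n. a (c k) (s n))"
    then show "convergent (\<lambda>n. a (c k) ((s \<circ> r) n))"
      using convergent_subseq_convergent[of "\<lambda>n. a (c k) (s n)" r] by (simp add: o_def)
  qed
  have "convergent (\<lambda>n. a (c k) (diagseq n))" for k
    using *[of k] convergent_ignore_initial_segment[of "\<lambda>n. a (c k) (diagseq n)" "Suc k"]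
    by (simp add: o_def add.commute)
  moreover have "\<exists>k. j = c k" if "j \<in> C" for j
    using from_nat_into_surj[OF \<open>countable C\<close> that] by (auto simp: c_def)
  ultimately show ?thesis using subseq_diagseq by blast
qed

text \<open>A finite common support lets no mass escape: the total mass is a finite sum and passes
  to the limit.\<close>

lemma pmf_finite_limit:
  fixes r :: "nat \<Rightarrow> 'a pmf"
  assumes "finite A" and supp: "\<And>n. set_pmf (r n) \<subseteq> A"
    and conv: "\<And>w. w \<in> A \<Longrightarrow> convergent (\<lambda>n. pmf (r n) w)"
  shows "\<exists>p. set_pmf p \<subseteq> A \<and> (\<forall>w. (\<lambda>n. pmf (r n) w) \<longlonglongrightarrow> pmf p w)"
proof -
  define f where "f w = lim (\<lambda>n. pmf (r n) w)" for w
  have zero: "pmf (r n) w = 0" if "w \<notin> A" for n w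
    using that supp by (auto simp: pmf_eq_0_set_pmf)
  have f: "(\<lambda>n. pmf (r n) w) \<longlonglongrightarrow> f w" for w
    using conv[of w] zero[of w] by (cases "w \<in> A") (auto simp: f_def convergent_LIMSEQ_iff)
  have f0: "f w = 0" if "w \<notin> A" for w
    using f[of w] zero[OF that] LIMSEQ_unique[of "\<lambda>_. 0::real"] by auto
  have fp: "0 \<le> f w" for w
    by (rule LIMSEQ_le_const[OF f]) auto
  have "(\<lambda>n. \<Sum>w\<in>A. pmf (r n) w) \<longlonglongrightarrow> (\<Sum>w\<in>A. f w)"
    by (intro tendsto_sum f)
  moreover have "(\<Sum>w\<in>A. pmf (r n) w) = 1" for n
    using sum_pmf_eq_1[OF \<open>finite A\<close> supp] .
  ultimately have sum1: "(\<Sum>w\<in>A. f w) = 1"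
    using LIMSEQ_unique[of "\<lambda>_. 1::real"] by auto
  have nn: "(\<integral>\<^sup>+ w. ennreal (f w) \<partial>count_space UNIV) = 1"
  proof -
    have "(\<integral>\<^sup>+ w. ennreal (f w) \<partial>count_space UNIV) = (\<Sum>w\<in>A. ennreal (f w))"
      by (rule nn_integral_count_space'[OF \<open>finite A\<close>]) (auto simp: f0)
    also have "\<dots> = ennreal (\<Sum>w\<in>A. f w)" using fp by (intro sum_ennreal) auto
    finally show ?thesis by (simp add: sum1)
  qed
  have pf: "pmf (embed_pmf f) w = f w" for w
    by (rule pmf_embed_pmf[OF fp nn])
  show ?thesis
    by (rule exI[of _ "embed_pmf f"]) (use pf f f0 in \<open>auto simp: set_pmf_eq\<close>)
qed

lemma pmf_map_finite:
  assumes "finite A" "set_pmf p \<subseteq> A"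
  shows "pmf (map_pmf h p) w = (\<Sum>v | v \<in> A \<and> h v = w. pmf p v)"
proof -
  have "pmf (map_pmf h p) w = measure (measure_pmf p) (h -` {w})"
    by (simp add: pmf_map)
  also have "\<dots> = measure (measure_pmf p) {v \<in> A. h v = w}"
    by (rule measure_pmf.finite_measure_eq_AE) (use assms(2) in \<open>auto simp: AE_measure_pmf_iff\<close>)
  also have "\<dots> = (\<Sum>v | v \<in> A \<and> h v = w. pmf p v)"
    using assms(1) by (intro measure_measure_pmf_finite) auto
  finally show ?thesis .
qed

text \<open>There are only countably many finite cylinders with values in \<open>K\<close>, so a
  diagonal subsequence makes all their frequencies converge. The limiting marginals are consistent,
  because projecting to fewer coordinates is a finite sum, and Kolmogorov's extension theorem
  assembles them.\<close>

theorem pmf_sequence_cylinder_limit: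
  fixes q :: "nat \<Rightarrow> ('i::countable \<Rightarrow> 'v::polish_space) pmf" and K :: "'i \<Rightarrow> 'v set"
  assumes K: "\<And>i. finite (K i)" and q: "\<And>n z i. z \<in> set_pmf (q n) \<Longrightarrow> z i \<in> K i"
  shows "\<exists>\<sigma> M. strict_mono (\<sigma> :: nat \<Rightarrow> nat) \<and> prob_space M \<and> sets M = sets borel \<and>
    (\<forall>J v. finite J \<longrightarrow> (\<lambda>n. measure_pmf.prob (q (\<sigma> n)) {z. \<forall>i\<in>J. z i = v i})
        \<longlonglongrightarrow> measure M {z. \<forall>i\<in>J. z i = v i})"
proof -
  define r where "r n J = map_pmf (\<lambda>z. restrict z J) (q n)" for n J
  have supp: "set_pmf (r n J) \<subseteq> PiE J K" for n J
    using q by (auto simp: r_def)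
  define C where "C = Sigma (Collect finite) (\<lambda>J. PiE J K)"
  have fin: "finite (PiE J K)" if "finite J" for J
    using that K by (intro finite_PiE) auto
  have "countable (Collect finite :: 'i set set)"
    by (simp add: countable_Collect_finite)
  then have "countable C" unfolding C_def
    using fin by (intro countable_SIGMA) (auto intro: countable_finite)
  from bounded_diagonal_subsequence[OF this, of "\<lambda>(J, w) n. pmf (r n J) w" "\<lambda>_. 1"]
  obtain \<sigma> :: "nat \<Rightarrow> nat" where \<sigma>: "strict_mono \<sigma>"
    and conv: "\<And>J w. finite J \<Longrightarrow> w \<in> PiE J K \<Longrightarrow> convergent (\<lambda>n. pmf (r (\<sigma> n) J) w)"
    by (force simp: C_def pmf_le_1)
  have "\<exists>p. set_pmf p \<subseteq> PiE J K \<and> (\<forall>w. (\<lambda>n. pmf (r (\<sigma> n) J) w) \<longlonglongrightarrow> pmf p w)" if "finite J" for J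
    using fin[OF that] supp conv[OF that] by (intro pmf_finite_limit) auto
  then obtain p where p: "\<And>J. finite J \<Longrightarrow> set_pmf (p J) \<subseteq> PiE J K"
    and lim: "\<And>J w. finite J \<Longrightarrow> (\<lambda>n. pmf (r (\<sigma> n) J) w) \<longlonglongrightarrow> pmf (p J) w"
    by metis
  have marg: "map_pmf (\<lambda>f. restrict f J) (p H) = p J" if "J \<subseteq> H" "finite H" for J H
  proof (rule pmf_eqI)
    fix w
    have "finite J" using that finite_subset by blast
    have "map_pmf (\<lambda>f. restrict f J) (r n H) = r n J" for n
      using \<open>J \<subseteq> H\<close> by (simp add: r_def pmf.map_comp o_def restrict_restrict Int_absorb1)
    then have "(\<lambda>n. pmf (r (\<sigma> n) J) w) = (\<lambda>n. \<Sum>v | v \<in> PiE H K \<and> restrict v J = w. pmf (r (\<sigma> n) H) v)"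
      using pmf_map_finite[OF fin[OF that(2)] supp, of "\<lambda>f. restrict f J" _ w] by metis
    moreover have "\<dots> \<longlonglongrightarrow> (\<Sum>v | v \<in> PiE H K \<and> restrict v J = w. pmf (p H) v)"
      by (intro tendsto_sum lim that)
    moreover have "(\<Sum>v | v \<in> PiE H K \<and> restrict v J = w. pmf (p H) v) = pmf (map_pmf (\<lambda>f. restrict f J) (p H)) w"
      using pmf_map_finite[OF fin[OF that(2)] p[OF that(2)], of "\<lambda>f. restrict f J" w] by simp
    ultimately show "pmf (map_pmf (\<lambda>f. restrict f J) (p H)) w = pmf (p J) w"
      using LIMSEQ_unique lim[OF \<open>finite J\<close>, of w] by metis
  qed
  \<comment> \<open>The extension theorem asks for marginals on products of Borel spaces, whereas a
    \<open>pmf\<close> measures every set.\<close>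
  define P where "P J = distr (measure_pmf (p J)) (PiM J (\<lambda>_. borel)) (\<lambda>f. restrict f J)" for J
  have meas: "(\<lambda>f. restrict f J) \<in> measurable (measure_pmf p') (PiM J (\<lambda>_. borel :: 'v measure))" for J p'
    by (auto simp: measurable_def space_PiM)
  have proj: "P J = distr (P H) (PiM J (\<lambda>_. borel)) (\<lambda>f. restrict f J)" if JH: "J \<subseteq> H" "finite H" for J H
  proof -
    have "distr (P H) (PiM J (\<lambda>_. borel)) (\<lambda>f. restrict f J)
        = distr (measure_pmf (p H)) (PiM J (\<lambda>_. borel)) ((\<lambda>f. restrict f J) \<circ> (\<lambda>f. restrict f H))"
      unfolding P_def using JH
      by (intro distr_distr meas measurable_restrict_subset)
    also have "((\<lambda>f. restrict f J) \<circ> (\<lambda>f. restrict f H)) = ((\<lambda>f. restrict f J) \<circ> (\<lambda>f::'i\<Rightarrow>'v. restrict f J))"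
      using JH by (intro ext) (simp add: Int_absorb1)
    also have "distr (measure_pmf (p H)) (PiM J (\<lambda>_. borel)) \<dots>
        = distr (distr (measure_pmf (p H)) (count_space UNIV) (\<lambda>f. restrict f J)) (PiM J (\<lambda>_. borel)) (\<lambda>f. restrict f J)"
      by (rule distr_distr[symmetric]) (use meas[of J "p H"] in \<open>auto simp: measurable_def space_PiM\<close>)
    also have "distr (measure_pmf (p H)) (count_space UNIV) (\<lambda>f. restrict f J) = measure_pmf (p J)"
      unfolding marg[OF JH(1,2), symmetric] by (simp add: map_pmf_rep_eq)
    also have "distr (measure_pmf (p J)) (PiM J (\<lambda>_. borel)) (\<lambda>f. restrict f J) = P J"
      by (simp only: P_def)
    finally show ?thesis by (rule HOL.sym)
  qed
  have prob: "prob_space (P J)" for J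
    unfolding P_def by (rule measure_pmf.prob_space_distr[OF meas])
  interpret polish_projective UNIV P
    by (intro polish_projective.intro projective_family.intro proj prob)
  have limJ: "measure lim {z. \<forall>i\<in>J. z i = v i} = pmf (p J) (restrict v J)" if "finite J" for J v
  proof -
    have s: "{restrict v J} \<in> sets (PiM J (\<lambda>_. borel))"
    proof -
      have "{restrict v J} = PiE J (\<lambda>i. {v i})" by (auto simp: PiE_def extensional_def fun_eq_iff Pi_def)
      then show ?thesis using that by (auto intro: sets_PiM_I_finite)
    qed
    have "{z. \<forall>i\<in>J. z i = v i} = emb UNIV J {restrict v J}"
      by (auto simp: prod_emb_def fun_eq_iff restrict_def split: if_splits)
    then have "measure lim {z. \<forall>i\<in>J. z i = v i} = measure (P J) {restrict v J}"
      using measure_lim_emb[OF _ that s] by simp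
    also have "\<dots> = measure (measure_pmf (p J)) ((\<lambda>f. restrict f J) -` {restrict v J})"
      unfolding P_def by (subst measure_distr[OF meas s]) simp
    also have "\<dots> = measure (measure_pmf (p J)) {restrict v J}"
      by (rule measure_pmf.finite_measure_eq_AE)
        (use p[OF that] in \<open>auto simp: AE_measure_pmf_iff PiE_def extensional_restrict\<close>)
    finally show ?thesis by (simp add: measure_pmf_single)
  qed
  moreover have qr: "measure_pmf.prob (q n) {z. \<forall>i\<in>J. z i = v i} = pmf (r n J) (restrict v J)" for n J v
  proof -
    have "(\<lambda>z. restrict z J) -` {restrict v J} = {z. \<forall>i\<in>J. z i = v i}"
      by (force simp: fun_eq_iff restrict_def split: if_splits)
    then show ?thesis by (simp add: r_def pmf_map)
  qed
  moreover have "sets lim = sets (borel :: ('i \<Rightarrow> 'v) measure)"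
    using sets_PiM_equal_borel by (simp add: sets_lim)
  moreover have "prob_space lim" by unfold_locales
  ultimately show ?thesis
    using \<sigma> lim by (intro exI[of _ \<sigma>] exI[of _ lim]) (simp add: limJ qr)
qed

section \<open>Almost invariant colourings without strongly ergodic components\<close>

locale pmp_system =
  fixes G :: "('a, 'm) monoid_scheme" (structure) and M :: "'b measure" and f :: "'a \<Rightarrow> 'b \<Rightarrow> 'b"
  assumes pmp: "pmp_action G M f"

sublocale pmp_system \<subseteq> prob_space M
  using pmp by (simp add: pmp_action_def)

sublocale pmp_system \<subseteq> act: group_action G "space M" f
  using pmp by (simp add: pmp_action_def)

sublocale pmp_system \<subseteq> grp: group G
  using act.group_hom by (rule group_hom.axioms(1))

context pmp_system
begin

section \<open>Measure preserving actions and the discrepancy of colourings\<close>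

lemma f_measurable [measurable]: "g \<in> carrier G \<Longrightarrow> f g \<in> measurable M M"
  using pmp by (simp add: pmp_action_def)

lemma f_space: "g \<in> carrier G \<Longrightarrow> x \<in> space M \<Longrightarrow> f g x \<in> space M"
  using measurable_space[OF f_measurable] .

lemma f_mult: "g \<in> carrier G \<Longrightarrow> h \<in> carrier G \<Longrightarrow> x \<in> space M \<Longrightarrow> f (g \<otimes> h) x = f g (f h x)"
  by (rule act.composition_rule)

lemma f_one: "x \<in> space M \<Longrightarrow> f \<one> x = x"
  using act.id_eq_one by (metis restrict_apply')

lemma f_inv: "g \<in> carrier G \<Longrightarrow> x \<in> space M \<Longrightarrow> f (inv g) (f g x) = x"
  using f_mult[of "inv g" g x] f_one by simp

lemma f_inv': "g \<in> carrier G \<Longrightarrow> x \<in> space M \<Longrightarrow> f g (f (inv g) x) = x"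
  using f_mult[of g "inv g" x] f_one by simp

lemma measure_vimage: "g \<in> carrier G \<Longrightarrow> A \<in> sets M \<Longrightarrow> measure M (f g -` A \<inter> space M) = measure M A"
  using pmp measure_distr[OF f_measurable, of g A] by (simp add: pmp_action_def)

lemma image_eq: "g \<in> carrier G \<Longrightarrow> A \<subseteq> space M \<Longrightarrow> f g ` A = {x \<in> space M. f (inv g) x \<in> A}"
  using f_inv f_inv' f_space by (auto simp: image_iff subset_iff) metis

text \<open>Any countable type of colours is allowed; with colours in \<open>bool\<close> this
  measures how far a set is from being invariant.\<close>

definition discrepancy :: "'a \<Rightarrow> ('b \<Rightarrow> 'c :: countable) \<Rightarrow> real" where
  "discrepancy g \<phi> = measure M {x \<in> space M. \<phi> (f g x) \<noteq> \<phi> x}"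

lemma countable_eq_sets:
  fixes \<phi> \<psi> :: "'b \<Rightarrow> 'c :: countable"
  assumes "\<phi> \<in> measurable M (count_space UNIV)" "\<psi> \<in> measurable M (count_space UNIV)"
  shows "{x \<in> space M. \<phi> x = \<psi> x} \<in> sets M" "{x \<in> space M. \<phi> x \<noteq> \<psi> x} \<in> sets M"
proof -
  have "{x \<in> space M. \<phi> x = \<psi> x} = (\<Union>c. (\<phi> -` {c} \<inter> space M) \<inter> (\<psi> -` {c} \<inter> space M))"
    by auto
  also have "\<dots> \<in> sets M"
    by (intro sets.countable_UN'' sets.Int[OF measurable_sets[OF assms(1)] measurable_sets[OF assms(2)]]) auto
  finally show *: "{x \<in> space M. \<phi> x = \<psi> x} \<in> sets M" .
  have "{x \<in> space M. \<phi> x \<noteq> \<psi> x} = space M - {x \<in> space M. \<phi> x = \<psi> x}" by auto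
  then show "{x \<in> space M. \<phi> x \<noteq> \<psi> x} \<in> sets M" using * by auto
qed

lemma shift_measurable: "g \<in> carrier G \<Longrightarrow> \<phi> \<in> measurable M N \<Longrightarrow> (\<lambda>x. \<phi> (f g x)) \<in> measurable M N"
  using measurable_compose[OF f_measurable] .

lemma discrepancy_sets:
  fixes \<phi> :: "'b \<Rightarrow> 'c :: countable"
  assumes "g \<in> carrier G" "\<phi> \<in> measurable M (count_space UNIV)"
  shows "{x \<in> space M. \<phi> (f g x) \<noteq> \<phi> x} \<in> sets M"
  using countable_eq_sets(2)[OF shift_measurable[OF assms] assms(2)] .

lemma discrepancy_nonneg: "0 \<le> discrepancy g \<phi>"
  by (simp add: discrepancy_def)

lemma discrepancy_one: "discrepancy \<one> \<phi> = 0"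
proof -
  have "{x \<in> space M. \<phi> (f \<one> x) \<noteq> \<phi> x} = {}" using f_one by auto
  then show ?thesis unfolding discrepancy_def by (simp only: measure_empty)
qed

lemma discrepancy_inv:
  fixes \<phi> :: "'b \<Rightarrow> 'c :: countable"
  assumes "g \<in> carrier G" "\<phi> \<in> measurable M (count_space UNIV)"
  shows "discrepancy (inv g) \<phi> = discrepancy g \<phi>"
proof -
  have "{x \<in> space M. \<phi> (f (inv g) x) \<noteq> \<phi> x} = f (inv g) -` {x \<in> space M. \<phi> (f g x) \<noteq> \<phi> x} \<inter> space M"
    using f_inv'[OF assms(1)] f_space[of "inv g"] assms(1) by auto
  then show ?thesis
    unfolding discrepancy_def using measure_vimage[OF _ discrepancy_sets[OF assms]] assms by simp
qed

text \<open>If \<open>h\<close> keeps the colour of \<open>x\<close> and \<open>g\<close> keeps that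
  of the image of \<open>x\<close> under \<open>h\<close>, then the product keeps the colour of
  \<open>x\<close>.\<close>

lemma discrepancy_mult:
  fixes \<phi> :: "'b \<Rightarrow> 'c :: countable"
  assumes "g \<in> carrier G" "h \<in> carrier G" "\<phi> \<in> measurable M (count_space UNIV)"
  shows "discrepancy (g \<otimes> h) \<phi> \<le> discrepancy g \<phi> + discrepancy h \<phi>"
proof -
  let ?D = "\<lambda>g. {x \<in> space M. \<phi> (f g x) \<noteq> \<phi> x}"
  have D: "?D g \<in> sets M" "?D h \<in> sets M" using discrepancy_sets assms by auto
  have "discrepancy (g \<otimes> h) \<phi> \<le> measure M ((f h -` ?D g \<inter> space M) \<union> ?D h)"
    unfolding discrepancy_def
  proof (rule finite_measure_mono)
    show "?D (g \<otimes> h) \<subseteq> (f h -` ?D g \<inter> space M) \<union> ?D h"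
      using f_space[OF assms(2)] f_mult[OF assms(1,2)] by auto
    show "(f h -` ?D g \<inter> space M) \<union> ?D h \<in> sets M"
      by (rule sets.Un[OF measurable_sets[OF f_measurable[OF assms(2)] D(1)] D(2)])
  qed
  also have "\<dots> \<le> measure M (f h -` ?D g \<inter> space M) + measure M (?D h)"
    by (rule measure_Un_le[OF measurable_sets[OF f_measurable[OF assms(2)] D(1)] D(2)])
  also have "\<dots> = discrepancy g \<phi> + discrepancy h \<phi>"
    using measure_vimage[OF assms(2) D(1)] by (simp add: discrepancy_def)
  finally show ?thesis .
qed

text \<open>The constant does not depend on the colouring, so colourings almost invariant under the
  generators are almost invariant under every fixed element.\<close>

lemma discrepancy_generate:
  assumes "S \<subseteq> carrier G" "finite S" "g \<in> generate G S"
  shows "\<exists>n::nat. \<forall>\<phi> :: 'b \<Rightarrow> 'c :: countable. \<phi> \<in> measurable M (count_space UNIV) \<longrightarrow>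
    discrepancy g \<phi> \<le> real n * (\<Sum>s\<in>S. discrepancy s \<phi>)"
  using assms(3)
proof (induction rule: generate.induct)
  case one
  show ?case by (intro exI[of _ 0]) (simp add: discrepancy_one)
next
  case (incl h)
  have "discrepancy h \<phi> \<le> (\<Sum>s\<in>S. discrepancy s \<phi>)" for \<phi> :: "'b \<Rightarrow> 'c"
    by (rule member_le_sum) (use incl assms(2) discrepancy_nonneg in auto)
  then show ?case by (intro exI[of _ 1]) simp
next
  case (inv h)
  have "discrepancy h \<phi> \<le> (\<Sum>s\<in>S. discrepancy s \<phi>)" for \<phi> :: "'b \<Rightarrow> 'c"
    by (rule member_le_sum) (use inv assms(2) discrepancy_nonneg in auto)
  moreover have "h \<in> carrier G" using inv assms(1) by blast
  ultimately show ?case by (intro exI[of _ 1]) (simp add: discrepancy_inv)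
next
  case (eng g h)
  then obtain m n :: nat where mn: "\<And>\<phi> :: 'b \<Rightarrow> 'c. \<phi> \<in> measurable M (count_space UNIV) \<Longrightarrow>
      discrepancy g \<phi> \<le> real m * (\<Sum>s\<in>S. discrepancy s \<phi>) \<and> discrepancy h \<phi> \<le> real n * (\<Sum>s\<in>S. discrepancy s \<phi>)"
    by metis
  have gh: "g \<in> carrier G" "h \<in> carrier G" using eng grp.generate_in_carrier[OF assms(1)] by auto
  show ?case
  proof (intro exI[of _ "m + n"] allI impI)
    fix \<phi> :: "'b \<Rightarrow> 'c" assume "\<phi> \<in> measurable M (count_space UNIV)"
    then show "discrepancy (g \<otimes> h) \<phi> \<le> real (m + n) * (\<Sum>s\<in>S. discrepancy s \<phi>)"
      using mn[of \<phi>] discrepancy_mult[OF gh, of \<phi>] by (simp add: ring_distribs)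
  qed
qed

lemma generate_countable:
  assumes "countable S" "S \<subseteq> carrier G"
  shows "countable (generate G S)"
proof -
  have sub: "generate G S \<subseteq> (\<lambda>w. foldr (\<otimes>) w \<one>) ` lists (S \<union> m_inv G ` S)"
  proof
    fix g assume "g \<in> generate G S"
    then show "g \<in> (\<lambda>w. foldr (\<otimes>) w \<one>) ` lists (S \<union> m_inv G ` S)"
    proof (induction rule: generate.induct)
      case one
      show ?case by (rule image_eqI[of _ _ "[]"]) auto
    next
      case (incl h)
      then show ?case using assms(2) by (intro image_eqI[of _ _ "[h]"]) auto
    next
      case (inv h)
      then show ?case using assms(2) by (intro image_eqI[of _ _ "[inv h]"]) auto
    next
      case (eng g h)
      then obtain u v where uv: "u \<in> lists (S \<union> m_inv G ` S)" "g = foldr (\<otimes>) u \<one>"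
        "v \<in> lists (S \<union> m_inv G ` S)" "h = foldr (\<otimes>) v \<one>" by blast
      have cl: "foldr (\<otimes>) w \<one> \<in> carrier G" if "w \<in> lists (S \<union> m_inv G ` S)" for w
        using that by (induction w) (use assms(2) in auto)
      have "foldr (\<otimes>) (w @ v) \<one> = foldr (\<otimes>) w \<one> \<otimes> foldr (\<otimes>) v \<one>" if "w \<in> lists (S \<union> m_inv G ` S)" for w
        using that
      proof (induction w rule: list.induct)
        case (Cons a w)
        have "a \<in> carrier G" using Cons.prems assms(2) by auto
        then show ?case using Cons cl[of w] cl[OF uv(3)] by (simp add: grp.m_assoc)
      qed (use cl[OF uv(3)] in simp)
      then have "foldr (\<otimes>) (u @ v) \<one> = g \<otimes> h" using uv by blast
      then show ?case using uv by (intro image_eqI[of _ _ "u @ v"]) auto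
    qed
  qed
  have "countable (lists (S \<union> m_inv G ` S))" using assms(1) by auto
  from countable_subset[OF sub countable_image[OF this]] show ?thesis .
qed

section \<open>Energy of colourings\<close>

definition colouring :: "('b \<Rightarrow> nat) \<Rightarrow> bool" where
  "colouring \<phi> \<longleftrightarrow> \<phi> \<in> measurable M (count_space UNIV) \<and> (\<exists>K. \<forall>x\<in>space M. \<phi> x < K)"

definition colour_class :: "('b \<Rightarrow> nat) \<Rightarrow> 'b \<Rightarrow> 'b set" where
  "colour_class \<phi> y = {x \<in> space M. \<phi> x = \<phi> y}"

text \<open>The probability that two independent random points have the same colour, or equally the
  sum of the squared class measures.\<close>

definition energy :: "('b \<Rightarrow> nat) \<Rightarrow> real" where
  "energy \<phi> = (\<integral>y. measure M (colour_class \<phi> y) \<partial>M)"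

text \<open>The common refinement; the pairing function keeps the colours natural numbers.\<close>

definition join :: "('b \<Rightarrow> nat) \<Rightarrow> ('b \<Rightarrow> nat) \<Rightarrow> 'b \<Rightarrow> nat" where
  "join \<phi> \<psi> x = prod_encode (\<phi> x, \<psi> x)"

lemma colouringD: "colouring \<phi> \<Longrightarrow> \<phi> \<in> measurable M (count_space UNIV)"
  by (simp add: colouring_def)

lemma colour_class_sets: "colouring \<phi> \<Longrightarrow> colour_class \<phi> y \<in> sets M"
  unfolding colour_class_def using countable_eq_sets(1)[OF colouringD, of \<phi> "\<lambda>_. \<phi> y"] by simp

lemma colour_class_join: "colour_class (join \<phi> \<psi>) y = colour_class \<phi> y \<inter> colour_class \<psi> y"
  by (auto simp: colour_class_def join_def)

lemma colouring_join:
  assumes "colouring \<phi>" "colouring \<psi>"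
  shows "colouring (join \<phi> \<psi>)"
proof -
  obtain K L where KL: "\<And>x. x \<in> space M \<Longrightarrow> \<phi> x < K" "\<And>x. x \<in> space M \<Longrightarrow> \<psi> x < L"
    using assms unfolding colouring_def by auto
  have "(\<lambda>x. (\<phi> x, \<psi> x)) \<in> measurable M (count_space UNIV \<Otimes>\<^sub>M count_space UNIV)"
    using assms[THEN colouringD] by (intro measurable_Pair)
  then have "(\<lambda>x. (\<phi> x, \<psi> x)) \<in> measurable M (count_space UNIV)"
    by (simp add: pair_measure_countable)
  then have "(\<lambda>x. prod_encode (\<phi> x, \<psi> x)) \<in> measurable M (count_space UNIV)"
    by (rule measurable_compose) simp
  moreover have "prod_encode (\<phi> x, \<psi> x) < Suc (Max (prod_encode ` ({..<K} \<times> {..<L})))" if "x \<in> space M" for x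
    using KL[OF that] by (intro le_imp_less_Suc Max_ge) auto
  ultimately show ?thesis unfolding colouring_def join_def by blast
qed

lemma join_discrepancy:
  assumes "colouring \<phi>" "colouring \<psi>" "g \<in> carrier G"
  shows "discrepancy g (join \<phi> \<psi>) \<le> discrepancy g \<phi> + discrepancy g \<psi>"
proof -
  have s: "{x \<in> space M. \<phi> (f g x) \<noteq> \<phi> x} \<in> sets M" "{x \<in> space M. \<psi> (f g x) \<noteq> \<psi> x} \<in> sets M"
    using discrepancy_sets assms colouringD by auto
  have "discrepancy g (join \<phi> \<psi>) \<le> measure M ({x \<in> space M. \<phi> (f g x) \<noteq> \<phi> x} \<union> {x \<in> space M. \<psi> (f g x) \<noteq> \<psi> x})"
    unfolding discrepancy_def using s by (intro finite_measure_mono) (auto simp: join_def)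
  also have "\<dots> \<le> discrepancy g \<phi> + discrepancy g \<psi>"
    unfolding discrepancy_def using s by (intro measure_Un_le)
  finally show ?thesis .
qed

lemma class_measure_measurable:
  assumes "colouring \<phi>" "colouring \<psi>"
  shows "(\<lambda>y. measure M (colour_class \<phi> y - colour_class \<psi> y)) \<in> borel_measurable M"
    "(\<lambda>y. measure M (colour_class \<phi> y)) \<in> borel_measurable M"
proof -
  let ?h = "\<lambda>c. case prod_decode c of (a, b) \<Rightarrow> measure M ({x \<in> space M. \<phi> x = a} - {x \<in> space M. \<psi> x = b})"
  have "(\<lambda>y. ?h (join \<phi> \<psi> y)) \<in> borel_measurable M"
    using colouringD[OF colouring_join[OF assms]] by (rule measurable_compose) simp
  then show "(\<lambda>y. measure M (colour_class \<phi> y - colour_class \<psi> y)) \<in> borel_measurable M"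
    by (simp add: join_def colour_class_def)
  have "(\<lambda>y. (\<lambda>a. measure M {x \<in> space M. \<phi> x = a}) (\<phi> y)) \<in> borel_measurable M"
    using colouringD[OF assms(1)] by (rule measurable_compose) simp
  then show "(\<lambda>y. measure M (colour_class \<phi> y)) \<in> borel_measurable M"
    by (simp add: colour_class_def)
qed

lemma class_measure_integrable:
  assumes "colouring \<phi>"
  shows "integrable M (\<lambda>y. measure M (colour_class \<phi> y))"
  using class_measure_measurable(2)[OF assms assms] by (intro integrable_const_bound[where B = 1]) auto

lemma class_diff_integrable:
  assumes "colouring \<phi>" "colouring \<psi>"
  shows "integrable M (\<lambda>y. measure M (colour_class \<phi> y - colour_class \<psi> y))"
  using class_measure_measurable(1)[OF assms] by (intro integrable_const_bound[where B = 1]) auto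

text \<open>In the refinement the class of \<open>y\<close> is the intersection of its two classes,
  so \<open>y\<close> loses the part of its class that \<open>\<psi>\<close> separates from
  it.\<close>

lemma energy_diff:
  assumes "colouring \<phi>" "colouring \<psi>"
  shows "(\<integral>y. measure M (colour_class \<phi> y - colour_class \<psi> y) \<partial>M) = energy \<phi> - energy (join \<phi> \<psi>)"
proof -
  have "measure M (colour_class \<phi> y - colour_class \<psi> y) = measure M (colour_class \<phi> y) - measure M (colour_class (join \<phi> \<psi>) y)" for y
    using finite_measure_Diff'[OF colour_class_sets colour_class_sets] assms by (simp add: colour_class_join)
  then show ?thesis unfolding energy_def
    using assms colouring_join class_measure_integrable by simp
qed

text \<open>Every point of \<open>C - B\<close> loses at least \<open>C \<inter> B\<close> from its
  class; integrating over \<open>C - B\<close> gives the product.\<close>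

lemma energy_class:
  assumes "colouring \<phi>" "B \<in> sets M" "C = colour_class \<phi> y" "y \<in> space M" "colouring \<psi>"
    and "\<And>x z. x \<in> C - B \<Longrightarrow> z \<in> C \<inter> B \<Longrightarrow> \<psi> x \<noteq> \<psi> z"
  shows "measure M (C \<inter> B) * measure M (C - B) \<le> energy \<phi> - energy (join \<phi> \<psi>)"
proof -
  have C: "C \<in> sets M" using assms colour_class_sets by simp
  have "measure M (C \<inter> B) * measure M (C - B) = (\<integral>x. measure M (C \<inter> B) * indicator (C - B) x \<partial>M)"
    using C assms(2) by simp
  also have "\<dots> \<le> (\<integral>y. measure M (colour_class \<phi> y - colour_class \<psi> y) \<partial>M)"
  proof (rule integral_mono)
    show "integrable M (\<lambda>x. measure M (C \<inter> B) * indicator (C - B) x :: real)"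
      using C assms(2) by (intro integrable_mult_right integrable_real_indicator) (auto simp: emeasure_eq_measure)
    show "integrable M (\<lambda>y. measure M (colour_class \<phi> y - colour_class \<psi> y))"
      by (rule class_diff_integrable) fact+
    fix x assume "x \<in> space M"
    show "measure M (C \<inter> B) * indicator (C - B) x \<le> measure M (colour_class \<phi> x - colour_class \<psi> x)"
    proof (cases "x \<in> C - B")
      case True
      have "C \<inter> B \<subseteq> colour_class \<phi> x - colour_class \<psi> x"
        using True assms(3,6) by (fastforce simp: colour_class_def)
      then show ?thesis using True assms colour_class_sets by (auto intro!: finite_measure_mono)
    qed simp
  qed
  also have "\<dots> = energy \<phi> - energy (join \<phi> \<psi>)" by (rule energy_diff) fact+
  finally show ?thesis .
qed

text \<open>Two random points that both fall into the class of \<open>y\<close> already contribute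
  its squared measure.\<close>

lemma energy_square:
  assumes "colouring \<phi>" "y \<in> space M"
  shows "(measure M (colour_class \<phi> y))\<^sup>2 \<le> energy \<phi>"
proof -
  let ?C = "colour_class \<phi> y"
  have C: "?C \<in> sets M" using assms colour_class_sets by simp
  have "(measure M ?C)\<^sup>2 = (\<integral>x. measure M ?C * indicator ?C x \<partial>M)"
    using C by (simp add: power2_eq_square)
  also have "\<dots> \<le> energy \<phi>" unfolding energy_def
  proof (rule integral_mono)
    show "integrable M (\<lambda>x. measure M ?C * indicator ?C x :: real)"
      using C by (intro integrable_mult_right integrable_real_indicator) (auto simp: emeasure_eq_measure)
    show "integrable M (\<lambda>y. measure M (colour_class \<phi> y))" by (rule class_measure_integrable) fact
    fix x assume "x \<in> space M"
    show "measure M ?C * indicator ?C x \<le> measure M (colour_class \<phi> x)"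
      by (cases "x \<in> ?C") (auto simp: colour_class_def)
  qed
  finally show ?thesis .
qed

end

section \<open>Components of an action\<close>

lemma normalized_restriction_sets:
  assumes "Y \<in> sets M"
  shows "sets (normalized_restriction M Y) = {A \<in> sets M. A \<subseteq> Y}"
proof -
  have "sets (normalized_restriction M Y) = (\<inter>) Y ` sets M"
    by (simp add: normalized_restriction_def sets_restrict_space)
  also have "\<dots> = {A \<in> sets M. A \<subseteq> Y}"
    using assms by (auto simp: image_iff)
  finally show ?thesis .
qed

lemma (in finite_measure) normalized_restriction_measure:
  assumes "Y \<in> sets M" "0 < measure M Y" "A \<in> sets M" "A \<subseteq> Y"
  shows "measure (normalized_restriction M Y) A = measure M A / measure M Y"
proof -
  have "measure (normalized_restriction M Y) A = measure (uniform_measure M Y) A"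
    unfolding normalized_restriction_def
    using assms sets.sets_into_space[OF assms(1)]
    by (intro measure_restrict_space) (auto simp: Int_absorb2)
  also have "\<dots> = measure M (Y \<inter> A) / measure M Y"
    using assms by (intro measure_uniform_measure) (auto simp: emeasure_eq_measure)
  finally show ?thesis using assms(4) by (simp add: Int_absorb1)
qed

context pmp_system
begin

text \<open>Strong ergodicity is applied to the constant sequence of an invariant set.\<close>

lemma strongly_ergodic_imp_ergodic:
  assumes "strongly_ergodic G N h"
  shows "ergodic G N h"
  unfolding ergodic_def
proof (intro allI impI)
  fix A assume A: "invariant_set G N h A"
  then have "(\<lambda>n::nat. measure N (sym_diff (h g ` A) A)) \<longlonglongrightarrow> 0" if "g \<in> carrier G" for g
    using that by (simp add: invariant_set_def)
  then have "(\<lambda>n::nat. measure N A * (1 - measure N A)) \<longlonglongrightarrow> 0"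
    using assms[unfolded strongly_ergodic_def, rule_format, of "\<lambda>_. A"] A by (auto simp: invariant_set_def)
  then have "measure N A * (1 - measure N A) = 0"
    by (simp add: LIMSEQ_const_iff)
  then show "measure N A = 0 \<or> measure N A = 1" by auto
qed

text \<open>The image under \<open>g\<close> is the preimage under \<open>inv g\<close>, and
  inverting \<open>g\<close> does not change the discrepancy.\<close>

lemma sym_diff_image:
  assumes "g \<in> carrier G" "A \<in> sets M"
  shows "measure M (sym_diff (f g ` A) A) = discrepancy g (\<lambda>x. x \<in> A)"
proof -
  have "A \<subseteq> space M" using assms(2) by (rule sets.sets_into_space)
  then have "sym_diff (f g ` A) A = {x \<in> space M. (f (inv g) x \<in> A) \<noteq> (x \<in> A)}"
    using image_eq[OF assms(1)] by auto
  then have "measure M (sym_diff (f g ` A) A) = discrepancy (inv g) (\<lambda>x. x \<in> A)"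
    by (simp add: discrepancy_def)
  also have "\<dots> = discrepancy g (\<lambda>x. x \<in> A)"
  proof (rule discrepancy_inv[OF assms(1)])
    show "(\<lambda>x. x \<in> A) \<in> measurable M (count_space UNIV)"
      using assms(2) by measurable
  qed
  finally show ?thesis .
qed

text \<open>There are only countably many group elements, so the points that some element moves
  across the border of \<open>Y\<close> form a null set. What is left are the points whose whole
  orbit lies in \<open>Y\<close>.\<close>

lemma almost_invariant_saturation:
  assumes "countable (carrier G)" "Y \<in> sets M"
    and null: "\<And>g. g \<in> carrier G \<Longrightarrow> discrepancy g (\<lambda>x. x \<in> Y) = 0"
  shows "\<exists>Y'\<subseteq>Y. invariant_set G M f Y' \<and> measure M (Y - Y') = 0"
proof -
  define D where "D g = {x \<in> space M. (f g x \<in> Y) \<noteq> (x \<in> Y)}" for g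
  define Y' where "Y' = Y - (\<Union>g\<in>carrier G. D g)"
  have Ysp: "Y \<subseteq> space M" using assms(2) by (rule sets.sets_into_space)
  have meas: "(\<lambda>x. x \<in> Y) \<in> measurable M (count_space UNIV)" using assms(2) by measurable
  have D: "D g \<in> sets M" if "g \<in> carrier G" for g
    unfolding D_def by (rule discrepancy_sets[OF that meas])
  have UD: "(\<Union>g\<in>carrier G. D g) \<in> null_sets M"
  proof (rule null_sets_UN'[OF assms(1)])
    fix g assume g: "g \<in> carrier G"
    have "measure M (D g) = 0" using null[OF g] by (simp add: discrepancy_def D_def)
    then show "D g \<in> null_sets M" using D[OF g] by (auto simp: emeasure_eq_measure)
  qed
  have Y'_iff: "x \<in> Y' \<longleftrightarrow> x \<in> space M \<and> (\<forall>g\<in>carrier G. f g x \<in> Y)" for x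
  proof
    assume x: "x \<in> space M \<and> (\<forall>g\<in>carrier G. f g x \<in> Y)"
    then have "x \<in> Y" using f_one[of x] by (metis grp.one_closed)
    then show "x \<in> Y'" using x by (auto simp: Y'_def D_def)
  qed (use Ysp in \<open>auto simp: Y'_def D_def\<close>)
  have Y's: "Y' \<in> sets M" using UD assms(2) by (auto simp: Y'_def)
  have "f h ` Y' = Y'" if h: "h \<in> carrier G" for h
  proof -
    have "f h x \<in> Y' \<longleftrightarrow> x \<in> Y'" if "h \<in> carrier G" "x \<in> space M" for h x
    proof
      assume "x \<in> Y'"
      then show "f h x \<in> Y'" unfolding Y'_iff using that f_space f_mult by (metis grp.m_closed)
    next
      assume r: "f h x \<in> Y'"
      have "f g x \<in> Y" if g: "g \<in> carrier G" for g
      proof -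
        have "f (g \<otimes> inv h) (f h x) \<in> Y" using r g \<open>h \<in> carrier G\<close> unfolding Y'_iff by simp
        moreover have "f (g \<otimes> inv h) (f h x) = f g x"
          using f_mult[OF g, of "inv h" "f h x"] f_space f_inv \<open>h \<in> carrier G\<close> \<open>x \<in> space M\<close> by simp
        ultimately show ?thesis by simp
      qed
      then show "x \<in> Y'" using that Y'_iff by blast
    qed
    moreover have "Y' \<subseteq> space M" using Y's by (rule sets.sets_into_space)
    ultimately show ?thesis
      unfolding image_eq[OF h \<open>Y' \<subseteq> space M\<close>] using grp.inv_closed[OF h] by blast
  qed
  moreover have "measure M (Y - Y') = 0"
  proof -
    have "Y - Y' \<subseteq> (\<Union>g\<in>carrier G. D g)" by (auto simp: Y'_def)
    then have "Y - Y' \<in> null_sets M" using UD assms(2) Y's by (intro null_sets_subset[OF UD]) auto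
    then show ?thesis by (simp add: measure_eq_0_null_sets)
  qed
  ultimately show ?thesis using Y's by (intro exI[of _ Y']) (auto simp: invariant_set_def Y'_def)
qed

end

section \<open>Minimal energy and strongly ergodic components\<close>

locale pmp_generated = pmp_system G M f
  for G :: "('a, 'm) monoid_scheme" (structure) and M :: "'b measure" and f +
  fixes S
  assumes fin_S: "finite S" and S_sub: "S \<subseteq> carrier G" and gen_S: "generate G S = carrier G"
begin

lemma countable_carrier: "countable (carrier G)"
  using generate_countable[of S] fin_S S_sub gen_S by (simp add: countable_finite)

definition boundary_size :: "('b \<Rightarrow> 'c :: countable) \<Rightarrow> real" where
  "boundary_size \<phi> = (\<Sum>s\<in>S. discrepancy s \<phi>)"

lemma boundary_size_nonneg: "0 \<le> boundary_size \<phi>"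
  unfolding boundary_size_def by (intro sum_nonneg discrepancy_nonneg)

lemma boundary_size_join:
  "colouring \<phi> \<Longrightarrow> colouring \<psi> \<Longrightarrow> boundary_size (join \<phi> \<psi>) \<le> boundary_size \<phi> + boundary_size \<psi>"
  unfolding boundary_size_def sum.distrib[symmetric]
  using S_sub by (intro sum_mono join_discrepancy) auto

lemma discrepancy_le_boundary_size: "s \<in> S \<Longrightarrow> discrepancy s \<phi> \<le> boundary_size \<phi>"
  unfolding boundary_size_def using fin_S discrepancy_nonneg by (intro member_le_sum) auto

lemma energy_bounds: "0 \<le> energy \<phi>" "colouring \<phi> \<Longrightarrow> energy \<phi> \<le> 1"
proof -
  show "0 \<le> energy \<phi>" unfolding energy_def by (intro integral_nonneg_AE) auto
  assume "colouring \<phi>"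
  then have "energy \<phi> \<le> (\<integral>y. 1 \<partial>M)" unfolding energy_def
    using class_measure_integrable by (intro integral_mono) auto
  then show "energy \<phi> \<le> 1" by (simp add: prob_space)
qed

text \<open>\<open>L\<close> is the limit, as the boundary tends to zero, of the infimum of the energy.\<close>

lemma minimal_energy:
  obtains L where "0 \<le> L"
    "\<And>\<eta>. 0 < \<eta> \<Longrightarrow> \<exists>\<delta>>0. \<forall>\<psi>. colouring \<psi> \<longrightarrow> boundary_size \<psi> < \<delta> \<longrightarrow> L - \<eta> < energy \<psi>"
    "\<And>\<eta> \<delta>. 0 < \<eta> \<Longrightarrow> 0 < \<delta> \<Longrightarrow> \<exists>\<phi>. colouring \<phi> \<and> boundary_size \<phi> < \<delta> \<and> energy \<phi> < L + \<eta>"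
proof -
  \<comment> \<open>As \<open>n\<close> grows the condition becomes stricter and the infimum
    \<open>a n\<close> rises; constant colourings have no boundary, so no \<open>E n\<close> is
    empty.\<close>
  define E where "E n = energy ` {\<phi>. colouring \<phi> \<and> boundary_size \<phi> < 1 / real (Suc n)}" for n
  define a where "a n = Inf (E n)" for n
  have const: "colouring (\<lambda>_. 0)" "boundary_size (\<lambda>_::'b. 0::nat) = 0"
    by (auto simp: colouring_def boundary_size_def discrepancy_def)
  have ne: "E n \<noteq> {}" for n using const unfolding E_def by fastforce
  have bb: "bdd_below (E n)" for n unfolding E_def using energy_bounds(1) by (intro bdd_belowI[of _ 0]) auto
  have a0: "0 \<le> a n" for n unfolding a_def using ne by (rule cInf_greatest) (auto simp: E_def energy_bounds)
  have a1: "a n \<le> 1" for n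
  proof -
    have "energy (\<lambda>_. 0) \<in> E n" using const by (auto simp: E_def)
    then have "a n \<le> energy (\<lambda>_. 0)" unfolding a_def using bb by (rule cInf_lower)
    then show ?thesis using energy_bounds(2)[OF const(1)] by simp
  qed
  have ba: "bdd_above (range a)" using a1 by (intro bdd_aboveI[of _ 1]) auto
  define L where "L = Sup (range a)"
  have aL: "a n \<le> L" for n unfolding L_def using ba by (intro cSup_upper) auto
  show ?thesis
  proof (rule that[of L])
    show "0 \<le> L" using a0[of 0] aL[of 0] by simp
  next
    fix \<eta> :: real assume "0 < \<eta>"
    then obtain n where n: "L - \<eta> < a n"
      using less_cSup_iff[of "range a" "L - \<eta>"] ba unfolding L_def by auto
    have "L - \<eta> < energy \<psi>" if "colouring \<psi>" "boundary_size \<psi> < 1 / real (Suc n)" for \<psi>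
    proof -
      have "energy \<psi> \<in> E n" using that unfolding E_def by blast
      then have "a n \<le> energy \<psi>" unfolding a_def using bb by (rule cInf_lower)
      then show ?thesis using n by simp
    qed
    then show "\<exists>\<delta>>0. \<forall>\<psi>. colouring \<psi> \<longrightarrow> boundary_size \<psi> < \<delta> \<longrightarrow> L - \<eta> < energy \<psi>"
      by (intro exI[of _ "1 / real (Suc n)"]) auto
  next
    fix \<eta> \<delta> :: real assume "0 < \<eta>" "0 < \<delta>"
    obtain n where n: "1 / real (Suc n) < \<delta>" using nat_approx_posE[OF \<open>0 < \<delta>\<close>] .
    have "a n < L + \<eta>" using aL[of n] \<open>0 < \<eta>\<close> by simp
    then obtain e where "e \<in> E n" "e < L + \<eta>" unfolding a_def using cInf_lessD[OF ne] by blast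
    then obtain \<phi> where "colouring \<phi>" "boundary_size \<phi> < 1 / real (Suc n)" "energy \<phi> < L + \<eta>"
      unfolding E_def by blast
    then show "\<exists>\<phi>. colouring \<phi> \<and> boundary_size \<phi> < \<delta> \<and> energy \<phi> < L + \<eta>"
      using n by (intro exI[of _ \<phi>]) auto
  qed
qed

text \<open>\<open>Y\<close> is the limit inferior of the sets. A point at which it differs from
  \<open>C N\<close> changes membership at some step from \<open>N\<close> on, so the difference is
  bounded by a tail of the convergent series.\<close>

lemma class_sequence_limit:
  assumes C: "\<And>i::nat. C i \<in> sets M" and sm: "summable (\<lambda>i. measure M (sym_diff (C i) (C (Suc i))))"
  obtains Y where "Y \<in> sets M" "(\<lambda>N. measure M (sym_diff Y (C N))) \<longlonglongrightarrow> 0"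
    "measure M (C 0) - (\<Sum>i. measure M (sym_diff (C i) (C (Suc i)))) \<le> measure M Y"
proof -
  define D where "D i = measure M (sym_diff (C i) (C (Suc i)))" for i
  have smD: "summable D" using sm unfolding D_def[abs_def] .
  define Y where "Y = (\<Union>N. \<Inter>i\<in>{N..}. C i)"
  have Ys: "Y \<in> sets M" unfolding Y_def using C by (intro sets.countable_UN'' sets.countable_INT') auto
  have le: "measure M (sym_diff Y (C N)) \<le> (\<Sum>i. D (i + N))" for N
  proof -
    have "x \<in> (\<Union>i. sym_diff (C (i + N)) (C (Suc (i + N))))" if x: "x \<in> sym_diff Y (C N)" for x
    proof (rule ccontr)
      assume "x \<notin> (\<Union>i. sym_diff (C (i + N)) (C (Suc (i + N))))"
      then have step: "x \<in> C (i + N) \<longleftrightarrow> x \<in> C (Suc (i + N))" for i by auto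
      have same: "x \<in> C (i + N) \<longleftrightarrow> x \<in> C N" for i
        by (induction i) (use step in auto)
      have same': "x \<in> C i \<longleftrightarrow> x \<in> C N" if "N \<le> i" for i
        using same[of "i - N"] that by simp
      have "x \<in> Y \<longleftrightarrow> x \<in> C N"
      proof
        assume "x \<in> Y"
        then obtain K where "\<forall>i\<ge>K. x \<in> C i" unfolding Y_def by blast
        then have "x \<in> C (max K N)" by simp
        then show "x \<in> C N" using same'[of "max K N"] by simp
      next
        assume "x \<in> C N"
        then have "\<forall>i\<ge>N. x \<in> C i" using same' by blast
        then show "x \<in> Y" unfolding Y_def by blast
      qed
      then show False using x by auto
    qed
    then have "measure M (sym_diff Y (C N)) \<le> measure M (\<Union>i. sym_diff (C (i + N)) (C (Suc (i + N))))"
      using C by (intro finite_measure_mono sets.countable_UN'') auto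
    also have "\<dots> \<le> (\<Sum>i. measure M (sym_diff (C (i + N)) (C (Suc (i + N)))))"
      using C summable_ignore_initial_segment[OF sm, of N]
      by (intro finite_measure_subadditive_countably) auto
    finally show ?thesis by (simp add: D_def)
  qed
  have tail: "(\<lambda>N. \<Sum>i. D (i + N)) \<longlonglongrightarrow> 0"
  proof -
    have "(\<Sum>i. D (i + N)) = suminf D - (\<Sum>i<N. D i)" for N
      using suminf_minus_initial_segment[OF smD, of N] .
    moreover have "(\<lambda>N. suminf D - (\<Sum>i<N. D i)) \<longlonglongrightarrow> suminf D - suminf D"
      by (intro tendsto_diff tendsto_const summable_LIMSEQ smD)
    ultimately show ?thesis by simp
  qed
  have "(\<lambda>N. measure M (sym_diff Y (C N))) \<longlonglongrightarrow> 0"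
    by (rule tendsto_sandwich[OF _ _ tendsto_const tail]) (use le in auto)
  moreover have "measure M (C 0) - suminf D \<le> measure M Y"
  proof -
    have "measure M (C 0) \<le> measure M (Y \<union> sym_diff Y (C 0))"
      using C Ys by (intro finite_measure_mono) auto
    also have "\<dots> \<le> measure M Y + measure M (sym_diff Y (C 0))"
      using C Ys by (intro measure_Un_le) auto
    finally show ?thesis using le[of 0] by simp
  qed
  ultimately show ?thesis using Ys that unfolding D_def[abs_def] by blast
qed

text \<open>For colourings whose energy is close to the minimal energy \<open>L\<close>, consecutive colourings
  \<open>\<phi> i\<close> and \<open>\<phi> (i + 1)\<close> nearly agree with their join, so the class of a typical point converges; the limit
  class is a strongly ergodic component, as otherwise refining \<open>\<phi> i\<close> would lower the energy.\<close>

lemma strongly_ergodic_component: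
  assumes L: "0 < L"
    and low: "\<And>\<eta>. 0 < \<eta> \<Longrightarrow> \<exists>\<delta>>0. \<forall>\<psi>. colouring \<psi> \<longrightarrow> boundary_size \<psi> < \<delta> \<longrightarrow> L - \<eta> < energy \<psi>"
    and upp: "\<And>\<eta> \<delta>. 0 < \<eta> \<Longrightarrow> 0 < \<delta> \<Longrightarrow> \<exists>\<phi>. colouring \<phi> \<and> boundary_size \<phi> < \<delta> \<and> energy \<phi> < L + \<eta>"
  shows "\<exists>Y. invariant_set G M f Y \<and> 0 < measure M Y \<and>
    strongly_ergodic G (normalized_restriction M Y) (restrict_action f Y)"
proof -
  \<comment> \<open>The errors add up to a small part of \<open>L\<close>: five times their sum is
    \<open>10 * L / 64\<close>, less than the energy of \<open>\<phi> 0\<close>, which exceeds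
    \<open>L - L / 64\<close>.\<close>
  define \<eta> where "\<eta> i = L / 64 * (1 / 2) ^ i" for i :: nat
  have \<eta>: "0 < \<eta> i" for i using L by (simp add: \<eta>_def)
  have \<eta>_lim: "\<eta> \<longlonglongrightarrow> 0" unfolding \<eta>_def by (intro tendsto_mult_right_zero LIMSEQ_power_zero) simp
  have "\<exists>\<delta>. \<forall>i. 0 < \<delta> i \<and> (\<forall>\<psi>. colouring \<psi> \<longrightarrow> boundary_size \<psi> < \<delta> i \<longrightarrow> L - \<eta> i < energy \<psi>)"
    by (rule choice) (use low \<eta> in blast)
  then obtain \<delta> where \<delta>: "\<And>i. 0 < \<delta> i"
    and \<delta>_low: "\<And>i \<psi>. colouring \<psi> \<Longrightarrow> boundary_size \<psi> < \<delta> i \<Longrightarrow> L - \<eta> i < energy \<psi>" by blast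
  \<comment> \<open>Half of the smallest threshold so far, so that the join of two consecutive
    colourings stays below the threshold of the earlier one; the second term makes the boundaries
    tend to 0.\<close>
  define \<Delta> where "\<Delta> i = min (Min (\<delta> ` {..i}) / 2) (1 / real (Suc i))" for i
  have \<Delta>: "0 < \<Delta> i" for i using \<delta> by (simp add: \<Delta>_def)
  have \<Delta>_le: "\<Delta> i \<le> \<delta> j / 2" if "j \<le> i" for i j
  proof -
    have "Min (\<delta> ` {..i}) \<le> \<delta> j" using that by (intro Min_le) auto
    then show ?thesis by (simp add: \<Delta>_def min_def)
  qed
  have "\<exists>\<phi>. \<forall>i. colouring (\<phi> i) \<and> boundary_size (\<phi> i) < \<Delta> i \<and> energy (\<phi> i) < L + \<eta> i"
    by (rule choice) (use upp \<eta> \<Delta> in blast)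
  then obtain \<phi> where col: "\<And>i. colouring (\<phi> i)" and bd: "\<And>i. boundary_size (\<phi> i) < \<Delta> i"
    and en: "\<And>i. energy (\<phi> i) < L + \<eta> i" by blast
  have bd_lim: "(\<lambda>i. boundary_size (\<phi> i)) \<longlonglongrightarrow> 0"
  proof (rule tendsto_sandwich[OF _ _ tendsto_const])
    show "\<forall>\<^sub>F i in sequentially. 0 \<le> boundary_size (\<phi> i)" by (intro always_eventually allI boundary_size_nonneg)
    have "boundary_size (\<phi> i) \<le> 1 / real (Suc i)" for i using bd[of i] by (simp add: \<Delta>_def)
    then show "\<forall>\<^sub>F i in sequentially. boundary_size (\<phi> i) \<le> 1 / real (Suc i)" by simp
    show "(\<lambda>i. 1 / real (Suc i)) \<longlonglongrightarrow> 0" using LIMSEQ_inverse_real_of_nat by (simp add: inverse_eq_divide)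
  qed
  define d where "d i y = measure M (colour_class (\<phi> i) y - colour_class (\<phi> (Suc i)) y)
      + measure M (colour_class (\<phi> (Suc i)) y - colour_class (\<phi> i) y)" for i y
  have d0: "0 \<le> d i y" for i y by (simp add: d_def)
  have d_int: "integrable M (d i)" for i
    unfolding d_def using col class_diff_integrable by (intro Bochner_Integration.integrable_add) auto
  \<comment> \<open>Both colourings have energy below \<open>L + \<eta> i\<close> and their joins
    have energy above \<open>L - \<eta> i\<close>, so each of the two drops is less than
    \<open>2 * \<eta> i\<close>.\<close>
  have d_le: "(\<integral>y. d i y \<partial>M) \<le> 5 * \<eta> i" for i
  proof -
    have e1: "L - \<eta> i < energy (join (\<phi> i) (\<phi> (Suc i)))"
      using col boundary_size_join[OF col col, of i "Suc i"] bd[of i] bd[of "Suc i"] \<Delta>_le[of i i] \<Delta>_le[of i "Suc i"]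
      by (intro \<delta>_low colouring_join) auto
    have e2: "L - \<eta> i < energy (join (\<phi> (Suc i)) (\<phi> i))"
      using col boundary_size_join[OF col col, of "Suc i" i] bd[of i] bd[of "Suc i"] \<Delta>_le[of i i] \<Delta>_le[of i "Suc i"]
      by (intro \<delta>_low colouring_join) auto
    have "(\<integral>y. d i y \<partial>M) = (energy (\<phi> i) - energy (join (\<phi> i) (\<phi> (Suc i)))) + (energy (\<phi> (Suc i)) - energy (join (\<phi> (Suc i)) (\<phi> i)))"
      unfolding d_def using col by (simp add: class_diff_integrable energy_diff)
    moreover have "\<eta> (Suc i) \<le> \<eta> i" using L by (simp add: \<eta>_def)
    ultimately show ?thesis using e1 e2 en[of i] en[of "Suc i"] \<eta>[of i] by simp
  qed
  have e0: "L - \<eta> 0 < energy (\<phi> 0)"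
    using bd[of 0] \<Delta>_le[of 0 0] \<delta>[of 0] by (intro \<delta>_low col) simp
  \<comment> \<open>By averaging: otherwise the energy of \<open>\<phi> 0\<close> would be at most
    the sum of the integrals of all \<open>d i\<close>. In the extended reals the series may be
    written before it is known to converge.\<close>
  have "\<exists>y\<in>space M. (\<Sum>i. ennreal (d i y)) < ennreal (measure M (colour_class (\<phi> 0) y))"
  proof (rule ccontr)
    assume "\<not> ?thesis"
    then have ge: "ennreal (measure M (colour_class (\<phi> 0) y)) \<le> (\<Sum>i. ennreal (d i y))" if "y \<in> space M" for y
      using that by (auto simp: not_less)
    have "ennreal (energy (\<phi> 0)) = (\<integral>\<^sup>+y. ennreal (measure M (colour_class (\<phi> 0) y)) \<partial>M)"
      unfolding energy_def using class_measure_integrable[OF col] by (intro nn_integral_eq_integral[symmetric]) auto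
    also have "\<dots> \<le> (\<integral>\<^sup>+y. (\<Sum>i. ennreal (d i y)) \<partial>M)"
      by (rule nn_integral_mono) (rule ge)
    also have "\<dots> = (\<Sum>i. \<integral>\<^sup>+y. ennreal (d i y) \<partial>M)"
      using d_int by (intro nn_integral_suminf) auto
    also have "\<dots> = (\<Sum>i. ennreal (\<integral>y. d i y \<partial>M))"
      using d_int d0 by (simp add: nn_integral_eq_integral)
    also have "\<dots> \<le> (\<Sum>i. ennreal (5 * \<eta> i))"
      using d_le by (intro suminf_le ennreal_leI) auto
    also have "\<dots> = ennreal (\<Sum>i. 5 * \<eta> i)"
      using \<eta> by (intro suminf_ennreal2) (auto simp: less_imp_le \<eta>_def intro!: summable_mult summable_geometric)
    also have "(\<Sum>i. 5 * \<eta> i) = 5 * (L / 64 * 2)"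
    proof -
      have "(\<lambda>i. 5 * (L / 64 * (1 / 2) ^ i)) sums (5 * (L / 64 * (1 / (1 - 1 / 2))))"
        by (intro sums_mult geometric_sums) simp
      then show ?thesis unfolding \<eta>_def by (simp add: sums_iff)
    qed
    finally have "energy (\<phi> 0) \<le> 5 * (L / 64 * 2)" using L by (simp add: ennreal_le_iff)
    then show False using e0 L by (simp add: \<eta>_def)
  qed
  then obtain y where y: "y \<in> space M" and yl: "(\<Sum>i. ennreal (d i y)) < ennreal (measure M (colour_class (\<phi> 0) y))"
    by blast
  define C where "C i = colour_class (\<phi> i) y" for i
  have Cs: "C i \<in> sets M" for i unfolding C_def using col colour_class_sets by simp
  have dC: "measure M (sym_diff (C i) (C (Suc i))) = d i y" for i
    unfolding d_def C_def[symmetric] using Cs by (intro finite_measure_Union) auto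
  have "(\<Sum>i. ennreal (d i y)) \<noteq> \<top>" using yl by auto
  then have sm: "summable (\<lambda>i. d i y)" using d0 by (intro summable_suminf_not_top) auto
  have pos: "(\<Sum>i. d i y) < measure M (C 0)"
    using yl unfolding suminf_ennreal2[OF d0 sm] C_def by (subst (asm) ennreal_less_iff) (auto intro: suminf_nonneg sm d0)
  obtain Y where Ys: "Y \<in> sets M" and Ylim: "(\<lambda>N. measure M (sym_diff Y (C N))) \<longlonglongrightarrow> 0"
    and "measure M (C 0) - (\<Sum>i. d i y) \<le> measure M Y"
    using class_sequence_limit[of C] Cs sm unfolding dC by metis
  then have Ypos: "0 < measure M Y" using pos by linarith
  have Ymeas: "(\<lambda>x. x \<in> Y) \<in> measurable M (count_space UNIV)" using Ys by measurable
  have null_S: "discrepancy s (\<lambda>x. x \<in> Y) = 0" if s: "s \<in> S" for s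
  proof -
    have sG: "s \<in> carrier G" using s S_sub by blast
    \<comment> \<open>If \<open>s\<close> moves a point across the border of \<open>Y\<close>, then
      \<open>Y\<close> and \<open>C i\<close> differ at the point or at its image, or
      \<open>s\<close> changes its colour.\<close>
    have "discrepancy s (\<lambda>x. x \<in> Y) \<le> 2 * measure M (sym_diff Y (C i)) + boundary_size (\<phi> i)" for i
    proof -
      let ?D = "sym_diff Y (C i)" and ?E = "{x \<in> space M. \<phi> i (f s x) \<noteq> \<phi> i x}"
      have D: "?D \<in> sets M" "?E \<in> sets M" using Ys Cs discrepancy_sets[OF sG colouringD[OF col]] by auto
      have D': "f s -` ?D \<inter> space M \<in> sets M" using measurable_sets[OF f_measurable[OF sG] D(1)] .
      have "discrepancy s (\<lambda>x. x \<in> Y) \<le> measure M (((f s -` ?D \<inter> space M) \<union> ?D) \<union> ?E)"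
        unfolding discrepancy_def
      proof (rule finite_measure_mono)
        show "{x \<in> space M. (f s x \<in> Y) \<noteq> (x \<in> Y)} \<subseteq> (f s -` ?D \<inter> space M) \<union> ?D \<union> ?E"
          using f_space[OF sG] by (auto simp: C_def colour_class_def)
        show "(f s -` ?D \<inter> space M) \<union> ?D \<union> ?E \<in> sets M" by (intro sets.Un D D')
      qed
      also have "\<dots> \<le> measure M ((f s -` ?D \<inter> space M) \<union> ?D) + measure M ?E"
        by (intro measure_Un_le sets.Un D D')
      also have "\<dots> \<le> measure M (f s -` ?D \<inter> space M) + measure M ?D + measure M ?E"
        using measure_Un_le[OF D' D(1)] by simp
      also have "\<dots> = 2 * measure M ?D + discrepancy s (\<phi> i)"
        using measure_vimage[OF sG D(1)] by (simp add: discrepancy_def)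
      finally show ?thesis using discrepancy_le_boundary_size[OF s, of "\<phi> i"] by simp
    qed
    moreover have "(\<lambda>i. 2 * measure M (sym_diff Y (C i)) + boundary_size (\<phi> i)) \<longlonglongrightarrow> 2 * 0 + 0"
      by (intro tendsto_intros Ylim bd_lim)
    ultimately have "discrepancy s (\<lambda>x. x \<in> Y) \<le> 2 * 0 + 0"
      by (intro LIMSEQ_le_const[where X = "\<lambda>i. 2 * measure M (sym_diff Y (C i)) + boundary_size (\<phi> i)"]) auto
    then show ?thesis using discrepancy_nonneg[of s "\<lambda>x. x \<in> Y"] by simp
  qed
  have null: "discrepancy g (\<lambda>x. x \<in> Y) = 0" if g: "g \<in> carrier G" for g
  proof -
    have "g \<in> generate G S" using g gen_S by simp
    from discrepancy_generate[OF S_sub fin_S this, where 'c = bool]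
    obtain n :: nat where "discrepancy g (\<lambda>x. x \<in> Y) \<le> real n * (\<Sum>s\<in>S. discrepancy s (\<lambda>x. x \<in> Y))"
      using Ymeas by blast
    also have "(\<Sum>s\<in>S. discrepancy s (\<lambda>x. x \<in> Y)) = 0" using null_S by simp
    finally show ?thesis using discrepancy_nonneg[of g "\<lambda>x. x \<in> Y"] by simp
  qed
  \<comment> \<open>\<open>Y\<close> is invariant only up to null sets, whereas a component has to
    be invariant as a set.\<close>
  obtain Y' where Y': "Y' \<subseteq> Y" "invariant_set G M f Y'" "measure M (Y - Y') = 0"
    using almost_invariant_saturation[OF countable_carrier Ys null] by blast
  have Y's: "Y' \<in> sets M" using Y'(2) by (simp add: invariant_set_def)
  have Y'pos: "0 < measure M Y'"
    using finite_measure_Diff[OF Ys Y's Y'(1)] Y'(3) Ypos by simp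
  define \<tau> where "\<tau> i = measure M (sym_diff Y (C i))" for i
  have \<tau>_lim: "\<tau> \<longlonglongrightarrow> 0" using Ylim unfolding \<tau>_def[abs_def] .
  have sym': "measure M (Y' - C i) \<le> \<tau> i" for i
    unfolding \<tau>_def using Y'(1) Ys Cs by (intro finite_measure_mono) auto
  have "strongly_ergodic G (normalized_restriction M Y') (restrict_action f Y')"
    unfolding strongly_ergodic_def
  proof (intro allI impI, elim conjE)
    fix A :: "nat \<Rightarrow> 'b set"
    assume "range A \<subseteq> sets (normalized_restriction M Y')"
      and ai: "\<forall>g\<in>carrier G. (\<lambda>n. measure (normalized_restriction M Y') (sym_diff (restrict_action f Y' g ` A n) (A n))) \<longlonglongrightarrow> 0"
    then have A: "A n \<in> sets M" "A n \<subseteq> Y'" for n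
      using normalized_restriction_sets[OF Y's] by auto
    have meas: "measure (normalized_restriction M Y') B = measure M B / measure M Y'" if "B \<in> sets M" "B \<subseteq> Y'" for B
      using normalized_restriction_measure[OF Y's Y'pos that] .
    have disc: "(\<lambda>n. discrepancy g (\<lambda>x. x \<in> A n)) \<longlonglongrightarrow> 0" if g: "g \<in> carrier G" for g
    proof -
      have "measure (normalized_restriction M Y') (sym_diff (restrict_action f Y' g ` A n) (A n))
          = discrepancy g (\<lambda>x. x \<in> A n) / measure M Y'" for n
      proof -
        have im: "restrict_action f Y' g ` A n = f g ` A n"
          using A(2)[of n] by (auto simp: restrict_action_def image_iff subset_iff)
        have "f g ` A n \<subseteq> Y'" using A(2)[of n] Y'(2) g unfolding invariant_set_def by blast
        moreover have "f g ` A n \<in> sets M"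
          unfolding image_eq[OF g sets.sets_into_space[OF A(1)]]
          using measurable_sets[OF f_measurable A(1), of "inv g" n] g by (simp add: vimage_def Int_def conj_commute)
        ultimately show ?thesis unfolding im sym_diff_image[OF g A(1), symmetric]
          using A[of n] by (intro meas) auto
      qed
      then have "(\<lambda>n. discrepancy g (\<lambda>x. x \<in> A n) / measure M Y' * measure M Y') \<longlonglongrightarrow> 0 * measure M Y'"
        using ai g by (intro tendsto_mult tendsto_const) auto
      then show ?thesis using Y'pos by simp
    qed
    \<comment> \<open>Were \<open>A n\<close> and its complement both substantial in the component,
      refining \<open>\<phi> i\<close> by the indicator of \<open>A n\<close> would push the energy
      below \<open>L - \<eta> i\<close>.\<close>
    define \<theta> where "\<theta> n x = (if x \<in> A n then 1 else (0::nat))" for n x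
    have \<theta>: "colouring (\<theta> n)" for n
      unfolding colouring_def
    proof
      show "\<theta> n \<in> measurable M (count_space UNIV)" unfolding \<theta>_def using A(1)[of n] by measurable
      show "\<exists>K. \<forall>x\<in>space M. \<theta> n x < K" by (intro exI[of _ 2]) (simp add: \<theta>_def)
    qed
    have \<theta>d: "discrepancy g (\<theta> n) = discrepancy g (\<lambda>x. x \<in> A n)" for g n
      unfolding discrepancy_def by (rule arg_cong[where f = "measure M"]) (auto simp: \<theta>_def)
    have \<theta>_lim: "(\<lambda>n. boundary_size (\<theta> n)) \<longlonglongrightarrow> 0"
      unfolding boundary_size_def \<theta>d using disc S_sub by (intro tendsto_null_sum) auto
    \<comment> \<open>The term \<open>2 * \<eta> i\<close> bounds the drop of the energy, and
      \<open>3 * \<tau> i\<close> pays for replacing \<open>C i\<close> by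
      \<open>Y'\<close>.\<close>
    have bound: "\<forall>\<^sub>F n in sequentially. measure M (A n) * measure M (Y' - A n) \<le> 2 * \<eta> i + 3 * \<tau> i" for i
    proof -
      have "\<forall>\<^sub>F n in sequentially. boundary_size (\<theta> n) < \<delta> i / 2"
        using order_tendstoD(2)[OF \<theta>_lim, of "\<delta> i / 2"] \<delta>[of i] by simp
      then show ?thesis
      proof eventually_elim
        case (elim n)
        have "boundary_size (join (\<phi> i) (\<theta> n)) < \<delta> i"
          using boundary_size_join[OF col \<theta>, of i n] bd[of i] \<Delta>_le[of i i] elim by simp
        then have "L - \<eta> i < energy (join (\<phi> i) (\<theta> n))" by (intro \<delta>_low colouring_join col \<theta>)
        moreover have "measure M (C i \<inter> A n) * measure M (C i - A n) \<le> energy (\<phi> i) - energy (join (\<phi> i) (\<theta> n))"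
          using col A(1)[of n] y \<theta> by (intro energy_class[where y = y]) (auto simp: C_def \<theta>_def)
        ultimately have main: "measure M (C i \<inter> A n) * measure M (C i - A n) \<le> 2 * \<eta> i"
          using en[of i] by simp
        have "measure M (A n) \<le> measure M ((C i \<inter> A n) \<union> (Y' - C i))"
          using A[of n] Cs Y's by (intro finite_measure_mono) auto
        also have "\<dots> \<le> measure M (C i \<inter> A n) + measure M (Y' - C i)"
          using A[of n] Cs Y's by (intro measure_Un_le) auto
        finally have p: "measure M (A n) \<le> measure M (C i \<inter> A n) + \<tau> i" using sym'[of i] by simp
        have "measure M (Y' - A n) \<le> measure M ((C i - A n) \<union> (Y' - C i))"
          using A[of n] Cs Y's by (intro finite_measure_mono) auto
        also have "\<dots> \<le> measure M (C i - A n) + measure M (Y' - C i)"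
          using A[of n] Cs Y's by (intro measure_Un_le) auto
        finally have q: "measure M (Y' - A n) \<le> measure M (C i - A n) + \<tau> i" using sym'[of i] by simp
        have \<tau>1: "0 \<le> \<tau> i" "\<tau> i \<le> 1" by (auto simp: \<tau>_def)
        have "measure M (A n) * measure M (Y' - A n) \<le> (measure M (C i \<inter> A n) + \<tau> i) * (measure M (C i - A n) + \<tau> i)"
          using p q \<tau>1 by (intro mult_mono) auto
        also have "\<dots> = measure M (C i \<inter> A n) * measure M (C i - A n) + \<tau> i * measure M (C i - A n) + \<tau> i * measure M (C i \<inter> A n) + \<tau> i * \<tau> i"
          by (simp add: algebra_simps)
        also have "\<dots> \<le> 2 * \<eta> i + \<tau> i * 1 + \<tau> i * 1 + \<tau> i * 1"
          using main \<tau>1 by (intro add_mono mult_left_mono) auto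
        finally show ?case by simp
      qed
    qed
    have lim0: "(\<lambda>n. measure M (A n) * measure M (Y' - A n)) \<longlonglongrightarrow> 0"
    proof (rule order_tendstoI)
      fix a :: real assume "a < 0"
      then show "\<forall>\<^sub>F n in sequentially. a < measure M (A n) * measure M (Y' - A n)"
        by (intro always_eventually allI less_le_trans[OF \<open>a < 0\<close>] mult_nonneg_nonneg measure_nonneg)
    next
      fix a :: real assume "0 < a"
      have "(\<lambda>i. 2 * \<eta> i + 3 * \<tau> i) \<longlonglongrightarrow> 2 * 0 + 3 * 0" by (intro tendsto_intros \<eta>_lim \<tau>_lim)
      then have "\<forall>\<^sub>F i in sequentially. 2 * \<eta> i + 3 * \<tau> i < a"
        by (rule order_tendstoD(2)) (use \<open>0 < a\<close> in simp)
      then obtain i where "2 * \<eta> i + 3 * \<tau> i < a"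
        using eventually_happens'[OF sequentially_bot] by blast
      then show "\<forall>\<^sub>F n in sequentially. measure M (A n) * measure M (Y' - A n) < a"
        using bound[of i] by (auto elim: eventually_mono)
    qed
    have "measure (normalized_restriction M Y') (A n) * (1 - measure (normalized_restriction M Y') (A n))
        = measure M (A n) * measure M (Y' - A n) / (measure M Y')\<^sup>2" for n
    proof -
      have "measure M (Y' - A n) = measure M Y' - measure M (A n)"
        using finite_measure_Diff[OF Y's A(1) A(2)] .
      moreover have "measure (normalized_restriction M Y') (A n) = measure M (A n) / measure M Y'"
        by (rule meas[OF A])
      ultimately show ?thesis using Y'pos by (simp only:) (simp add: field_simps power2_eq_square)
    qed
    moreover have "(\<lambda>n. measure M (A n) * measure M (Y' - A n) / (measure M Y')\<^sup>2) \<longlonglongrightarrow> 0 / (measure M Y')\<^sup>2"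
      using Y'pos by (intro tendsto_divide lim0 tendsto_const) auto
    ultimately show "(\<lambda>n. measure (normalized_restriction M Y') (A n) * (1 - measure (normalized_restriction M Y') (A n))) \<longlonglongrightarrow> 0"
      by simp
  qed
  then show ?thesis using Y'(2) Y'pos by blast
qed

text \<open>Without a strongly ergodic component the limiting minimal energy is 0. Hence there are
  colourings with arbitrarily small boundary and energy below the square of \<open>t\<close>, and by
  \<open>energy_square\<close> their classes are small.\<close>

theorem small_almost_invariant_colouring:
  assumes no: "\<not> (\<exists>Y. invariant_set G M f Y \<and> 0 < measure M Y \<and>
      ergodic G (normalized_restriction M Y) (restrict_action f Y) \<and>
      strongly_ergodic G (normalized_restriction M Y) (restrict_action f Y))"
    and F: "finite F" "F \<subseteq> carrier G" and "0 < \<epsilon>" "0 < t"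
  shows "\<exists>\<phi>. colouring \<phi> \<and> (\<forall>i. measure M {x \<in> space M. \<phi> x = i} \<le> t) \<and> (\<forall>g\<in>F. discrepancy g \<phi> \<le> \<epsilon>)"
proof -
  obtain L where L: "0 \<le> L"
    "\<And>\<eta>. 0 < \<eta> \<Longrightarrow> \<exists>\<delta>>0. \<forall>\<psi>. colouring \<psi> \<longrightarrow> boundary_size \<psi> < \<delta> \<longrightarrow> L - \<eta> < energy \<psi>"
    "\<And>\<eta> \<delta>. 0 < \<eta> \<Longrightarrow> 0 < \<delta> \<Longrightarrow> \<exists>\<phi>. colouring \<phi> \<and> boundary_size \<phi> < \<delta> \<and> energy \<phi> < L + \<eta>"
    by (rule minimal_energy) blast
  have "L = 0"
    using strongly_ergodic_component[OF _ L(2,3)] L(1) no strongly_ergodic_imp_ergodic by fastforce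
  have "\<exists>n. \<forall>g. g \<in> F \<longrightarrow> (\<forall>\<phi> :: 'b \<Rightarrow> nat. \<phi> \<in> measurable M (count_space UNIV) \<longrightarrow> discrepancy g \<phi> \<le> real (n g) * boundary_size \<phi>)"
    unfolding boundary_size_def using discrepancy_generate[OF S_sub fin_S, where 'c = nat] F(2) gen_S
    by (intro choice) blast
  then obtain n where n: "\<And>g (\<phi> :: 'b \<Rightarrow> nat). g \<in> F \<Longrightarrow> \<phi> \<in> measurable M (count_space UNIV) \<Longrightarrow>
      discrepancy g \<phi> \<le> real (n g) * boundary_size \<phi>" by blast
  \<comment> \<open>A common bound for the constants by which \<open>discrepancy_generate\<close>
    controls the elements of \<open>F\<close>.\<close>
  define N where "N = Suc (\<Sum>g\<in>F. n g)"
  have nN: "n g \<le> N" if "g \<in> F" for g using member_le_sum[of g F n] F(1) that by (simp add: N_def)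
  obtain \<phi> where \<phi>: "colouring \<phi>" "boundary_size \<phi> < \<epsilon> / real N" "energy \<phi> < L + t\<^sup>2"
  proof -
    have "0 < \<epsilon> / real N" using assms(4) by (simp add: N_def del: of_nat_Suc)
    then show thesis using L(3)[of "t\<^sup>2" "\<epsilon> / real N"] assms(5) that by auto
  qed
  have "measure M {x \<in> space M. \<phi> x = i} \<le> t" for i
  proof (cases "\<exists>y\<in>space M. \<phi> y = i")
    case True
    then obtain y where y: "y \<in> space M" "\<phi> y = i" by blast
    have "(measure M {x \<in> space M. \<phi> x = i})\<^sup>2 \<le> t\<^sup>2"
      using energy_square[OF \<phi>(1) y(1)] \<phi>(3) \<open>L = 0\<close> y(2) by (simp add: colour_class_def)
    then show ?thesis by (rule power2_le_imp_le) (use assms(5) in simp)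
  next
    case False
    then have e: "{x \<in> space M. \<phi> x = i} = {}" by blast
    show ?thesis using assms(5) unfolding e measure_empty by simp
  qed
  moreover have "discrepancy g \<phi> \<le> \<epsilon>" if "g \<in> F" for g
  proof -
    have "discrepancy g \<phi> \<le> real (n g) * boundary_size \<phi>" using n[OF that colouringD[OF \<phi>(1)]] .
    also have "\<dots> \<le> real N * (\<epsilon> / real N)"
      using nN[OF that] \<phi>(2) boundary_size_nonneg[of \<phi>] by (intro mult_mono) auto
    also have "real N * (\<epsilon> / real N) = \<epsilon>" by (simp add: N_def del: of_nat_Suc)
    finally show ?thesis .
  qed
  ultimately show ?thesis using \<phi>(1) by blast
qed

end

section \<open>Local statistics\<close>

primrec word_ball :: "('a, 'm) monoid_scheme \<Rightarrow> 'a set \<Rightarrow> nat \<Rightarrow> 'a set" where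
  "word_ball G S 0 = {\<one>\<^bsub>G\<^esub>}"
| "word_ball G S (Suc r) = word_ball G S r \<union> {s \<otimes>\<^bsub>G\<^esub> g |s g. s \<in> S \<and> g \<in> word_ball G S r}"

lemma word_ball_mono: "r \<le> r' \<Longrightarrow> word_ball G S r \<subseteq> word_ball G S r'"
  by (induction r' rule: dec_induct) auto

lemma finite_word_ball: "finite S \<Longrightarrow> finite (word_ball G S r)"
proof (induction r)
  case (Suc r)
  have "{s \<otimes>\<^bsub>G\<^esub> g |s g. s \<in> S \<and> g \<in> word_ball G S r} = (\<lambda>(s, g). s \<otimes>\<^bsub>G\<^esub> g) ` (S \<times> word_ball G S r)"
    by auto
  then show ?case using Suc by simp
qed simp

locale symmetric_generators = group G for G (structure) +
  fixes S
  assumes S_fin: "finite S" and S_carrier: "S \<subseteq> carrier G" and S_inv: "\<And>s. s \<in> S \<Longrightarrow> inv s \<in> S"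
    and S_gen: "generate G S = carrier G"
begin

lemma word_ball_carrier: "word_ball G S r \<subseteq> carrier G"
  by (induction r) (use S_carrier in auto)

lemma word_ball_mult: "g \<in> word_ball G S a \<Longrightarrow> h \<in> word_ball G S b \<Longrightarrow> g \<otimes> h \<in> word_ball G S (a + b)"
proof (induction a arbitrary: g)
  case 0
  then show ?case using word_ball_carrier[of b] by (simp add: subset_iff)
next
  case (Suc a)
  show ?case
  proof (cases "g \<in> word_ball G S a")
    case True
    then show ?thesis using Suc by simp
  next
    case False
    then obtain s g' where g: "g = s \<otimes> g'" "s \<in> S" "g' \<in> word_ball G S a" using Suc.prems by auto
    have "g \<otimes> h = s \<otimes> (g' \<otimes> h)"
      using g Suc.prems(2) S_carrier word_ball_carrier by (auto intro!: m_assoc)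
    moreover have "g' \<otimes> h \<in> word_ball G S (a + b)" using Suc.IH g(3) Suc.prems(2) by blast
    ultimately show ?thesis using g(2) by auto
  qed
qed

lemma generator_word_ball: "s \<in> S \<Longrightarrow> s \<in> word_ball G S 1"
  using S_carrier by force

lemma word_ball_inv: "g \<in> word_ball G S a \<Longrightarrow> inv g \<in> word_ball G S a"
proof (induction a arbitrary: g)
  case (Suc a)
  show ?case
  proof (cases "g \<in> word_ball G S a")
    case False
    then obtain s g' where g: "g = s \<otimes> g'" "s \<in> S" "g' \<in> word_ball G S a" using Suc.prems by auto
    have "inv g = inv g' \<otimes> inv s"
      using g S_carrier word_ball_carrier by (auto intro!: inv_mult_group)
    then show ?thesis using word_ball_mult[OF Suc.IH[OF g(3)] generator_word_ball[OF S_inv[OF g(2)]]] by simp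
  qed (use Suc in simp)
qed simp

lemma word_ball_exhausts: "g \<in> carrier G \<Longrightarrow> \<exists>r. g \<in> word_ball G S r"
proof -
  assume "g \<in> carrier G"
  then have "g \<in> generate G S" using S_gen by simp
  then show ?thesis
  proof (induction rule: generate.induct)
    case one
    show ?case by (rule exI[of _ 0]) simp
  next
    case (incl h)
    then show ?case using generator_word_ball by blast
  next
    case (inv h)
    then show ?case using generator_word_ball S_inv by blast
  next
    case (eng g h)
    then show ?case using word_ball_mult by blast
  qed
qed

lemma finite_subset_word_ball: "finite F \<Longrightarrow> F \<subseteq> carrier G \<Longrightarrow> \<exists>r. F \<subseteq> word_ball G S r"
proof (induction F rule: finite_induct)
  case (insert g F)
  then obtain r r' where "F \<subseteq> word_ball G S r" "g \<in> word_ball G S r'" using word_ball_exhausts[of g] by auto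
  then have "insert g F \<subseteq> word_ball G S (max r r')"
    using word_ball_mono[of r "max r r'" G S] word_ball_mono[of r' "max r r'" G S] by auto
  then show ?case by blast
qed simp

end

lemma rooted_iso_trans:
  assumes "rooted_iso B C" "rooted_iso C D"
  shows "rooted_iso B D"
proof -
  obtain h k where h: "bij_betw h (verts B) (verts C)" "edges C = (\<lambda>(v, s, w). (h v, s, h w)) ` edges B"
      "centre C = h (centre B)" "\<forall>v\<in>verts B. colour C (h v) = colour B v"
    and k: "bij_betw k (verts C) (verts D)" "edges D = (\<lambda>(v, s, w). (k v, s, k w)) ` edges C"
      "centre D = k (centre C)" "\<forall>v\<in>verts C. colour D (k v) = colour C v"
    using assms unfolding rooted_iso_def by blast
  show ?thesis unfolding rooted_iso_def
  proof (intro exI[of _ "k \<circ> h"] conjI)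
    show "bij_betw (k \<circ> h) (verts B) (verts D)" using bij_betw_trans[OF h(1) k(1)] .
    show "edges D = (\<lambda>(v, s, w). ((k \<circ> h) v, s, (k \<circ> h) w)) ` edges B"
      unfolding k(2) h(2) image_image by (rule image_cong) auto
    show "centre D = (k \<circ> h) (centre B)" using h(3) k(3) by simp
    show "\<forall>v\<in>verts B. colour D ((k \<circ> h) v) = colour B v"
      using h(1,4) k(4) bij_betwE by fastforce
  qed
qed

text \<open>The isomorphism is inverted on the vertices only, so the edges and the centre have to
  lie there.\<close>

lemma rooted_iso_sym:
  assumes "rooted_iso B C" "edges B \<subseteq> verts B \<times> UNIV \<times> verts B" "centre B \<in> verts B"
  shows "rooted_iso C B"
proof -
  obtain h where h: "bij_betw h (verts B) (verts C)" "edges C = (\<lambda>(v, s, w). (h v, s, h w)) ` edges B"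
      "centre C = h (centre B)" "\<forall>v\<in>verts B. colour C (h v) = colour B v"
    using assms(1) unfolding rooted_iso_def by blast
  let ?k = "inv_into (verts B) h"
  have k: "?k (h v) = v" if "v \<in> verts B" for v using that h(1) by (simp add: bij_betw_def)
  have hk: "h (?k w) = w" "?k w \<in> verts B" if "w \<in> verts C" for w
    using that h(1) by (auto simp: bij_betw_def f_inv_into_f inv_into_into)
  show ?thesis unfolding rooted_iso_def
  proof (intro exI[of _ ?k] conjI)
    show "bij_betw ?k (verts C) (verts B)" using bij_betw_inv_into[OF h(1)] .
    have "(\<lambda>(v, s, w). (?k v, s, ?k w)) ` edges C = (\<lambda>e. e) ` edges B"
      unfolding h(2) image_image using assms(2) k by (intro image_cong) auto
    then show "edges B = (\<lambda>(v, s, w). (?k v, s, ?k w)) ` edges C" by simp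
    show "centre B = ?k (centre C)" using h(3) k assms(3) by simp
    show "\<forall>v\<in>verts C. colour B (?k v) = colour C v" using h(4) hk by metis
  qed
qed

context pmp_system
begin

text \<open>Since \<open>S\<close> is symmetric, following an edge labelled \<open>s\<close>
  backwards is a step by \<open>inv s\<close>, so undirected paths from \<open>x\<close> are words
  in \<open>S\<close>.\<close>

lemma ball_verts_eq:
  assumes "symmetric_generators G S" "x \<in> space M"
  shows "ball_verts (schreier_edges S (space M) f) x r = (\<lambda>g. f g x) ` word_ball G S r"
proof (induction r)
  case 0
  show ?case using f_one[OF assms(2)] by simp
next
  case (Suc r)
  interpret symmetric_generators G S by fact
  have "{z. \<exists>y\<in>(\<lambda>g. f g x) ` word_ball G S r. \<exists>s. (y, s, z) \<in> schreier_edges S (space M) f \<or> (z, s, y) \<in> schreier_edges S (space M) f}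
      = (\<lambda>g. f g x) ` {s \<otimes> g |s g. s \<in> S \<and> g \<in> word_ball G S r}" (is "?l = ?r")
  proof
    show "?l \<subseteq> ?r"
    proof
      fix z assume "z \<in> ?l"
      then obtain g s where g: "g \<in> word_ball G S r"
        and e: "(f g x, s, z) \<in> schreier_edges S (space M) f \<or> (z, s, f g x) \<in> schreier_edges S (space M) f" by auto
      have gc: "g \<in> carrier G" using g word_ball_carrier by blast
      from e show "z \<in> ?r"
      proof
        assume "(f g x, s, z) \<in> schreier_edges S (space M) f"
        then have s: "s \<in> S" "z = f s (f g x)" by (auto simp: schreier_edges_def)
        then have "z = f (s \<otimes> g) x" using f_mult[of s g x] gc S_carrier assms(2) by auto
        then show ?thesis using g s(1) by blast
      next
        assume "(z, s, f g x) \<in> schreier_edges S (space M) f"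
        then have s: "s \<in> S" "z \<in> space M" "f g x = f s z" by (auto simp: schreier_edges_def)
        then have sc: "s \<in> carrier G" using S_carrier by blast
        have "z = f (inv s) (f g x)" using f_inv[OF sc s(2)] s(3) by simp
        then have "z = f (inv s \<otimes> g) x" using f_mult[of "inv s" g x] gc sc assms(2) by auto
        then show ?thesis using g S_inv[OF s(1)] by blast
      qed
    qed
    show "?r \<subseteq> ?l"
    proof
      fix z assume "z \<in> ?r"
      then obtain s g where sg: "s \<in> S" "g \<in> word_ball G S r" "z = f (s \<otimes> g) x" by blast
      then have c: "s \<in> carrier G" "g \<in> carrier G" using S_carrier word_ball_carrier by blast+
      then have "(f g x, s, z) \<in> schreier_edges S (space M) f"
        using sg f_mult[OF c assms(2)] f_space[OF c(2) assms(2)] by (auto simp: schreier_edges_def)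
      then show "z \<in> ?l" using sg by blast
    qed
  qed
  then show ?case by (simp only: ball_verts.simps word_ball.simps Suc image_Un)
qed

lemma schreier_ball_simps:
  assumes "symmetric_generators G S" "x \<in> space M"
  shows "verts (schreier_ball S (space M) f \<phi> r x) = (\<lambda>g. f g x) ` word_ball G S r"
    "edges (schreier_ball S (space M) f \<phi> r x) = {(y, s, z). (y, s, z) \<in> schreier_edges S (space M) f \<and>
        y \<in> (\<lambda>g. f g x) ` word_ball G S r \<and> z \<in> (\<lambda>g. f g x) ` word_ball G S r}"
    "centre (schreier_ball S (space M) f \<phi> r x) = x"
    "colour (schreier_ball S (space M) f \<phi> r x) = \<phi>"
  using ball_verts_eq[OF assms] by (simp_all add: schreier_ball_def Let_def)

lemma schreier_ball_wf:
  assumes "symmetric_generators G S" "x \<in> space M"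
  shows "edges (schreier_ball S (space M) f \<phi> r x) \<subseteq>
      verts (schreier_ball S (space M) f \<phi> r x) \<times> UNIV \<times> verts (schreier_ball S (space M) f \<phi> r x)"
    "centre (schreier_ball S (space M) f \<phi> r x) \<in> verts (schreier_ball S (space M) f \<phi> r x)"
proof -
  have "\<one> \<in> word_ball G S r" using word_ball_mono[of 0 r G S] by simp
  then show "centre (schreier_ball S (space M) f \<phi> r x) \<in> verts (schreier_ball S (space M) f \<phi> r x)"
    using f_one[OF assms(2)] by (auto simp: schreier_ball_simps[OF assms] image_iff intro!: bexI[of _ \<one>])
qed (auto simp: schreier_ball_simps[OF assms])

text \<open>Reduces coincidences inside a ball to the stabilizer of its centre.\<close>

lemma same_point_iff:
  assumes "g \<in> carrier G" "h \<in> carrier G" "x \<in> space M"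
  shows "f g x = f h x \<longleftrightarrow> f (inv h \<otimes> g) x = x"
proof -
  have "f (inv h \<otimes> g) x = f (inv h) (f g x)" using f_mult assms by simp
  then show ?thesis
    using f_inv[of h x] f_inv'[of h "f g x"] assms f_space by metis
qed

end

text \<open>The map from \<open>f g x\<close> to \<open>h g y\<close> is well defined and injective
  because coincidences between points of the ball are stabilizer conditions. Edges lead to comparing
  words of lengths \<open>r + 1\<close> and \<open>r\<close>, whence the radius
  \<open>2 * r + 1\<close>.\<close>

lemma schreier_ball_iso:
  assumes "pmp_system G M f" "pmp_system G N h" "symmetric_generators G S"
    and x: "x \<in> space M" and y: "y \<in> space N"
    and fix_iff: "\<And>g. g \<in> word_ball G S (2 * r + 1) \<Longrightarrow> f g x = x \<longleftrightarrow> h g y = y"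
    and col: "\<And>g. g \<in> word_ball G S r \<Longrightarrow> \<phi> (f g x) = \<psi> (h g y)"
  shows "rooted_iso (schreier_ball S (space M) f \<phi> r x) (schreier_ball S (space N) h \<psi> r y)"
proof -
  interpret F: pmp_system G M f by fact
  interpret H: pmp_system G N h by fact
  interpret symmetric_generators G S by fact
  let ?W = "word_ball G S"
  have Wc: "g \<in> carrier G" if "g \<in> ?W n" for g n using that word_ball_carrier by blast
  have same: "f g x = f k x \<longleftrightarrow> h g y = h k y" if "g \<in> ?W (Suc r)" "k \<in> ?W r" for g k
  proof -
    have "inv\<^bsub>G\<^esub> k \<otimes>\<^bsub>G\<^esub> g \<in> ?W (r + Suc r)" using that by (intro word_ball_mult word_ball_inv)
    then have "f (inv\<^bsub>G\<^esub> k \<otimes>\<^bsub>G\<^esub> g) x = x \<longleftrightarrow> h (inv\<^bsub>G\<^esub> k \<otimes>\<^bsub>G\<^esub> g) y = y"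
      by (intro fix_iff) (simp add: mult_2)
    then show ?thesis
      using F.same_point_iff[OF Wc Wc x] H.same_point_iff[OF Wc Wc y] that by blast
  qed
  have sub: "?W r \<subseteq> ?W (Suc r)" by auto
  define \<theta> where "\<theta> v = h (SOME g. g \<in> ?W r \<and> f g x = v) y" for v
  have \<theta>: "\<theta> (f g x) = h g y" if "g \<in> ?W r" for g
  proof -
    have "\<exists>k. k \<in> ?W r \<and> f k x = f g x" using that by blast
    from someI_ex[OF this] show ?thesis unfolding \<theta>_def using same that sub by blast
  qed
  note sF = F.schreier_ball_simps[OF assms(3) x] and sH = H.schreier_ball_simps[OF assms(3) y]
  have eF: "(f g x, s, f k x) \<in> schreier_edges S (space M) f \<longleftrightarrow> s \<in> S \<and> f k x = f (s \<otimes>\<^bsub>G\<^esub> g) x"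
    if "g \<in> ?W r" for g s k
    using F.f_mult[of s g x] F.f_space[OF Wc x, OF that] Wc[OF that] S_carrier x by (auto simp: schreier_edges_def)
  have eH: "(h g y, s, h k y) \<in> schreier_edges S (space N) h \<longleftrightarrow> s \<in> S \<and> h k y = h (s \<otimes>\<^bsub>G\<^esub> g) y"
    if "g \<in> ?W r" for g s k
    using H.f_mult[of s g y] H.f_space[OF Wc y, OF that] Wc[OF that] S_carrier y by (auto simp: schreier_edges_def)
  have eFH: "(f g x, s, f k x) \<in> schreier_edges S (space M) f \<longleftrightarrow> (h g y, s, h k y) \<in> schreier_edges S (space N) h"
    if "g \<in> ?W r" "k \<in> ?W r" for g s k
  proof -
    have "s \<in> S \<Longrightarrow> s \<otimes>\<^bsub>G\<^esub> g \<in> ?W (Suc r)" using that by auto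
    then show ?thesis unfolding eF[OF that(1)] eH[OF that(1)] using same[of "s \<otimes>\<^bsub>G\<^esub> g" k] that by metis
  qed
  show ?thesis unfolding rooted_iso_def
  proof (intro exI[of _ \<theta>] conjI)
    show "bij_betw \<theta> (verts (schreier_ball S (space M) f \<phi> r x)) (verts (schreier_ball S (space N) h \<psi> r y))"
      unfolding sF sH
    proof (rule bij_betw_imageI)
      show "inj_on \<theta> ((\<lambda>g. f g x) ` ?W r)" using \<theta> same sub by (auto simp: inj_on_def)
      show "\<theta> ` (\<lambda>g. f g x) ` ?W r = (\<lambda>g. h g y) ` ?W r" unfolding image_image using \<theta> by (rule image_cong[OF HOL.refl])
    qed
    show "edges (schreier_ball S (space N) h \<psi> r y)
        = (\<lambda>(v, s, w). (\<theta> v, s, \<theta> w)) ` edges (schreier_ball S (space M) f \<phi> r x)"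
    proof (rule equalityI; rule subsetI)
      fix e assume "e \<in> edges (schreier_ball S (space N) h \<psi> r y)"
      then obtain g s k where e: "e = (h g y, s, h k y)" "g \<in> ?W r" "k \<in> ?W r" "(h g y, s, h k y) \<in> schreier_edges S (space N) h"
        unfolding sH by auto
      then have "(f g x, s, f k x) \<in> edges (schreier_ball S (space M) f \<phi> r x)"
        unfolding sF using eFH by auto
      then show "e \<in> (\<lambda>(v, s, w). (\<theta> v, s, \<theta> w)) ` edges (schreier_ball S (space M) f \<phi> r x)"
        using e \<theta> by (intro image_eqI[of _ _ "(f g x, s, f k x)"]) auto
    next
      fix e assume "e \<in> (\<lambda>(v, s, w). (\<theta> v, s, \<theta> w)) ` edges (schreier_ball S (space M) f \<phi> r x)"
      then obtain g s k where "e = (\<theta> (f g x), s, \<theta> (f k x))" "g \<in> ?W r" "k \<in> ?W r" "(f g x, s, f k x) \<in> schreier_edges S (space M) f"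
        unfolding sF by auto
      then show "e \<in> edges (schreier_ball S (space N) h \<psi> r y)"
        unfolding sH using eFH \<theta> by auto
    qed
    have one: "\<one>\<^bsub>G\<^esub> \<in> ?W r" using word_ball_mono[of 0 r G S] by simp
    show "centre (schreier_ball S (space N) h \<psi> r y) = \<theta> (centre (schreier_ball S (space M) f \<phi> r x))"
      unfolding sF sH using \<theta>[OF one] F.f_one[OF x] H.f_one[OF y] by simp
    show "\<forall>v\<in>verts (schreier_ball S (space M) f \<phi> r x).
        colour (schreier_ball S (space N) h \<psi> r y) (\<theta> v) = colour (schreier_ball S (space M) f \<phi> r x) v"
      unfolding sF sH using \<theta> col by auto
  qed
qed

lemma ball_type_eqI:
  assumes "pmp_system G M f" "pmp_system G N h" "symmetric_generators G S"
    and "x \<in> space M" and "y \<in> space N"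
    and "\<And>g. g \<in> word_ball G S (2 * r + 1) \<Longrightarrow> f g x = x \<longleftrightarrow> h g y = y"
    and "\<And>g. g \<in> word_ball G S r \<Longrightarrow> \<phi> (f g x) = \<psi> (h g y)"
  shows "ball_type S (space M) f \<phi> r x = ball_type S (space N) h \<psi> r y"
proof -
  have i: "rooted_iso (schreier_ball S (space M) f \<phi> r x) (schreier_ball S (space N) h \<psi> r y)"
    by (rule schreier_ball_iso) (use assms in auto)
  have j: "rooted_iso (schreier_ball S (space N) h \<psi> r y) (schreier_ball S (space M) f \<phi> r x)"
    by (rule rooted_iso_sym[OF i pmp_system.schreier_ball_wf[OF assms(1,3,4)]])
  show ?thesis unfolding ball_type_def using rooted_iso_trans[OF i] rooted_iso_trans[OF j] by blast
qed

text \<open>A rooted isomorphism that respects labels has to follow every word from the centre, so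
  it sends \<open>f g x\<close> to \<open>h g y\<close>, and it preserves colours.\<close>

lemma ball_type_colour:
  fixes M :: "'x measure" and N :: "'y measure"
  assumes "pmp_system G M f" "pmp_system G N h" "symmetric_generators G S"
    and x: "x \<in> space M" and y: "y \<in> space N"
    and eq: "ball_type S (space M) f \<phi> r x = ball_type S (space N) h \<psi> r y" and g: "g \<in> word_ball G S r"
  shows "\<phi> (f g x) = \<psi> (h g y)"
proof -
  interpret F: pmp_system G M f by fact
  interpret H: pmp_system G N h by fact
  interpret symmetric_generators G S by fact
  let ?W = "word_ball G S"
  let ?B = "schreier_ball S (space M) f \<phi> r x" and ?C = "schreier_ball S (space N) h \<psi> r y"
  have Wc: "g \<in> carrier G" if "g \<in> ?W n" for g n using that word_ball_carrier by blast
  note sF = F.schreier_ball_simps[OF assms(3) x] and sH = H.schreier_ball_simps[OF assms(3) y]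
  \<comment> \<open>Ball types contain only graphs on natural numbers, so the two balls are related
    through a copy \<open>D\<close> of the first one with such vertices.\<close>
  have "finite (verts ?B)" unfolding sF by (intro finite_imageI finite_word_ball S_fin)
  then obtain e :: "'x \<Rightarrow> nat" where e: "inj_on e (verts ?B)" using finite_imp_inj_to_nat_seg by blast
  define D where "D = \<lparr>verts = e ` verts ?B, edges = (\<lambda>(v, s, w). (e v, s, e w)) ` edges ?B,
      centre = e (centre ?B), colour = colour ?B \<circ> inv_into (verts ?B) e\<rparr>"
  have BD: "rooted_iso ?B D" unfolding rooted_iso_def D_def using e
    by (intro exI[of _ e]) (auto simp: bij_betw_def)
  then have "D \<in> ball_type S (space N) h \<psi> r y" using eq by (auto simp: ball_type_def)
  then have "rooted_iso D ?C"
    unfolding ball_type_def using rooted_iso_sym H.schreier_ball_wf[OF assms(3) y] by blast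
  from rooted_iso_trans[OF BD this] obtain \<theta> where \<theta>: "edges ?C = (\<lambda>(v, s, w). (\<theta> v, s, \<theta> w)) ` edges ?B"
      "centre ?C = \<theta> (centre ?B)" "\<forall>v\<in>verts ?B. colour ?C (\<theta> v) = colour ?B v"
    unfolding rooted_iso_def by blast
  have "\<theta> (f g x) = h g y" if "g \<in> ?W n" "n \<le> r" for g n
    using that
  proof (induction n arbitrary: g)
    case 0
    then show ?case using \<theta>(2) F.f_one[OF x] H.f_one[OF y] unfolding sF sH by simp
  next
    case (Suc n)
    show ?case
    proof (cases "g \<in> ?W n")
      case False
      then obtain s k where g: "g = s \<otimes>\<^bsub>G\<^esub> k" "s \<in> S" "k \<in> ?W n" using Suc.prems by auto
      have sc: "s \<in> carrier G" "k \<in> carrier G" using g S_carrier Wc by auto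
      have kr: "k \<in> ?W r" "g \<in> ?W r" using g(3) Suc.prems word_ball_mono[of n r G S] word_ball_mono[of "Suc n" r G S] by auto
      have "(f k x, s, f g x) \<in> schreier_edges S (space M) f"
        using g F.f_mult[OF sc x] F.f_space[OF sc(2) x] by (auto simp: schreier_edges_def)
      then have "(f k x, s, f g x) \<in> edges ?B"
        unfolding sF using imageI[OF kr(1), of "\<lambda>g. f g x"] imageI[OF kr(2), of "\<lambda>g. f g x"] by simp
      then have "(\<theta> (f k x), s, \<theta> (f g x)) \<in> edges ?C" unfolding \<theta>(1) by (auto simp: image_iff) (metis case_prod_conv)
      then have "\<theta> (f g x) = h s (\<theta> (f k x))" unfolding sH by (auto simp: schreier_edges_def)
      then show ?thesis using Suc g H.f_mult[OF sc y] by simp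
    qed (use Suc in simp)
  qed
  then show ?thesis using \<theta>(3) g unfolding sF sH by fastforce
qed

section \<open>Total variation and Hausdorff distance\<close>

lemma tv_dist_bdd:
  assumes "prob_space P" "prob_space Q"
  shows "bdd_above ((\<lambda>A. \<bar>measure P A - measure Q A\<bar>) ` sets P)"
proof (rule bdd_aboveI2[of _ _ 1])
  fix A
  show "\<bar>measure P A - measure Q A\<bar> \<le> 1"
    using prob_space.prob_le_1[OF assms(1), of A] prob_space.prob_le_1[OF assms(2), of A]
      measure_nonneg[of P A] measure_nonneg[of Q A] by linarith
qed

lemma tv_dist_ge:
  assumes "prob_space P" "prob_space Q" "A \<in> sets P"
  shows "\<bar>measure P A - measure Q A\<bar> \<le> tv_dist P Q"
  unfolding tv_dist_def using tv_dist_bdd[OF assms(1,2)] assms(3) by (rule cSUP_upper2) simp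

lemma tv_dist_leI: "(\<And>A. A \<in> sets P \<Longrightarrow> \<bar>measure P A - measure Q A\<bar> \<le> c) \<Longrightarrow> tv_dist P Q \<le> c"
proof -
  assume *: "\<And>A. A \<in> sets P \<Longrightarrow> \<bar>measure P A - measure Q A\<bar> \<le> c"
  have "sets P \<noteq> {}" using sets.empty_sets[of P] by blast
  then show ?thesis unfolding tv_dist_def using * by (rule cSUP_least)
qed

lemma tv_dist_nonneg: "prob_space P \<Longrightarrow> prob_space Q \<Longrightarrow> 0 \<le> tv_dist P Q"
  using tv_dist_ge[of P Q "{}"] by simp

lemma tv_dist_le_1:
  assumes "prob_space P" "prob_space Q"
  shows "tv_dist P Q \<le> 1"
proof (rule tv_dist_leI)
  fix A
  show "\<bar>measure P A - measure Q A\<bar> \<le> 1"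
    using prob_space.prob_le_1[OF assms(1), of A] prob_space.prob_le_1[OF assms(2), of A]
      measure_nonneg[of P A] measure_nonneg[of Q A] by linarith
qed

lemma tv_dist_self: "tv_dist P P = 0"
proof -
  have "sets P \<noteq> {}" using sets.empty_sets[of P] by blast
  then show ?thesis by (simp add: tv_dist_def)
qed

lemma tv_dist_sym: "sets P = sets Q \<Longrightarrow> tv_dist P Q = tv_dist Q P"
  unfolding tv_dist_def by (simp add: abs_minus_commute[of "measure P _"])

lemma tv_dist_triangle:
  assumes "prob_space P" "prob_space Q" "prob_space R" "sets P = sets Q"
  shows "tv_dist P R \<le> tv_dist P Q + tv_dist Q R"
proof (rule tv_dist_leI)
  fix A assume "A \<in> sets P"
  moreover from this have "A \<in> sets Q" using assms(4) by simp
  ultimately show "\<bar>measure P A - measure R A\<bar> \<le> tv_dist P Q + tv_dist Q R"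
    using tv_dist_ge[OF assms(1,2), of A] tv_dist_ge[OF assms(2,3), of A] by linarith
qed

lemma hausdorff_distance_le:
  fixes d :: "'b \<Rightarrow> 'b \<Rightarrow> real"
  assumes ne: "A \<noteq> {}" "B \<noteq> {}" and d0: "\<And>a b. a \<in> A \<Longrightarrow> b \<in> B \<Longrightarrow> 0 \<le> d a b \<and> d a b \<le> 1"
    and A: "\<And>a. a \<in> A \<Longrightarrow> \<exists>b\<in>B. d a b \<le> \<epsilon>" and B: "\<And>b. b \<in> B \<Longrightarrow> \<exists>a\<in>A. d a b \<le> \<epsilon>"
  shows "0 \<le> hausdorff_distance d A B" "hausdorff_distance d A B \<le> \<epsilon>"
proof -
  have infA: "(INF b\<in>B. d a b) \<le> \<epsilon>" if a: "a \<in> A" for a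
  proof -
    obtain b where "b \<in> B" "d a b \<le> \<epsilon>" using A[OF a] by blast
    then show ?thesis using d0[OF a] by (intro cINF_lower2[of _ _ b] bdd_belowI2[of _ 0]) auto
  qed
  have infB: "(INF a\<in>A. d a b) \<le> \<epsilon>" if b: "b \<in> B" for b
  proof -
    obtain a where "a \<in> A" "d a b \<le> \<epsilon>" using B[OF b] by blast
    then show ?thesis using d0[OF _ b] by (intro cINF_lower2[of _ _ a] bdd_belowI2[of _ 0]) auto
  qed
  have "(SUP a\<in>A. INF b\<in>B. d a b) \<le> \<epsilon>" using ne(1) infA by (rule cSUP_least)
  moreover have "(SUP b\<in>B. INF a\<in>A. d a b) \<le> \<epsilon>" using ne(2) infB by (rule cSUP_least)
  ultimately show "hausdorff_distance d A B \<le> \<epsilon>" by (simp add: hausdorff_distance_def)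
  obtain a where a: "a \<in> A" using ne(1) by blast
  have "0 \<le> (INF b\<in>B. d a b)" using ne(2) d0[OF a] by (intro cINF_greatest) auto
  also have "\<dots> \<le> (SUP a\<in>A. INF b\<in>B. d a b)"
    using infA by (intro cSUP_upper[OF a] bdd_aboveI2[of _ _ \<epsilon>])
  finally show "0 \<le> hausdorff_distance d A B" by (simp add: hausdorff_distance_def)
qed

text \<open>The bound 1 on \<open>d\<close> makes the real supremum a genuine upper bound of the
  infima, and an infimum below \<open>\<epsilon>\<close> has a witness.\<close>

lemma hausdorff_distance_lessD:
  fixes d :: "'b \<Rightarrow> 'b \<Rightarrow> real"
  assumes ne: "A \<noteq> {}" and d0: "\<And>a b. a \<in> A \<Longrightarrow> b \<in> B \<Longrightarrow> 0 \<le> d a b \<and> d a b \<le> 1"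
    and less: "hausdorff_distance d A B < \<epsilon>" and b: "b \<in> B"
  shows "\<exists>a\<in>A. d a b < \<epsilon>"
proof -
  have inf1: "(INF a\<in>A. d a b) \<le> 1" if b: "b \<in> B" for b
  proof -
    obtain a where "a \<in> A" using ne by blast
    then show ?thesis using d0[OF _ b] by (intro cINF_lower2[of _ _ a] bdd_belowI2[of _ 0]) auto
  qed
  have "(INF a\<in>A. d a b) \<le> (SUP b\<in>B. INF a\<in>A. d a b)"
    using inf1 by (intro cSUP_upper[OF b] bdd_aboveI2[of _ _ 1])
  also have "\<dots> < \<epsilon>" using less by (simp add: hausdorff_distance_def)
  finally show ?thesis
    using ne d0[OF _ b] by (subst (asm) cINF_less_iff) (auto intro!: bdd_belowI2[of _ 0])
qed

text \<open>Concrete data that determine the type of a coloured ball: the words fixing the point and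
  the colours they lead to. Patterns of different systems lie in one explicit finite set and can be
  compared directly.\<close>

definition pattern :: "'a set \<Rightarrow> ('a \<Rightarrow> 'x \<Rightarrow> 'x) \<Rightarrow> ('x \<Rightarrow> nat) \<Rightarrow> 'x \<Rightarrow> 'a set \<times> ('a \<Rightarrow> nat)" where
  "pattern U f \<phi> x = ({g \<in> U. f g x = x}, restrict (\<lambda>g. \<phi> (f g x)) U)"

definition patterns :: "'a set \<Rightarrow> nat \<Rightarrow> ('a set \<times> ('a \<Rightarrow> nat)) set" where
  "patterns U k = Pow U \<times> (U \<rightarrow>\<^sub>E {1..k})"

lemma finite_patterns: "finite U \<Longrightarrow> finite (patterns U k)"
  by (auto simp: patterns_def intro!: finite_PiE)

text \<open>Ball types depend on stabilizers, so their measurability rests on that of the fixed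
  point sets. On a finite space this is automatic; on the limit space it is checked in
  coordinates.\<close>

locale fixed_point_measurable = pmp_system +
  assumes fixed_sets: "\<And>g. g \<in> carrier G \<Longrightarrow> {x \<in> space M. f g x = x} \<in> sets M"
begin

lemma pattern_in_patterns:
  assumes "U \<subseteq> carrier G" "\<phi> \<in> measurable M (count_space {1..k})" "x \<in> space M"
  shows "pattern U f \<phi> x \<in> patterns U k"
proof -
  have "\<phi> (f g x) \<in> {1..k}" if "g \<in> U" for g
    using measurable_space[OF assms(2), of "f g x"] f_space[of g x] that assms(1,3) by auto
  then show ?thesis unfolding pattern_def patterns_def by (auto simp: PiE_def Pi_def)
qed

lemma pattern_sets:
  assumes U: "U \<subseteq> carrier G" "finite U" and \<phi>: "\<phi> \<in> measurable M (count_space {1..k})"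
  shows "{x \<in> space M. pattern U f \<phi> x = q} \<in> sets M"
proof -
  obtain P c where q: "q = (P, c)" by (cases q)
  have fx: "{x \<in> space M. (f g x = x) \<longleftrightarrow> g \<in> P} \<in> sets M" if "g \<in> U" for g
  proof (cases "g \<in> P")
    case False
    have "{x \<in> space M. f g x \<noteq> x} = space M - {x \<in> space M. f g x = x}" by auto
    then show ?thesis using False fixed_sets[of g] that U(1) by auto
  qed (use fixed_sets[of g] that U(1) in auto)
  have cx: "{x \<in> space M. \<phi> (f g x) = c g} \<in> sets M" if "g \<in> U" for g
  proof (cases "c g \<in> {1..k}")
    case True
    have "(\<lambda>x. \<phi> (f g x)) -` {c g} \<inter> space M \<in> sets M"
      using measurable_sets[OF shift_measurable[OF _ \<phi>], of g "{c g}"] that U(1) True by auto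
    then show ?thesis by (simp add: vimage_def Int_def conj_commute)
  next
    case False
    then have "{x \<in> space M. \<phi> (f g x) = c g} = {}"
      using measurable_space[OF \<phi> f_space[of g]] that U(1) by fastforce
    then show ?thesis by (simp only: sets.empty_sets)
  qed
  show ?thesis
  proof (cases "P \<subseteq> U \<and> c \<in> extensional U")
    case True
    have "{x \<in> space M. pattern U f \<phi> x = q} = {x \<in> space M. \<forall>g\<in>U. ((f g x = x) \<longleftrightarrow> g \<in> P) \<and> \<phi> (f g x) = c g}"
      using True unfolding q pattern_def by (auto simp: fun_eq_iff extensional_def restrict_def)
    also have "\<dots> \<in> sets M"
      using fx cx U(2) by (intro sets.sets_Collect_finite_All sets.sets_Collect_conj) auto
    finally show ?thesis .
  next
    case False
    then have "{x \<in> space M. pattern U f \<phi> x = q} = {}" unfolding q pattern_def by auto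
    then show ?thesis by (simp only: sets.empty_sets)
  qed
qed

end

text \<open>Vertices and edges of the \<open>r\<close>-ball are determined by which words of length at most \<open>2 * r + 1\<close> fix the centre.\<close>

definition big_ball :: "('a, 'm) monoid_scheme \<Rightarrow> 'a set \<Rightarrow> nat \<Rightarrow> 'a set" where
  "big_ball G S r = word_ball G S (2 * r + 1)"

lemma finite_big_ball: "finite S \<Longrightarrow> finite (big_ball G S r)"
  unfolding big_ball_def by (rule finite_word_ball)

lemma word_ball_subset_big_ball: "word_ball G S r \<subseteq> big_ball G S r"
  unfolding big_ball_def by (rule word_ball_mono) simp

lemma (in symmetric_generators) big_ball_carrier: "big_ball G S r \<subseteq> carrier G"
  unfolding big_ball_def by (rule word_ball_carrier)

lemma (in symmetric_generators) ball_type_pattern: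
  assumes "pmp_system G M f" "pmp_system G N h" "x \<in> space M" "y \<in> space N"
    and eq: "pattern (big_ball G S r) f \<phi> x = pattern (big_ball G S r) h \<psi> y"
  shows "ball_type S (space M) f \<phi> r x = ball_type S (space N) h \<psi> r y"
proof (rule ball_type_eqI[OF assms(1,2) symmetric_generators_axioms assms(3,4)])
  fix g assume "g \<in> word_ball G S (2 * r + 1)"
  then have "g \<in> big_ball G S r" by (simp only: big_ball_def)
  then show "f g x = x \<longleftrightarrow> h g y = y" using eq by (auto simp: pattern_def)
next
  fix g assume "g \<in> word_ball G S r"
  then have g: "g \<in> big_ball G S r" by (rule subsetD[OF word_ball_subset_big_ball])
  have "restrict (\<lambda>g. \<phi> (f g x)) (big_ball G S r) g = restrict (\<lambda>g. \<psi> (h g y)) (big_ball G S r) g"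
    using eq by (simp add: pattern_def)
  then show "\<phi> (f g x) = \<psi> (h g y)" using g by simp
qed

locale symmetric_system = fixed_point_measurable G M f + symmetric_generators G S
  for G :: "('a, 'm) monoid_scheme" (structure) and M :: "'b measure" and f and S
begin

text \<open>The ball type is a function of the pattern, and the patterns form a finite measurable
  partition.\<close>

lemma ball_type_vimage:
  assumes "\<phi> \<in> measurable M (count_space {1..k})"
  shows "ball_type S (space M) f \<phi> r -` D \<inter> space M
    = (\<Union>q\<in>{q \<in> patterns (big_ball G S r) k. \<exists>x\<in>space M. pattern (big_ball G S r) f \<phi> x = q \<and> ball_type S (space M) f \<phi> r x \<in> D}.
        {x \<in> space M. pattern (big_ball G S r) f \<phi> x = q})"
    (is "?l = (\<Union>q\<in>?Q. ?A q)")
proof (rule equalityI; rule subsetI)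
  fix x assume "x \<in> ?l"
  then show "x \<in> (\<Union>q\<in>?Q. ?A q)"
    using pattern_in_patterns[OF big_ball_carrier assms, of x r] by blast
next
  fix x assume "x \<in> (\<Union>q\<in>?Q. ?A q)"
  then obtain y where x: "x \<in> space M" "y \<in> space M" "pattern (big_ball G S r) f \<phi> y = pattern (big_ball G S r) f \<phi> x"
    "ball_type S (space M) f \<phi> r y \<in> D" by auto
  then show "x \<in> ?l"
    using ball_type_pattern[OF pmp_system_axioms pmp_system_axioms x(2,1,3)] by simp
qed

lemma ball_type_measurable:
  assumes "\<phi> \<in> measurable M (count_space {1..k})"
  shows "ball_type S (space M) f \<phi> r \<in> measurable M (count_space UNIV)"
proof (rule measurableI)
  fix D
  show "ball_type S (space M) f \<phi> r -` D \<inter> space M \<in> sets M"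
    unfolding ball_type_vimage[OF assms]
    by (intro sets.finite_UN finite_subset[OF _ finite_patterns[OF finite_big_ball[OF S_fin]]]
        pattern_sets[OF big_ball_carrier finite_big_ball[OF S_fin] assms]) auto
qed simp

lemma local_statistics_prob:
  assumes "\<phi> \<in> measurable M (count_space {1..k})"
  shows "prob_space (local_statistics S M f \<phi> r)"
  unfolding local_statistics_def by (rule prob_space_distr[OF ball_type_measurable[OF assms]])

lemma local_statistics_sets: "sets (local_statistics S M f \<phi> r) = UNIV"
  by (simp add: local_statistics_def)

lemma local_statistics_measure:
  assumes "\<phi> \<in> measurable M (count_space {1..k})"
  shows "measure (local_statistics S M f \<phi> r) D = measure M {x \<in> space M. ball_type S (space M) f \<phi> r x \<in> D}"
  unfolding local_statistics_def
  by (subst measure_distr[OF ball_type_measurable[OF assms]]) (auto simp: vimage_def Int_def conj_commute)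

lemma pattern_union_measure:
  assumes "\<phi> \<in> measurable M (count_space {1..k})" "Q \<subseteq> patterns (big_ball G S r) k"
  shows "measure M {x \<in> space M. pattern (big_ball G S r) f \<phi> x \<in> Q}
     = (\<Sum>q\<in>Q. measure M {x \<in> space M. pattern (big_ball G S r) f \<phi> x = q})"
proof -
  have fin: "finite Q" using assms(2) finite_patterns[OF finite_big_ball[OF S_fin]] finite_subset by blast
  have "{x \<in> space M. pattern (big_ball G S r) f \<phi> x \<in> Q} = (\<Union>q\<in>Q. {x \<in> space M. pattern (big_ball G S r) f \<phi> x = q})" by auto
  also have "measure M \<dots> = (\<Sum>q\<in>Q. measure M {x \<in> space M. pattern (big_ball G S r) f \<phi> x = q})"
    using fin pattern_sets[OF big_ball_carrier finite_big_ball[OF S_fin] assms(1)]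
    by (intro finite_measure_finite_Union) (auto simp: disjoint_family_on_def)
  finally show ?thesis .
qed

lemma colour_statistics_local:
  assumes "\<phi> \<in> measurable M (count_space {1..k})"
  shows "local_statistics S M f \<phi> r \<in> colour_statistics S M f k r"
proof -
  have "\<exists>\<psi>\<in>measurable M (count_space {1..k}). tv_dist (local_statistics S M f \<phi> r) (local_statistics S M f \<psi> r) < \<epsilon>"
    if "0 < \<epsilon>" for \<epsilon>
    using that assms tv_dist_self[of "local_statistics S M f \<phi> r"] by (intro bexI[of _ \<phi>]) simp_all
  then show ?thesis
    unfolding colour_statistics_def using local_statistics_prob[OF assms] local_statistics_sets by blast
qed

lemma colour_statistics_nonempty:
  assumes "1 \<le> k"
  shows "colour_statistics S M f k r \<noteq> {}"
proof -
  have "(\<lambda>_. 1) \<in> measurable M (count_space {1..k})" using assms by (intro measurable_const) simp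
  from colour_statistics_local[OF this] show ?thesis by blast
qed

end

section \<open>Weak convergence in terms of single colourings\<close>

lemma colour_statistics_prob: "P \<in> colour_statistics S M f k r \<Longrightarrow> prob_space P"
  and colour_statistics_sets: "P \<in> colour_statistics S M f k r \<Longrightarrow> sets P = UNIV"
  and colour_statistics_approx: "P \<in> colour_statistics S M f k r \<Longrightarrow> 0 < \<epsilon> \<Longrightarrow>
    \<exists>\<phi>\<in>measurable M (count_space {1..k}). tv_dist P (local_statistics S M f \<phi> r) < \<epsilon>"
  unfolding colour_statistics_def by blast+

text \<open>Every event about ball types is a union of patterns, the same union in both systems, so
  its probabilities differ by at most the sum of the differences of the pattern frequencies.\<close>

lemma local_statistics_tv:
  fixes r :: nat
  assumes "symmetric_system G M f S" "symmetric_system G N h S"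
    and \<phi>: "\<phi> \<in> measurable M (count_space {1..k})" and \<psi>: "\<psi> \<in> measurable N (count_space {1..k})"
  defines "U \<equiv> big_ball G S r"
  assumes close: "(\<Sum>q\<in>patterns U k. \<bar>measure M {x \<in> space M. pattern U f \<phi> x = q} - measure N {y \<in> space N. pattern U h \<psi> y = q}\<bar>) \<le> \<epsilon>"
  shows "tv_dist (local_statistics S M f \<phi> r) (local_statistics S N h \<psi> r) \<le> \<epsilon>"
proof (rule tv_dist_leI)
  interpret F: symmetric_system G M f S by fact
  interpret H: symmetric_system G N h S by fact
  fix D
  let ?bF = "ball_type S (space M) f \<phi> r" and ?bH = "ball_type S (space N) h \<psi> r"
  \<comment> \<open>Both systems are consulted, since a pattern may occur in only one of
    them.\<close>
  define Q where "Q = {q \<in> patterns U k. (\<exists>x\<in>space M. pattern U f \<phi> x = q \<and> ?bF x \<in> D) \<or> (\<exists>y\<in>space N. pattern U h \<psi> y = q \<and> ?bH y \<in> D)}"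
  have pF: "pattern U f \<phi> x \<in> patterns U k" if "x \<in> space M" for x
    unfolding U_def by (rule F.pattern_in_patterns[OF F.big_ball_carrier \<phi> that])
  have pH: "pattern U h \<psi> y \<in> patterns U k" if "y \<in> space N" for y
    unfolding U_def by (rule H.pattern_in_patterns[OF F.big_ball_carrier \<psi> that])
  have FF: "?bF x = ?bF x'" if "x \<in> space M" "x' \<in> space M" "pattern U f \<phi> x = pattern U f \<phi> x'" for x x'
    using F.ball_type_pattern[OF F.pmp_system_axioms F.pmp_system_axioms that(1,2)] that(3) unfolding U_def by blast
  have HH: "?bH x = ?bH x'" if "x \<in> space N" "x' \<in> space N" "pattern U h \<psi> x = pattern U h \<psi> x'" for x x'
    using F.ball_type_pattern[OF H.pmp_system_axioms H.pmp_system_axioms that(1,2)] that(3) unfolding U_def by blast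
  have FH: "?bF x = ?bH y" if "x \<in> space M" "y \<in> space N" "pattern U f \<phi> x = pattern U h \<psi> y" for x y
    using F.ball_type_pattern[OF F.pmp_system_axioms H.pmp_system_axioms that(1,2)] that(3) unfolding U_def by blast
  have "?bF x \<in> D \<longleftrightarrow> pattern U f \<phi> x \<in> Q" if x: "x \<in> space M" for x
  proof
    assume "?bF x \<in> D"
    then show "pattern U f \<phi> x \<in> Q" unfolding Q_def using pF[OF x] x by blast
  next
    assume "pattern U f \<phi> x \<in> Q"
    then consider x' where "x' \<in> space M" "pattern U f \<phi> x' = pattern U f \<phi> x" "?bF x' \<in> D"
      | y where "y \<in> space N" "pattern U h \<psi> y = pattern U f \<phi> x" "?bH y \<in> D"
      unfolding Q_def by blast
    then show "?bF x \<in> D" using FF[OF x] FH[OF x] by cases metis+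
  qed
  then have sF: "{x \<in> space M. ?bF x \<in> D} = {x \<in> space M. pattern U f \<phi> x \<in> Q}" by blast
  have "?bH y \<in> D \<longleftrightarrow> pattern U h \<psi> y \<in> Q" if y: "y \<in> space N" for y
  proof
    assume "?bH y \<in> D"
    then show "pattern U h \<psi> y \<in> Q" unfolding Q_def using pH[OF y] y by blast
  next
    assume "pattern U h \<psi> y \<in> Q"
    then consider x where "x \<in> space M" "pattern U f \<phi> x = pattern U h \<psi> y" "?bF x \<in> D"
      | y' where "y' \<in> space N" "pattern U h \<psi> y' = pattern U h \<psi> y" "?bH y' \<in> D"
      unfolding Q_def by blast
    then show "?bH y \<in> D" using HH[OF y] FH[OF _ y] by cases metis+
  qed
  then have sH: "{y \<in> space N. ?bH y \<in> D} = {y \<in> space N. pattern U h \<psi> y \<in> Q}" by blast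
  have QP: "Q \<subseteq> patterns U k" by (auto simp: Q_def)
  have "\<bar>measure (local_statistics S M f \<phi> r) D - measure (local_statistics S N h \<psi> r) D\<bar>
     = \<bar>\<Sum>q\<in>Q. measure M {x \<in> space M. pattern U f \<phi> x = q} - measure N {y \<in> space N. pattern U h \<psi> y = q}\<bar>"
    unfolding F.local_statistics_measure[OF \<phi>] H.local_statistics_measure[OF \<psi>] sF sH sum_subtractf
    using F.pattern_union_measure[OF \<phi>] H.pattern_union_measure[OF \<psi>] QP unfolding U_def by simp
  also have "\<dots> \<le> (\<Sum>q\<in>Q. \<bar>measure M {x \<in> space M. pattern U f \<phi> x = q} - measure N {y \<in> space N. pattern U h \<psi> y = q}\<bar>)"
    by (rule sum_abs)
  also have "\<dots> \<le> (\<Sum>q\<in>patterns U k. \<bar>measure M {x \<in> space M. pattern U f \<phi> x = q} - measure N {y \<in> space N. pattern U h \<psi> y = q}\<bar>)"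
    using finite_patterns[OF finite_big_ball[OF F.S_fin]] QP unfolding U_def by (intro sum_mono2) auto
  also have "\<dots> \<le> \<epsilon>" by (rule close)
  finally show "\<bar>measure (local_statistics S M f \<phi> r) D - measure (local_statistics S N h \<psi> r) D\<bar> \<le> \<epsilon>" .
qed

text \<open>The sets under the Hausdorff distance are closures: one \<open>\<epsilon>\<close> is
  spent on passing to an actual colouring and another on the matching colouring of the other
  system.\<close>

lemma weakly_convergesI:
  assumes Ms: "\<And>n. symmetric_system G (Ms n) (fs n) S" and M: "symmetric_system G M f S"
    and lower: "\<And>r k \<epsilon>. 1 \<le> k \<Longrightarrow> 0 < \<epsilon> \<Longrightarrow> \<forall>\<^sub>F n in sequentially. \<forall>\<phi>\<in>measurable (Ms n) (count_space {1..k}).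
        \<exists>\<psi>\<in>measurable M (count_space {1..k}). tv_dist (local_statistics S (Ms n) (fs n) \<phi> r) (local_statistics S M f \<psi> r) \<le> \<epsilon>"
    and upper: "\<And>r k \<epsilon>. 1 \<le> k \<Longrightarrow> 0 < \<epsilon> \<Longrightarrow> \<forall>\<^sub>F n in sequentially. \<forall>\<psi>\<in>measurable M (count_space {1..k}).
        \<exists>\<phi>\<in>measurable (Ms n) (count_space {1..k}). tv_dist (local_statistics S (Ms n) (fs n) \<phi> r) (local_statistics S M f \<psi> r) \<le> \<epsilon>"
  shows "weakly_converges S Ms fs M f"
  unfolding weakly_converges_def
proof (intro allI impI)
  fix r k :: nat assume k: "1 \<le> k"
  let ?Q = "\<lambda>n. colour_statistics S (Ms n) (fs n) k r" and ?R = "colour_statistics S M f k r"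
  interpret F: symmetric_system G M f S by (rule M)
  have ev: "\<forall>\<^sub>F n in sequentially. 0 \<le> hausdorff_distance tv_dist (?Q n) ?R \<and> hausdorff_distance tv_dist (?Q n) ?R \<le> 2 * \<epsilon>"
    if \<epsilon>: "0 < \<epsilon>" for \<epsilon>
    using lower[OF k \<epsilon>, of r] upper[OF k \<epsilon>, of r]
  proof eventually_elim
    case (elim n)
    interpret N: symmetric_system G "Ms n" "fs n" S by (rule Ms)
    have A: "\<exists>b\<in>?R. tv_dist a b \<le> 2 * \<epsilon>" if a: "a \<in> ?Q n" for a
    proof -
      note pa = colour_statistics_prob[OF a] colour_statistics_sets[OF a]
      obtain \<phi> where \<phi>: "\<phi> \<in> measurable (Ms n) (count_space {1..k})" "tv_dist a (local_statistics S (Ms n) (fs n) \<phi> r) < \<epsilon>"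
        using colour_statistics_approx[OF a \<epsilon>] by blast
      obtain \<psi> where \<psi>: "\<psi> \<in> measurable M (count_space {1..k})"
          "tv_dist (local_statistics S (Ms n) (fs n) \<phi> r) (local_statistics S M f \<psi> r) \<le> \<epsilon>"
        using elim(1) \<phi>(1) by blast
      have "tv_dist a (local_statistics S M f \<psi> r) \<le> 2 * \<epsilon>"
        using tv_dist_triangle[OF pa(1) N.local_statistics_prob[OF \<phi>(1)] F.local_statistics_prob[OF \<psi>(1)], of r r]
          pa(2) N.local_statistics_sets \<phi>(2) \<psi>(2) by simp
      then show ?thesis using F.colour_statistics_local[OF \<psi>(1)] by blast
    qed
    have B: "\<exists>a\<in>?Q n. tv_dist a b \<le> 2 * \<epsilon>" if b: "b \<in> ?R" for b
    proof -
      note pb = colour_statistics_prob[OF b] colour_statistics_sets[OF b]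
      obtain \<psi> where \<psi>: "\<psi> \<in> measurable M (count_space {1..k})" "tv_dist b (local_statistics S M f \<psi> r) < \<epsilon>"
        using colour_statistics_approx[OF b \<epsilon>] by blast
      obtain \<phi> where \<phi>: "\<phi> \<in> measurable (Ms n) (count_space {1..k})"
          "tv_dist (local_statistics S (Ms n) (fs n) \<phi> r) (local_statistics S M f \<psi> r) \<le> \<epsilon>"
        using elim(2) \<psi>(1) by blast
      have "tv_dist (local_statistics S M f \<psi> r) b < \<epsilon>"
        using \<psi>(2) tv_dist_sym[of b "local_statistics S M f \<psi> r"] pb(2) F.local_statistics_sets by simp
      then have "tv_dist (local_statistics S (Ms n) (fs n) \<phi> r) b \<le> 2 * \<epsilon>"
        using tv_dist_triangle[OF N.local_statistics_prob[OF \<phi>(1)] F.local_statistics_prob[OF \<psi>(1)] pb(1), of r r]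
          N.local_statistics_sets F.local_statistics_sets \<phi>(2) by simp
      then show ?thesis using N.colour_statistics_local[OF \<phi>(1)] by blast
    qed
    have d: "0 \<le> tv_dist a b \<and> tv_dist a b \<le> 1" if "a \<in> ?Q n" "b \<in> ?R" for a b
      using that[THEN colour_statistics_prob] tv_dist_nonneg tv_dist_le_1 by blast
    show ?case
      using hausdorff_distance_le[OF N.colour_statistics_nonempty[OF k] F.colour_statistics_nonempty[OF k] d A B] by blast
  qed
  show "(\<lambda>n. hausdorff_distance tv_dist (?Q n) ?R) \<longlonglongrightarrow> 0"
  proof (rule tendstoI)
    fix \<epsilon> :: real assume "0 < \<epsilon>"
    then show "\<forall>\<^sub>F n in sequentially. dist (hausdorff_distance tv_dist (?Q n) ?R) 0 < \<epsilon>"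
      using ev[of "\<epsilon> / 3"] by (auto elim!: eventually_mono)
  qed
qed

text \<open>The Hausdorff distance yields only a limit of statistics of colourings, so half of
  \<open>\<epsilon>\<close> is kept for a colouring that approximates it.\<close>

lemma weakly_convergesD:
  assumes Ms: "\<And>n. symmetric_system G (Ms n) (fs n) S" and M: "symmetric_system G M f S"
    and conv: "weakly_converges S Ms fs M f" and k: "1 \<le> k" and \<epsilon>: "0 < \<epsilon>" and \<psi>: "\<psi> \<in> measurable M (count_space {1..k})"
  shows "\<forall>\<^sub>F n in sequentially. \<exists>\<phi>\<in>measurable (Ms n) (count_space {1..k}).
      tv_dist (local_statistics S (Ms n) (fs n) \<phi> r) (local_statistics S M f \<psi> r) < \<epsilon>"
proof -
  interpret F: symmetric_system G M f S by (rule M)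
  have "(\<lambda>n. hausdorff_distance tv_dist (colour_statistics S (Ms n) (fs n) k r) (colour_statistics S M f k r)) \<longlonglongrightarrow> 0"
    by (rule conv[unfolded weakly_converges_def, rule_format, OF k])
  then have "\<forall>\<^sub>F n in sequentially. hausdorff_distance tv_dist (colour_statistics S (Ms n) (fs n) k r) (colour_statistics S M f k r) < \<epsilon> / 2"
    by (rule order_tendstoD(2)) (use \<epsilon> in simp)
  then show ?thesis
  proof eventually_elim
    case (elim n)
    interpret N: symmetric_system G "Ms n" "fs n" S by (rule Ms)
    have d: "0 \<le> tv_dist a b \<and> tv_dist a b \<le> 1"
      if "a \<in> colour_statistics S (Ms n) (fs n) k r" "b \<in> colour_statistics S M f k r" for a b
      using that[THEN colour_statistics_prob] tv_dist_nonneg tv_dist_le_1 by blast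
    obtain a where a: "a \<in> colour_statistics S (Ms n) (fs n) k r" "tv_dist a (local_statistics S M f \<psi> r) < \<epsilon> / 2"
      using hausdorff_distance_lessD[OF N.colour_statistics_nonempty[OF k] d elim F.colour_statistics_local[OF \<psi>]] by blast
    note pa = colour_statistics_prob[OF a(1)] colour_statistics_sets[OF a(1)]
    obtain \<phi> where \<phi>: "\<phi> \<in> measurable (Ms n) (count_space {1..k})" "tv_dist a (local_statistics S (Ms n) (fs n) \<phi> r) < \<epsilon> / 2"
      using colour_statistics_approx[OF a(1) half_gt_zero[OF \<epsilon>]] by blast
    have "tv_dist (local_statistics S (Ms n) (fs n) \<phi> r) a < \<epsilon> / 2"
      using \<phi>(2) tv_dist_sym[of a "local_statistics S (Ms n) (fs n) \<phi> r"] pa(2) N.local_statistics_sets by simp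
    then have "tv_dist (local_statistics S (Ms n) (fs n) \<phi> r) (local_statistics S M f \<psi> r) < \<epsilon>"
      using tv_dist_triangle[OF N.local_statistics_prob[OF \<phi>(1)] pa(1) F.local_statistics_prob[OF \<psi>], of r r]
        N.local_statistics_sets a(2) pa(2) by simp
    then show ?case using \<phi>(1) by blast
  qed
qed

section \<open>Weak limits of finite systems\<close>

text \<open>Used with values in \<open>bool\<close> for finite-dimensional events, and with other
  values for colourings and patterns.\<close>

definition depends_on :: "'i set \<Rightarrow> (('i \<Rightarrow> 'v) \<Rightarrow> 'b) \<Rightarrow> bool" where
  "depends_on J E \<longleftrightarrow> (\<forall>z z'. (\<forall>i\<in>J. z i = z' i) \<longrightarrow> E z = E z')"

lemma depends_onD: "depends_on J E \<Longrightarrow> (\<And>i. i \<in> J \<Longrightarrow> z i = z' i) \<Longrightarrow> E z = E z'"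
  by (simp add: depends_on_def)

lemma depends_on_comp: "depends_on J E \<Longrightarrow> depends_on J (\<lambda>z. h (E z))"
  unfolding depends_on_def by (intro allI impI arg_cong[where f = h]) blast

lemma coordinate_sets: "{z :: 'i::countable \<Rightarrow> 'v::second_countable_topology. z i \<in> B} \<in> sets borel"
  if "B \<in> sets borel"
proof -
  have "(\<lambda>z :: 'i \<Rightarrow> 'v. z i) \<in> borel_measurable borel"
    by (intro borel_measurable_continuous_onI continuous_on_product_coordinates)
  from measurable_sets[OF this that] show ?thesis by (simp add: vimage_def)
qed

lemma discrete_borel_sets: "B \<in> sets (borel :: 'a discrete measure)"
  using open_discrete borel_open by blast

lemma cylinder_sets:
  fixes v :: "'i::countable \<Rightarrow> 'c::countable discrete"
  assumes "finite J"
  shows "{z. \<forall>i\<in>J. z i = v i} \<in> sets borel"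
proof -
  have "{z \<in> space borel. \<forall>i\<in>J. z i = v i} \<in> sets borel"
  proof (rule sets.sets_Collect_finite_All[OF _ assms])
    fix i
    show "{z \<in> space borel. z i = v i} \<in> sets borel"
      using coordinate_sets[OF discrete_borel_sets, where B = "{v i}" and i = i] by simp
  qed
  then show ?thesis by simp
qed

lemma cylinder_partition:
  fixes E :: "('i \<Rightarrow> 'v) \<Rightarrow> bool"
  assumes "depends_on J E"
  shows "{z. E z} = (\<Union>v\<in>{v \<in> PiE J (\<lambda>_. UNIV). E v}. {z. \<forall>i\<in>J. z i = v i})"
proof (rule equalityI; rule subsetI)
  fix z assume "z \<in> {z. E z}"
  then have "E (restrict z J)" using depends_onD[OF assms, of z "restrict z J"] by simp
  then show "z \<in> (\<Union>v\<in>{v \<in> PiE J (\<lambda>_. UNIV). E v}. {z. \<forall>i\<in>J. z i = v i})"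
    by (intro UN_I[of "restrict z J"]) auto
next
  fix z assume "z \<in> (\<Union>v\<in>{v \<in> PiE J (\<lambda>_. UNIV). E v}. {z. \<forall>i\<in>J. z i = v i})"
  then obtain v where "E v" "\<forall>i\<in>J. z i = v i" by blast
  then show "z \<in> {z. E z}" using depends_onD[OF assms, of z v] by simp
qed

lemma depends_on_sets:
  fixes E :: "('i::countable \<Rightarrow> 'c::countable discrete) \<Rightarrow> bool"
  assumes "finite J" "depends_on J E"
  shows "{z. E z} \<in> sets borel"
proof -
  have "countable (PiE J (\<lambda>_. UNIV :: 'c discrete set))"
    using assms(1) by (intro countable_PiE) auto
  then have "countable {v \<in> PiE J (\<lambda>_. UNIV). E v}" by (rule countable_subset[rotated]) blast
  then show ?thesis unfolding cylinder_partition[OF assms(2)]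
    using cylinder_sets[OF assms(1)] by (intro sets.countable_UN'') auto
qed

text \<open>Outside the finitely many cylinders with values in \<open>K\<close> there is no mass, so
  up to a null set the event is a finite disjoint union of cylinders.\<close>

lemma finite_cylinder_sum:
  fixes N :: "('i::countable \<Rightarrow> 'c::countable discrete) measure"
  assumes N: "finite_measure N" and sets: "\<And>v. {z. \<forall>i\<in>J. z i = v i} \<in> sets N"
    and "finite J" and E: "depends_on J E" and fin: "\<And>i. finite (K i)"
    and null: "measure N (UNIV - {z. \<forall>i\<in>J. z i \<in> K i}) = 0" and sp: "space N = UNIV"
  shows "measure N {z. E z} = (\<Sum>v | v \<in> PiE J K \<and> E v. measure N {z. \<forall>i\<in>J. z i = v i})"
proof -
  interpret finite_measure N by fact
  let ?V = "{v \<in> PiE J K. E v}"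
  have finV: "finite ?V" using fin \<open>finite J\<close> by (simp add: finite_PiE)
  have K: "{z. \<forall>i\<in>J. z i \<in> K i} = (\<Union>v\<in>PiE J K. {z. \<forall>i\<in>J. z i = v i})"
  proof (rule equalityI; rule subsetI)
    fix z assume "z \<in> {z. \<forall>i\<in>J. z i \<in> K i}"
    then show "z \<in> (\<Union>v\<in>PiE J K. {z. \<forall>i\<in>J. z i = v i})"
      by (intro UN_I[of "restrict z J"]) auto
  qed (auto simp: PiE_def Pi_def)
  have Ks: "{z. \<forall>i\<in>J. z i \<in> K i} \<in> sets N"
    unfolding K using fin \<open>finite J\<close> sets by (intro sets.finite_UN finite_PiE) auto
  have Es: "{z. E z} \<in> sets N" unfolding cylinder_partition[OF E]
    using sets countable_PiE[OF \<open>finite J\<close>, of "\<lambda>_. UNIV :: 'c discrete set"]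
    by (intro sets.countable_UN'') (auto intro: countable_subset)
  have eq: "{z. E z} \<inter> {z. \<forall>i\<in>J. z i \<in> K i} = (\<Union>v\<in>?V. {z. \<forall>i\<in>J. z i = v i})"
  proof (rule equalityI; rule subsetI)
    fix z assume z: "z \<in> {z. E z} \<inter> {z. \<forall>i\<in>J. z i \<in> K i}"
    then have "E (restrict z J)" using depends_onD[OF E, of z "restrict z J"] by simp
    then show "z \<in> (\<Union>v\<in>?V. {z. \<forall>i\<in>J. z i = v i})"
      using z by (intro UN_I[of "restrict z J"]) auto
  next
    fix z assume "z \<in> (\<Union>v\<in>?V. {z. \<forall>i\<in>J. z i = v i})"
    then obtain v where v: "v \<in> PiE J K" "E v" "\<forall>i\<in>J. z i = v i" by blast
    then show "z \<in> {z. E z} \<inter> {z. \<forall>i\<in>J. z i \<in> K i}"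
      using depends_onD[OF E, of z v] by (auto simp: PiE_def Pi_def)
  qed
  have "measure N {z. E z} \<le> measure N (({z. E z} \<inter> {z. \<forall>i\<in>J. z i \<in> K i}) \<union> (UNIV - {z. \<forall>i\<in>J. z i \<in> K i}))"
    using Es Ks sets.compl_sets[OF Ks] sp by (intro finite_measure_mono) auto
  also have "\<dots> \<le> measure N ({z. E z} \<inter> {z. \<forall>i\<in>J. z i \<in> K i}) + measure N (UNIV - {z. \<forall>i\<in>J. z i \<in> K i})"
    using Es Ks sets.compl_sets[OF Ks] sp by (intro measure_Un_le) auto
  finally have "measure N {z. E z} \<le> measure N ({z. E z} \<inter> {z. \<forall>i\<in>J. z i \<in> K i})" using null by simp
  moreover have "measure N ({z. E z} \<inter> {z. \<forall>i\<in>J. z i \<in> K i}) \<le> measure N {z. E z}"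
    using Es by (intro finite_measure_mono) auto
  ultimately have "measure N {z. E z} = measure N (\<Union>v\<in>?V. {z. \<forall>i\<in>J. z i = v i})" unfolding eq by simp
  also have "\<dots> = (\<Sum>v\<in>?V. measure N {z. \<forall>i\<in>J. z i = v i})"
  proof (rule finite_measure_finite_Union[OF finV])
    show "(\<lambda>v. {z. \<forall>i\<in>J. z i = v i}) ` ?V \<subseteq> sets N" using sets by blast
    show "disjoint_family_on (\<lambda>v. {z. \<forall>i\<in>J. z i = v i}) ?V"
      unfolding disjoint_family_on_def
    proof (intro ballI impI)
      fix v w assume vw: "v \<in> ?V" "w \<in> ?V" "v \<noteq> w"
      then obtain i where "v i \<noteq> w i" by (auto simp: fun_eq_iff)
      then have "i \<in> J" using vw by (auto simp: PiE_def extensional_def)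
      then show "{z. \<forall>i\<in>J. z i = v i} \<inter> {z. \<forall>i\<in>J. z i = w i} = {}" using \<open>v i \<noteq> w i\<close> by force
    qed
  qed
  finally show ?thesis by simp
qed

text \<open>Probabilities of finite-dimensional events are finite sums over cylinders, at each stage
  and, once the limit is known to give full mass to the values in \<open>K\<close>, in the limit as
  well.\<close>

theorem pmf_sequence_limit:
  fixes q :: "nat \<Rightarrow> ('i::countable \<Rightarrow> 'c::countable discrete) pmf"
  assumes K: "\<And>i. finite (K i)" and q: "\<And>n z i. z \<in> set_pmf (q n) \<Longrightarrow> z i \<in> K i"
  shows "\<exists>\<sigma> M. strict_mono (\<sigma> :: nat \<Rightarrow> nat) \<and> prob_space M \<and> sets M = sets borel \<and>
    (\<forall>J E. finite J \<longrightarrow> depends_on J E \<longrightarrow> (\<lambda>n. measure_pmf.prob (q (\<sigma> n)) {z. E z}) \<longlonglongrightarrow> measure M {z. E z})"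
proof -
  obtain \<sigma> M where \<sigma>: "strict_mono (\<sigma> :: nat \<Rightarrow> nat)" and M: "prob_space M" "sets M = sets borel"
    and lim: "\<And>J v. finite J \<Longrightarrow> (\<lambda>n. measure_pmf.prob (q (\<sigma> n)) {z. \<forall>i\<in>J. z i = v i})
        \<longlonglongrightarrow> measure M {z. \<forall>i\<in>J. z i = v i}"
  proof -
    have "\<exists>\<sigma> M. strict_mono (\<sigma> :: nat \<Rightarrow> nat) \<and> prob_space M \<and> sets M = sets borel \<and>
      (\<forall>J v. finite J \<longrightarrow> (\<lambda>n. measure_pmf.prob (q (\<sigma> n)) {z. \<forall>i\<in>J. z i = v i})
        \<longlonglongrightarrow> measure M {z. \<forall>i\<in>J. z i = v i})"
      by (rule pmf_sequence_cylinder_limit[where K = K]) (use K q in auto)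
    then show thesis using that by blast
  qed
  interpret prob_space M by (rule M)
  have sp: "space M = UNIV" using sets_eq_imp_space_eq[OF M(2)] by simp
  have q_sum: "measure_pmf.prob (q n) {z. E z} = (\<Sum>v | v \<in> PiE J K \<and> E v. measure_pmf.prob (q n) {z. \<forall>i\<in>J. z i = v i})"
    if "finite J" "depends_on J E" for J E n
  proof (rule finite_cylinder_sum[OF measure_pmf.finite_measure_axioms _ that K])
    have "UNIV - {z. \<forall>i\<in>J. z i \<in> K i} \<inter> set_pmf (q n) = UNIV - {z. \<forall>i\<in>J. z i \<in> K i} \<inter> set_pmf (q n)" ..
    have "measure_pmf.prob (q n) (UNIV - {z. \<forall>i\<in>J. z i \<in> K i}) = measure_pmf.prob (q n) {}"
      by (rule measure_pmf.finite_measure_eq_AE) (use q in \<open>auto simp: AE_measure_pmf_iff\<close>)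
    then show "measure_pmf.prob (q n) (UNIV - {z. \<forall>i\<in>J. z i \<in> K i}) = 0" by simp
  qed simp_all
  have cyl: "{z. \<forall>i\<in>J. z i = v i} \<in> sets M" if "finite J" for J v
    using cylinder_sets[OF that] M(2) by simp
  \<comment> \<open>At each stage finitely many cylinders carry the whole mass, so they do in the
    limit.\<close>
  have null: "measure M (UNIV - {z. \<forall>i\<in>J. z i \<in> K i}) = 0" if J: "finite J" for J
  proof -
    have fin: "finite (PiE J K)" using J K by (intro finite_PiE) auto
    have dep: "depends_on J (\<lambda>z. \<forall>i\<in>J. z i \<in> K i)" by (auto simp: depends_on_def)
    have in_K: "(\<forall>i\<in>J. v i \<in> K i) \<longleftrightarrow> True" if "v \<in> PiE J K" for v using that by auto
    have "measure_pmf.prob (q n) {z. \<forall>i\<in>J. z i \<in> K i} = 1" for n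
      by (subst measure_pmf.prob_eq_1) (use q in \<open>auto simp: AE_measure_pmf_iff\<close>)
    then have "(\<Sum>v\<in>PiE J K. measure_pmf.prob (q n) {z. \<forall>i\<in>J. z i = v i}) = 1" for n
      using q_sum[OF J dep, of n] in_K by (simp cong: conj_cong)
    moreover have "(\<lambda>n. \<Sum>v\<in>PiE J K. measure_pmf.prob (q (\<sigma> n)) {z. \<forall>i\<in>J. z i = v i})
        \<longlonglongrightarrow> (\<Sum>v\<in>PiE J K. measure M {z. \<forall>i\<in>J. z i = v i})"
      by (intro tendsto_sum lim J)
    ultimately have s1: "(\<Sum>v\<in>PiE J K. measure M {z. \<forall>i\<in>J. z i = v i}) = 1"
      using LIMSEQ_unique[OF tendsto_const] by fastforce
    have "(\<Sum>v\<in>PiE J K. measure M {z. \<forall>i\<in>J. z i = v i}) = measure M (\<Union>v\<in>PiE J K. {z. \<forall>i\<in>J. z i = v i})"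
    proof (rule finite_measure_finite_Union[OF fin, symmetric])
      show "(\<lambda>v. {z. \<forall>i\<in>J. z i = v i}) ` PiE J K \<subseteq> sets M" using cyl[OF J] by blast
      show "disjoint_family_on (\<lambda>v. {z. \<forall>i\<in>J. z i = v i}) (PiE J K)"
        unfolding disjoint_family_on_def
      proof (intro ballI impI)
        fix v w assume vw: "v \<in> PiE J K" "w \<in> PiE J K" "v \<noteq> w"
        then obtain i where "v i \<noteq> w i" by (auto simp: fun_eq_iff)
        then have "i \<in> J" using vw by (auto simp: PiE_def extensional_def)
        then show "{z. \<forall>i\<in>J. z i = v i} \<inter> {z. \<forall>i\<in>J. z i = w i} = {}" using \<open>v i \<noteq> w i\<close> by force
      qed
    qed
    also have "\<dots> \<le> measure M {z. \<forall>i\<in>J. z i \<in> K i}"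
      using depends_on_sets[OF J dep] M(2) by (intro finite_measure_mono) (auto simp: PiE_def Pi_def)
    finally have "1 \<le> measure M {z. \<forall>i\<in>J. z i \<in> K i}" using s1 by simp
    then have "measure M {z. \<forall>i\<in>J. z i \<in> K i} = 1"
      using prob_le_1[of "{z. \<forall>i\<in>J. z i \<in> K i}"] by linarith
    then show ?thesis using prob_compl[of "{z. \<forall>i\<in>J. z i \<in> K i}"] depends_on_sets[OF J dep] M(2) sp by simp
  qed
  have "(\<lambda>n. measure_pmf.prob (q (\<sigma> n)) {z. E z}) \<longlonglongrightarrow> measure M {z. E z}" if J: "finite J" "depends_on J E" for J E
  proof -
    have "measure M {z. E z} = (\<Sum>v | v \<in> PiE J K \<and> E v. measure M {z. \<forall>i\<in>J. z i = v i})"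
      by (rule finite_cylinder_sum[OF finite_measure_axioms cyl[OF J(1)] J K null[OF J(1)] sp])
    moreover have "(\<lambda>n. \<Sum>v | v \<in> PiE J K \<and> E v. measure_pmf.prob (q (\<sigma> n)) {z. \<forall>i\<in>J. z i = v i})
        \<longlonglongrightarrow> (\<Sum>v | v \<in> PiE J K \<and> E v. measure M {z. \<forall>i\<in>J. z i = v i})"
      by (intro tendsto_sum lim J)
    ultimately show ?thesis by (simp only: q_sum[OF J])
  qed
  then show ?thesis using \<sigma> M by blast
qed

text \<open>The sets approximated by finite-dimensional ones form a \<open>\<sigma>\<close>-algebra containing the cylinders.\<close>

lemma finite_dimensional_approximation:
  fixes M :: "('i::countable \<Rightarrow> 'c::countable discrete) measure"
  assumes "finite_measure M" and M: "sets M = sets borel" and A: "A \<in> sets M" and "0 < \<epsilon>"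
  shows "\<exists>J E. finite J \<and> depends_on J E \<and> measure M (sym_diff A {z. E z}) < \<epsilon>"
proof -
  interpret finite_measure M by fact
  have sp: "space M = UNIV" using sets_eq_imp_space_eq[OF M] by simp
  have Es: "{z. E z} \<in> sets M" if "finite J" "depends_on J E" for J and E :: "('i \<Rightarrow> 'c discrete) \<Rightarrow> bool"
    using depends_on_sets[OF that] M by simp
  define \<A> where "\<A> = {A \<in> sets M. \<forall>\<epsilon>>0. \<exists>J E. finite J \<and> depends_on J E \<and> measure M (sym_diff A {z. E z}) < \<epsilon>}"
  have "sigma_algebra UNIV \<A>"
  proof (rule sigma_algebra_iff2[THEN iffD2], intro conjI ballI allI impI)
    show "\<A> \<subseteq> Pow UNIV" by simp
    have "depends_on {} (\<lambda>z :: 'i \<Rightarrow> 'c discrete. False)" by (simp add: depends_on_def)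
    then show "{} \<in> \<A>" unfolding \<A>_def by (auto intro!: exI[of _ "{}"] exI[of _ "\<lambda>_. False"])
  next
    fix A assume A: "A \<in> \<A>"
    have "\<exists>J E. finite J \<and> depends_on J E \<and> measure M (sym_diff (UNIV - A) {z. E z}) < \<epsilon>" if "0 < \<epsilon>" for \<epsilon>
    proof -
      obtain J E where JE: "finite J" "depends_on J E" "measure M (sym_diff A {z. E z}) < \<epsilon>"
        using A \<open>0 < \<epsilon>\<close> unfolding \<A>_def by blast
      have "depends_on J (\<lambda>z. \<not> E z)" using JE(2) unfolding depends_on_def by metis
      moreover have "sym_diff (UNIV - A) {z. \<not> E z} = sym_diff A {z. E z}" by auto
      ultimately show ?thesis using JE by (intro exI[of _ J] exI[of _ "\<lambda>z. \<not> E z"]) simp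
    qed
    moreover have "UNIV - A \<in> sets M" using sets.compl_sets[of A M] A sp unfolding \<A>_def by simp
    ultimately show "UNIV - A \<in> \<A>" unfolding \<A>_def by blast
  next
    fix A :: "nat \<Rightarrow> ('i \<Rightarrow> 'c discrete) set" assume r: "range A \<subseteq> \<A>"
    have As: "A n \<in> sets M" for n using r unfolding \<A>_def by blast
    have U: "(\<Union>n. A n) \<in> sets M" using As by blast
    have "\<exists>J E. finite J \<and> depends_on J E \<and> measure M (sym_diff (\<Union>n. A n) {z. E z}) < \<epsilon>" if \<epsilon>: "0 < \<epsilon>" for \<epsilon>
    proof -
      define B where "B n = (\<Union>m<n. A m)" for n :: nat
      have Bs: "B n \<in> sets M" for n unfolding B_def using As by auto
      have "(\<lambda>n. measure M (B n)) \<longlonglongrightarrow> measure M (\<Union>n. B n)"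
        using Bs by (intro finite_Lim_measure_incseq) (auto simp: B_def incseq_def intro: order_less_le_trans)
      moreover have UB: "(\<Union>n. B n) = (\<Union>n. A n)" unfolding B_def by (auto intro: lessI)
      ultimately have "\<forall>\<^sub>F n in sequentially. measure M (\<Union>n. A n) - \<epsilon> / 2 < measure M (B n)"
        using \<epsilon> by (intro order_tendstoD(1)) auto
      then obtain N where N: "measure M (\<Union>n. A n) - \<epsilon> / 2 < measure M (B N)"
        using eventually_happens'[OF sequentially_bot] by blast
      \<comment> \<open>Half of \<open>\<epsilon>\<close> goes to cutting off the union, the other
        half is shared by the \<open>N\<close> remaining sets; \<open>Suc N\<close> covers the case
        \<open>N = 0\<close>.\<close>
      have \<epsilon>': "0 < \<epsilon> / (2 * real (Suc N))" using \<epsilon> by (intro divide_pos_pos) auto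
      have "\<forall>n. \<exists>J E. finite J \<and> depends_on J E \<and> measure M (sym_diff (A n) {z. E z}) < \<epsilon> / (2 * real (Suc N))"
        using r \<epsilon>' unfolding \<A>_def by blast
      then obtain J E where JE: "\<And>n. finite (J n)" "\<And>n. depends_on (J n) (E n)"
          "\<And>n. measure M (sym_diff (A n) {z. E n z}) < \<epsilon> / (2 * real (Suc N))"
        by metis
      let ?J = "\<Union>n<N. J n" and ?E = "\<lambda>z. \<exists>n<N. E n z"
      have fJ: "finite ?J" using JE(1) by blast
      have dE: "depends_on ?J ?E"
        unfolding depends_on_def
      proof (intro allI impI)
        fix z z' :: "'i \<Rightarrow> 'c discrete" assume "\<forall>i\<in>?J. z i = z' i"
        then have "E n z = E n z'" if "n < N" for n using JE(2)[of n] that unfolding depends_on_def by blast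
        then show "?E z = ?E z'" by blast
      qed
      have ss: "sym_diff (A n) {z. E n z} \<in> sets M" for n using As Es[OF JE(1,2)] by blast
      have Us: "(\<Union>n<N. sym_diff (A n) {z. E n z}) \<in> sets M" by (rule sets.finite_UN) (use ss in auto)
      have Ds: "(\<Union>n. A n) - B N \<in> sets M" using U Bs by blast
      have "sym_diff (\<Union>n. A n) {z. ?E z} \<subseteq> ((\<Union>n. A n) - B N) \<union> (\<Union>n<N. sym_diff (A n) {z. E n z})"
        unfolding B_def by blast
      then have "measure M (sym_diff (\<Union>n. A n) {z. ?E z}) \<le> measure M (((\<Union>n. A n) - B N) \<union> (\<Union>n<N. sym_diff (A n) {z. E n z}))"
        by (rule finite_measure_mono[OF _ sets.Un[OF Ds Us]])
      also have "\<dots> \<le> measure M ((\<Union>n. A n) - B N) + measure M (\<Union>n<N. sym_diff (A n) {z. E n z})"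
        by (rule measure_Un_le[OF Ds Us])
      also have "measure M ((\<Union>n. A n) - B N) < \<epsilon> / 2"
        using finite_measure_Diff[OF U Bs, of N] N unfolding B_def by (simp add: UN_subset_iff UN_upper)
      also have "measure M (\<Union>n<N. sym_diff (A n) {z. E n z}) \<le> (\<Sum>n<N. measure M (sym_diff (A n) {z. E n z}))"
        using ss by (intro finite_measure_subadditive_finite) auto
      also have "\<dots> \<le> (\<Sum>n<N. \<epsilon> / (2 * real (Suc N)))" using JE(3) by (intro sum_mono less_imp_le)
      also have "\<dots> \<le> \<epsilon> / 2"
      proof -
        have "real N * (\<epsilon> / (2 * real (Suc N))) \<le> real (Suc N) * (\<epsilon> / (2 * real (Suc N)))"
          using \<epsilon>' by (intro mult_right_mono) auto
        also have "\<dots> = \<epsilon> / 2" by (simp del: of_nat_Suc)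
        finally show ?thesis by simp
      qed
      finally have "measure M (sym_diff (\<Union>n. A n) {z. ?E z}) < \<epsilon>" by simp
      then show ?thesis using fJ dE by blast
    qed
    then show "(\<Union>n. A n) \<in> \<A>" unfolding \<A>_def using U by blast
  qed
  then interpret S: sigma_algebra UNIV \<A> .
  have "{{f \<in> UNIV. f i \<in> A} |i A. i \<in> UNIV \<and> A \<in> sets (borel :: 'c discrete measure)} \<subseteq> \<A>"
  proof
    fix X assume "X \<in> {{f :: 'i \<Rightarrow> 'c discrete \<in> UNIV. f i \<in> A} |i A. i \<in> UNIV \<and> A \<in> sets (borel :: 'c discrete measure)}"
    then obtain i B where X: "X = {z. z i \<in> B}" by auto
    have dep: "depends_on {i} (\<lambda>z. z i \<in> B)" by (simp add: depends_on_def)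
    have "\<exists>J E. finite J \<and> depends_on J E \<and> measure M (sym_diff X {z. E z}) < \<epsilon>" if "0 < \<epsilon>" for \<epsilon>
      using dep that unfolding X by (intro exI[of _ "{i}"] exI[of _ "\<lambda>z. z i \<in> B"]) simp
    then show "X \<in> \<A>" unfolding \<A>_def using Es[OF _ dep] X by auto
  qed
  from S.sigma_sets_subset[OF this]
  have "sets (PiM UNIV (\<lambda>_. borel) :: ('i \<Rightarrow> 'c discrete) measure) \<subseteq> \<A>"
    unfolding sets_PiM_single by (simp add: PiE_UNIV_domain)
  then have "A \<in> \<A>" using A M sets_PiM_equal_borel by blast
  then show ?thesis using \<open>0 < \<epsilon>\<close> unfolding \<A>_def by blast
qed

lemma group_actionI:
  assumes "group G"
    and maps: "\<And>g x. g \<in> carrier G \<Longrightarrow> x \<in> E \<Longrightarrow> f g x \<in> E"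
    and ext: "\<And>g. g \<in> carrier G \<Longrightarrow> f g \<in> extensional E"
    and one: "\<And>x. x \<in> E \<Longrightarrow> f \<one>\<^bsub>G\<^esub> x = x"
    and mult: "\<And>g h x. g \<in> carrier G \<Longrightarrow> h \<in> carrier G \<Longrightarrow> x \<in> E \<Longrightarrow> f (g \<otimes>\<^bsub>G\<^esub> h) x = f g (f h x)"
  shows "group_action G E f"
proof -
  interpret group G by fact
  have inv: "f (inv\<^bsub>G\<^esub> g) (f g x) = x" "f g (f (inv\<^bsub>G\<^esub> g) x) = x" if "g \<in> carrier G" "x \<in> E" for g x
    using mult[of "inv\<^bsub>G\<^esub> g" g x] mult[of g "inv\<^bsub>G\<^esub> g" x] one that by simp_all
  have bij: "f g \<in> Bij E" if g: "g \<in> carrier G" for g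
    unfolding Bij_def
  proof (intro IntI CollectI bij_betw_byWitness[where f' = "f (inv\<^bsub>G\<^esub> g)"])
    show "f g \<in> extensional E" by (rule ext[OF g])
  qed (use inv g maps in auto)
  have "f \<in> hom G (BijGroup E)"
  proof (rule homI)
    fix g assume "g \<in> carrier G"
    then show "f g \<in> carrier (BijGroup E)" using bij by (simp add: BijGroup_def)
  next
    fix g h assume gh: "g \<in> carrier G" "h \<in> carrier G"
    have "f (g \<otimes>\<^bsub>G\<^esub> h) = compose E (f g) (f h)"
    proof
      fix x
      show "f (g \<otimes>\<^bsub>G\<^esub> h) x = compose E (f g) (f h) x"
        using mult[OF gh] ext[of "g \<otimes>\<^bsub>G\<^esub> h"] gh by (cases "x \<in> E") (auto simp: compose_def extensional_def)
    qed
    then show "f (g \<otimes>\<^bsub>G\<^esub> h) = f g \<otimes>\<^bsub>BijGroup E\<^esub> f h" using bij gh by (simp add: BijGroup_def)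
  qed
  then show ?thesis
    by (intro group_action.intro group_hom.intro group_hom_axioms.intro group_BijGroup is_group)
qed

section \<open>Profiles of points and their limit distribution\<close>

type_synonym profile = "nat \<times> nat \<Rightarrow> nat discrete"

text \<open>\<open>Ms n\<close> is the \<open>n\<close>-th finite system with uniform measure on \<open>X n\<close>, and \<open>c i n\<close> is a
  countable family of colourings of it. Coordinate \<open>(i, l)\<close> of the profile of a point \<open>x\<close> is the
  \<open>i\<close>-th colour of the image of \<open>x\<close> under the \<open>l\<close>-th group element. Since the
  colourings separate \<open>x\<close> from \<open>g x\<close> whenever these differ, stabilizers are visible in the profile.\<close>

locale coloured_sequence = symmetric_generators G S
  for G :: "('a, 'm) monoid_scheme" (structure) and S +
  fixes X :: "nat \<Rightarrow> 'x set" and fs :: "nat \<Rightarrow> 'a \<Rightarrow> 'x \<Rightarrow> 'x"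
    and c :: "nat \<Rightarrow> nat \<Rightarrow> 'x \<Rightarrow> nat" and K :: "nat \<Rightarrow> nat" and sep :: "'a \<Rightarrow> nat"
  assumes X_fin: "\<And>n. finite (X n)"
    and sys: "\<And>n. pmp_system G (uniform_count_measure (X n)) (fs n)"
    and c_bound: "\<And>i n x. x \<in> X n \<Longrightarrow> c i n x \<le> K i"
    and c_sep: "\<And>g n x. g \<in> carrier G \<Longrightarrow> x \<in> X n \<Longrightarrow> fs n g x \<noteq> x \<Longrightarrow> c (sep g) n (fs n g x) \<noteq> c (sep g) n x"
begin

abbreviation "Ms n \<equiv> uniform_count_measure (X n)"

lemma space_Ms [simp]: "space (Ms n) = X n" by (simp add: space_uniform_count_measure)

lemma sets_Ms [simp]: "sets (Ms n) = Pow (X n)" by (simp add: sets_uniform_count_measure)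

lemma X_ne: "X n \<noteq> {}"
  using prob_space.not_empty[of "Ms n"] sys[of n] by (simp add: pmp_system_def pmp_action_def)

lemma carrier_countable: "countable (carrier G)"
proof -
  have "carrier G = (\<Union>r. word_ball G S r)" using word_ball_exhausts word_ball_carrier by blast
  moreover have "countable (\<Union>r. word_ball G S r)"
    using finite_word_ball[OF S_fin] by (intro countable_UN) (auto intro: countable_finite)
  ultimately show ?thesis by simp
qed

definition idx :: "'a \<Rightarrow> nat" where "idx = to_nat_on (carrier G)"

definition elt :: "nat \<Rightarrow> 'a" where "elt = from_nat_into (carrier G)"

text \<open>A proper subset of the natural numbers if the group is finite.\<close>

definition dom :: "nat set" where "dom = idx ` carrier G"

lemma elt_idx: "g \<in> carrier G \<Longrightarrow> elt (idx g) = g"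
  by (simp add: elt_def idx_def carrier_countable)

lemma elt_carrier: "elt l \<in> carrier G"
  unfolding elt_def using one_closed by (intro from_nat_into) blast

lemma idx_elt: "l \<in> dom \<Longrightarrow> idx (elt l) = l"
  by (auto simp: dom_def elt_idx)

lemma idx_dom: "g \<in> carrier G \<Longrightarrow> idx g \<in> dom" by (simp add: dom_def)

text \<open>The index is multiplied on the right, so that precomposition in \<open>act\<close> is a
  left action and \<open>prof\<close> is equivariant. Indices that code no group element stay
  put.\<close>

fun shift :: "'a \<Rightarrow> nat \<times> nat \<Rightarrow> nat \<times> nat" where
  "shift h (i, l) = (if l \<in> dom then (i, idx (elt l \<otimes> h)) else (i, l))"

lemma shift_shift:
  assumes "g \<in> carrier G" "h \<in> carrier G"
  shows "shift h (shift g p) = shift (g \<otimes> h) p"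
proof (cases p)
  case (Pair i l)
  have "elt l \<otimes> g \<in> carrier G" using assms elt_carrier by simp
  then show ?thesis unfolding Pair using assms elt_carrier
    by (simp add: elt_idx idx_dom m_assoc)
qed

lemma shift_one: "shift \<one> p = p"
  by (cases p) (simp add: elt_carrier idx_elt)

definition act :: "'a \<Rightarrow> profile \<Rightarrow> profile" where
  "act h z = (\<lambda>p. z (shift h p))"

lemma act_mult: "g \<in> carrier G \<Longrightarrow> h \<in> carrier G \<Longrightarrow> act (g \<otimes> h) z = act g (act h z)"
  by (simp add: act_def shift_shift)

lemma act_one: "act \<one> z = z"
  by (simp add: act_def shift_one)

lemma act_group_action: "group_action G UNIV act"
  by (rule group_actionI) (auto simp: act_mult act_one is_group)

definition prof :: "nat \<Rightarrow> 'x \<Rightarrow> profile" where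
  "prof n x = (\<lambda>(i, l). discrete (if l \<in> dom then c i n (fs n (elt l) x) else 0))"

lemma prof_coord: "g \<in> carrier G \<Longrightarrow> prof n x (i, idx g) = discrete (c i n (fs n g x))"
  by (simp add: prof_def elt_idx idx_dom)

lemma prof_act:
  assumes "h \<in> carrier G" "x \<in> X n"
  shows "prof n (fs n h x) = act h (prof n x)"
proof
  interpret pmp_system G "Ms n" "fs n" by (rule sys)
  fix p :: "nat \<times> nat"
  obtain i l where p: "p = (i, l)" by (cases p)
  show "prof n (fs n h x) p = act h (prof n x) p"
  proof (cases "l \<in> dom")
    case True
    then show ?thesis unfolding p act_def using assms elt_carrier[of l] f_mult[of "elt l" h x]
      by (simp add: prof_coord) (simp add: prof_def)
  qed (simp add: p act_def prof_def)
qed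

lemma prof_bound: "x \<in> X n \<Longrightarrow> prof n x p \<in> discrete ` {..K (fst p)}"
proof -
  interpret pmp_system G "Ms n" "fs n" by (rule sys)
  assume x: "x \<in> X n"
  obtain i l where p: "p = (i, l)" by (cases p)
  have "fs n (elt l) x \<in> X n" using f_space[OF elt_carrier, of x l] x by simp
  then show ?thesis unfolding p prof_def using c_bound by auto
qed

lemma prof_fixed:
  assumes "g \<in> carrier G" "x \<in> X n"
  shows "fs n g x = x \<longleftrightarrow> prof n x (sep g, idx \<one>) = prof n x (sep g, idx g)"
proof -
  interpret pmp_system G "Ms n" "fs n" by (rule sys)
  have "fs n \<one> x = x" using f_one[of x] assms by simp
  then have "prof n x (sep g, idx \<one>) = prof n x (sep g, idx g) \<longleftrightarrow> c (sep g) n x = c (sep g) n (fs n g x)"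
    using assms by (simp add: prof_coord discrete_inject)
  then show ?thesis using c_sep[OF assms] by metis
qed

lemma Ms_measure: "measure (Ms n) {x \<in> X n. P (prof n x)} = measure_pmf.prob (map_pmf (prof n) (pmf_of_set (X n))) {z. P z}"
proof -
  have "measure_pmf.prob (map_pmf (prof n) (pmf_of_set (X n))) {z. P z} = measure_pmf.prob (pmf_of_set (X n)) (prof n -` {z. P z})"
    by simp
  also have "\<dots> = real (card (X n \<inter> prof n -` {z. P z})) / real (card (X n))"
    by (rule measure_pmf_of_set[OF X_ne X_fin])
  also have "X n \<inter> prof n -` {z. P z} = {x \<in> X n. P (prof n x)}" by auto
  finally show ?thesis using X_fin by (simp add: measure_uniform_count_measure)
qed

definition limit_measure :: "(nat \<Rightarrow> nat) \<Rightarrow> profile measure \<Rightarrow> bool" where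
  "limit_measure \<sigma> M \<longleftrightarrow> strict_mono \<sigma> \<and> prob_space M \<and> sets M = sets borel \<and>
    (\<forall>J E. finite J \<longrightarrow> depends_on J E \<longrightarrow>
      (\<lambda>n. measure (Ms (\<sigma> n)) {x \<in> X (\<sigma> n). E (prof (\<sigma> n) x)}) \<longlonglongrightarrow> measure M {z. E z})"

lemma limit_measure_exists: "\<exists>\<sigma> M. limit_measure \<sigma> M"
proof -
  have "\<exists>\<sigma> M. strict_mono (\<sigma> :: nat \<Rightarrow> nat) \<and> prob_space M \<and> sets M = sets borel \<and>
    (\<forall>J E. finite J \<longrightarrow> depends_on J E \<longrightarrow>
      (\<lambda>n. measure_pmf.prob (map_pmf (prof (\<sigma> n)) (pmf_of_set (X (\<sigma> n)))) {z. E z}) \<longlonglongrightarrow> measure M {z. E z})"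
  proof (rule pmf_sequence_limit[where K = "\<lambda>p. discrete ` {..K (fst p)}"])
    fix n z p assume "z \<in> set_pmf (map_pmf (prof n) (pmf_of_set (X n)))"
    then obtain x where "x \<in> X n" "z = prof n x" using X_fin[of n] X_ne[of n] by (auto simp: set_pmf_of_set)
    then show "z p \<in> discrete ` {..K (fst p)}" using prof_bound[of x n p] by simp
  qed simp
  then show ?thesis unfolding limit_measure_def Ms_measure .
qed

end

section \<open>The limit action on profiles\<close>

locale coloured_limit = coloured_sequence +
  fixes \<sigma> M
  assumes lim: "limit_measure \<sigma> M"
begin

lemma mono_\<sigma>: "strict_mono \<sigma>" using lim by (simp add: limit_measure_def)
lemma prob_M: "prob_space M" using lim by (simp add: limit_measure_def)
lemma sets_M: "sets M = sets borel" using lim by (simp add: limit_measure_def)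
lemma space_M: "space M = UNIV" using sets_eq_imp_space_eq[OF sets_M] by simp

lemma limit_M: "finite J \<Longrightarrow> depends_on J E \<Longrightarrow>
    (\<lambda>n. measure (Ms (\<sigma> n)) {x \<in> X (\<sigma> n). E (prof (\<sigma> n) x)}) \<longlonglongrightarrow> measure M {z. E z}"
  using lim unfolding limit_measure_def by blast

lemma depends_on_act: "h \<in> carrier G \<Longrightarrow> depends_on J E \<Longrightarrow> depends_on (shift h ` J) (\<lambda>z. E (act h z))"
  unfolding depends_on_def act_def by (metis imageI)

lemma depends_on_M: "finite J \<Longrightarrow> depends_on J E \<Longrightarrow> {z. E z} \<in> sets M"
  using depends_on_sets sets_M by blast

lemma act_measurable: "h \<in> carrier G \<Longrightarrow> act h \<in> measurable M M"
proof -
  have "act h \<in> measurable (PiM UNIV (\<lambda>_. borel)) (PiM UNIV (\<lambda>_. borel))"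
    unfolding act_def by (rule measurable_PiM_single') (auto simp: space_PiM)
  moreover have "sets M = sets (PiM UNIV (\<lambda>_. borel :: nat discrete measure))"
    unfolding sets_M by (rule sets_PiM_equal_borel[symmetric])
  ultimately show ?thesis using measurable_cong_sets by blast
qed

text \<open>Each finite system preserves its uniform measure and \<open>prof\<close> is equivariant,
  so the equality holds at every stage and passes to the limit.\<close>

lemma measure_act:
  assumes "h \<in> carrier G" "finite J" "depends_on J E"
  shows "measure M {z. E (act h z)} = measure M {z. E z}"
proof -
  have "measure (Ms n) {x \<in> X n. E (act h (prof n x))} = measure (Ms n) {x \<in> X n. E (prof n x)}" for n
  proof -
    interpret pmp_system G "Ms n" "fs n" by (rule sys)
    have "{x \<in> X n. E (act h (prof n x))} = fs n h -` {x \<in> X n. E (prof n x)} \<inter> space (Ms n)"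
      using f_space[OF assms(1)] by (auto simp: prof_act[OF assms(1)])
    then show ?thesis using measure_vimage[OF assms(1), of "{x \<in> X n. E (prof n x)}"] by simp
  qed
  then show ?thesis
    using LIMSEQ_unique[OF limit_M[OF assms(2,3)], of "measure M {z. E (act h z)}"]
      limit_M[OF _ depends_on_act[OF assms(1,3)]] assms(2) by simp
qed

text \<open>Both measures agree on finite-dimensional boxes, and these determine a finite
  measure.\<close>

lemma act_preserves: "h \<in> carrier G \<Longrightarrow> distr M M (act h) = M"
proof -
  interpret prob_space M by (rule prob_M)
  assume h: "h \<in> carrier G"
  have sP: "sets M = sets (PiM UNIV (\<lambda>_. borel :: nat discrete measure))"
    unfolding sets_M by (rule sets_PiM_equal_borel[symmetric])
  show ?thesis
  proof (rule measure_eqI_PiM_infinite[where I = UNIV and M = "\<lambda>_. borel"])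
    show "sets (distr M M (act h)) = sets (PiM UNIV (\<lambda>_. borel))" using sP by simp
    show "sets M = sets (PiM UNIV (\<lambda>_. borel))" by (rule sP)
    show "finite_measure (distr M M (act h))"
      using prob_space_distr[OF act_measurable[OF h]] by (simp add: prob_space_def)
    fix A :: "nat \<times> nat \<Rightarrow> nat discrete set" and J :: "(nat \<times> nat) set"
    assume J: "finite J"
    let ?E = "\<lambda>z. \<forall>p\<in>J. z p \<in> A p"
    have dep: "depends_on J ?E" by (simp add: depends_on_def)
    have emb: "prod_emb UNIV (\<lambda>_. borel) J (PiE J A) = {z. ?E z}"
      by (auto simp: prod_emb_def)
    have "emeasure (distr M M (act h)) {z. ?E z} = emeasure M (act h -` {z. ?E z} \<inter> space M)"
      by (rule emeasure_distr[OF act_measurable[OF h] depends_on_M[OF J dep]])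
    also have "act h -` {z. ?E z} \<inter> space M = {z. ?E (act h z)}" by (auto simp: space_M)
    also have "emeasure M {z. ?E (act h z)} = emeasure M {z. ?E z}"
      using measure_act[OF h J dep] by (simp add: emeasure_eq_measure)
    finally show "emeasure (distr M M (act h)) (prod_emb UNIV (\<lambda>_. borel) J (PiE J A)) = emeasure M (prod_emb UNIV (\<lambda>_. borel) J (PiE J A))"
      unfolding emb .
  qed
qed

lemma pmp_act: "pmp_action G M act"
  unfolding pmp_action_def using prob_M act_group_action act_measurable act_preserves by (simp add: space_M)

text \<open>Being fixed amounts to countably many equations between two coordinates.\<close>

lemma act_fixed_sets: "{z \<in> space M. act g z = z} \<in> sets M"
proof -
  have dep: "depends_on {p, shift g p} (\<lambda>z. z (shift g p) = z p)" for p by (simp add: depends_on_def)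
  have "{z \<in> space M. act g z = z} = (\<Inter>p. {z. z (shift g p) = z p})"
    unfolding act_def fun_eq_iff space_M by blast
  also have "\<dots> \<in> sets M" using depends_on_M[OF _ dep] by (intro sets.countable_INT') auto
  finally show ?thesis .
qed

lemma act_system: "symmetric_system G M act S"
  by (intro symmetric_system.intro fixed_point_measurable.intro pmp_system.intro pmp_act
      fixed_point_measurable_axioms.intro act_fixed_sets symmetric_generators_axioms)

lemma Ms_system: "symmetric_system G (Ms n) (fs n) S"
  by (intro symmetric_system.intro fixed_point_measurable.intro sys
      fixed_point_measurable_axioms.intro symmetric_generators_axioms) auto

text \<open>That a profile is fixed involves infinitely many coordinates, while the limit is
  controlled on finitely many. In the finite systems agreement at the separating coordinate already
  forces \<open>g\<close> to fix the point. So the event that this coordinate agrees but another one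
  moves is empty at every stage and null in the limit, and there are countably many such
  events.\<close>

lemma act_fixed_AE:
  assumes g: "g \<in> carrier G"
  shows "AE z in M. act g z = z \<longleftrightarrow> z (sep g, idx \<one>) = z (sep g, idx g)"
proof -
  interpret prob_space M by (rule prob_M)
  have "AE z in M. \<forall>p. z (sep g, idx \<one>) = z (sep g, idx g) \<longrightarrow> z (shift g p) = z p"
  proof (subst AE_all_countable, rule allI)
    fix p
    let ?E = "\<lambda>z. z (sep g, idx \<one>) = z (sep g, idx g) \<and> z (shift g p) \<noteq> z p"
    let ?J = "{(sep g, idx \<one>), (sep g, idx g), p, shift g p}"
    have dep: "depends_on ?J ?E" by (simp add: depends_on_def)
    have emp: "{x \<in> X n. ?E (prof n x)} = {}" for n
    proof -
      have "prof n x (shift g p) = prof n x p"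
        if "x \<in> X n" "prof n x (sep g, idx \<one>) = prof n x (sep g, idx g)" for x
      proof -
        have "fs n g x = x" using prof_fixed[OF g that(1)] that(2) by simp
        then have "act g (prof n x) = prof n x" using prof_act[OF g that(1)] by simp
        then show ?thesis unfolding act_def by metis
      qed
      then show ?thesis by blast
    qed
    have "(\<lambda>n. measure (Ms (\<sigma> n)) {x \<in> X (\<sigma> n). ?E (prof (\<sigma> n) x)}) \<longlonglongrightarrow> measure M {z. ?E z}"
      by (rule limit_M[OF _ dep]) simp
    then have "(\<lambda>n. 0 :: real) \<longlonglongrightarrow> measure M {z. ?E z}" unfolding emp measure_empty .
    from LIMSEQ_unique[OF tendsto_const this] have "measure M {z. ?E z} = 0" by (rule HOL.sym)
    then have "{z. ?E z} \<in> null_sets M" using depends_on_M[OF _ dep] by (auto simp: emeasure_eq_measure)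
    then show "AE z in M. z (sep g, idx \<one>) = z (sep g, idx g) \<longrightarrow> z (shift g p) = z p"
      by (rule AE_I') auto
  qed
  then show ?thesis
  proof eventually_elim
    case (elim z)
    show ?case
    proof
      assume "act g z = z"
      then have "z (shift g (sep g, idx \<one>)) = z (sep g, idx \<one>)" unfolding act_def by metis
      then show "z (sep g, idx \<one>) = z (sep g, idx g)" using g by (simp add: idx_dom elt_idx)
    qed (use elim in \<open>auto simp: act_def fun_eq_iff\<close>)
  qed
qed

text \<open>The variant of \<open>pattern\<close> that reads stabilizers from the separating
  coordinates. For finite \<open>U\<close> and finite-dimensional \<open>\<psi>\<close> it is
  finite-dimensional; it equals \<open>pattern\<close> on the finite systems and agrees with it
  almost everywhere in the limit.\<close>

definition profile_pattern :: "'a set \<Rightarrow> (profile \<Rightarrow> nat) \<Rightarrow> profile \<Rightarrow> 'a set \<times> ('a \<Rightarrow> nat)" where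
  "profile_pattern U \<psi> z = ({g \<in> U. z (sep g, idx \<one>) = z (sep g, idx g)}, restrict (\<lambda>g. \<psi> (act g z)) U)"

lemma profile_pattern_depends:
  assumes "U \<subseteq> carrier G" "depends_on J \<psi>"
  shows "depends_on ((\<Union>g\<in>U. shift g ` J) \<union> (\<Union>g\<in>U. {(sep g, idx \<one>), (sep g, idx g)})) (profile_pattern U \<psi>)"
  unfolding depends_on_def
proof (intro allI impI)
  fix z z' :: profile
  assume eq: "\<forall>i\<in>(\<Union>g\<in>U. shift g ` J) \<union> (\<Union>g\<in>U. {(sep g, idx \<one>), (sep g, idx g)}). z i = z' i"
  have "\<psi> (act g z) = \<psi> (act g z')" if "g \<in> U" for g
    using eq that by (intro depends_onD[OF assms(2)]) (auto simp: act_def)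
  moreover have "z (sep g, idx \<one>) = z' (sep g, idx \<one>)" "z (sep g, idx g) = z' (sep g, idx g)" if "g \<in> U" for g
    by (rule eq[rule_format], use that in blast)+
  ultimately show "profile_pattern U \<psi> z = profile_pattern U \<psi> z'"
    unfolding profile_pattern_def by (auto intro!: restrict_ext)
qed

lemma profile_pattern_prof:
  assumes "U \<subseteq> carrier G" "x \<in> X n"
  shows "pattern U (fs n) (\<lambda>x. \<psi> (prof n x)) x = profile_pattern U \<psi> (prof n x)"
  unfolding pattern_def profile_pattern_def
  using assms prof_fixed prof_act by (auto intro!: restrict_ext simp: subset_iff)

lemma profile_pattern_AE:
  assumes "U \<subseteq> carrier G" "finite U"
  shows "AE z in M. pattern U act \<psi> z = profile_pattern U \<psi> z"
proof -
  have "AE z in M. \<forall>g\<in>U. act g z = z \<longleftrightarrow> z (sep g, idx \<one>) = z (sep g, idx g)"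
    using act_fixed_AE assms by (intro AE_finite_allI) auto
  then show ?thesis
    by eventually_elim (auto simp: pattern_def profile_pattern_def)
qed

lemma depends_on_measurable:
  fixes k :: nat and \<psi> :: "profile \<Rightarrow> nat"
  assumes J: "finite J" "depends_on J \<psi>" and \<psi>: "\<And>z. \<psi> z \<in> {1..k}"
  shows "\<psi> \<in> measurable M (count_space {1..k})"
proof (rule measurable_count_space_eq2[THEN iffD2], simp, intro conjI ballI)
  show "\<psi> \<in> space M \<rightarrow> {1..k}" using \<psi> by auto
  fix a
  have "depends_on J (\<lambda>z. \<psi> z = a)" by (rule depends_on_comp[OF J(2)])
  from depends_on_M[OF J(1) this] show "\<psi> -` {a} \<inter> space M \<in> sets M" by (simp add: space_M vimage_def)
qed

lemma pattern_limit:
  fixes k :: nat and \<psi> :: "profile \<Rightarrow> nat"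
  assumes U: "U \<subseteq> carrier G" "finite U" and J: "finite J" "depends_on J \<psi>" and \<psi>: "\<And>z. \<psi> z \<in> {1..k}"
  shows "(\<lambda>n. measure (Ms (\<sigma> n)) {x \<in> X (\<sigma> n). pattern U (fs (\<sigma> n)) (\<lambda>x. \<psi> (prof (\<sigma> n) x)) x = q})
    \<longlonglongrightarrow> measure M {z \<in> space M. pattern U act \<psi> z = q}"
proof -
  interpret symmetric_system G M act S by (rule act_system)
  let ?J = "(\<Union>g\<in>U. shift g ` J) \<union> (\<Union>g\<in>U. {(sep g, idx \<one>), (sep g, idx g)})"
  have fJ: "finite ?J" using U(2) J(1) by blast
  have dep: "depends_on ?J (\<lambda>z. profile_pattern U \<psi> z = q)"
    by (rule depends_on_comp[OF profile_pattern_depends[OF U(1) J(2)]])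
  have \<psi>m: "\<psi> \<in> measurable M (count_space {1..k})" by (rule depends_on_measurable[OF J \<psi>])
  have "measure M {z \<in> space M. pattern U act \<psi> z = q} = measure M {z. profile_pattern U \<psi> z = q}"
  proof (rule finite_measure_eq_AE)
    show "AE z in M. z \<in> {z \<in> space M. pattern U act \<psi> z = q} \<longleftrightarrow> z \<in> {z. profile_pattern U \<psi> z = q}"
      using profile_pattern_AE[OF U, of \<psi>] by eventually_elim (simp add: space_M)
  qed (use pattern_sets[OF U \<psi>m] depends_on_M[OF fJ dep] in auto)
  moreover have "{x \<in> X n. pattern U (fs n) (\<lambda>x. \<psi> (prof n x)) x = q} = {x \<in> X n. profile_pattern U \<psi> (prof n x) = q}" for n
    using profile_pattern_prof[OF U(1)] by auto
  ultimately show ?thesis using limit_M[OF fJ dep] by simp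
qed

lemma colouring_approximation:
  fixes k :: nat and \<psi> :: "profile \<Rightarrow> nat"
  assumes \<psi>: "\<psi> \<in> measurable M (count_space {1..k})" and \<epsilon>: "0 < \<epsilon>" and k: "1 \<le> k"
  shows "\<exists>J \<psi>'. finite J \<and> depends_on J \<psi>' \<and> (\<forall>z. \<psi>' z \<in> {1..k}) \<and> measure M {z \<in> space M. \<psi> z \<noteq> \<psi>' z} < \<epsilon>"
proof -
  interpret prob_space M by (rule prob_M)
  have A: "{z. \<psi> z = a} \<in> sets M" if "a \<in> {1..k}" for a
    using measurable_sets[OF \<psi>, of "{a}"] that by (simp add: space_M vimage_def)
  have \<epsilon>': "0 < \<epsilon> / real (Suc k)" using \<epsilon> by simp
  have "\<forall>a. \<exists>J E. a \<in> {1..k} \<longrightarrow> finite J \<and> depends_on J E \<and> measure M (sym_diff {z. \<psi> z = a} {z. E z}) < \<epsilon> / real (Suc k)"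
    using finite_dimensional_approximation[OF finite_measure_axioms sets_M A \<epsilon>'] by blast
  then obtain J E where JE: "\<And>a. a \<in> {1..k} \<Longrightarrow> finite (J a)" "\<And>a. a \<in> {1..k} \<Longrightarrow> depends_on (J a) (E a)"
    "\<And>a. a \<in> {1..k} \<Longrightarrow> measure M (sym_diff {z. \<psi> z = a} {z. E a z}) < \<epsilon> / real (Suc k)" by metis
  \<comment> \<open>The events approximating the colour classes may overlap or miss a point: the
    least colour wins, and 1 is the default.\<close>
  define \<psi>' where "\<psi>' z = (if \<exists>a\<in>{1..k}. E a z then LEAST a. a \<in> {1..k} \<and> E a z else 1)" for z
  have range: "\<psi>' z \<in> {1..k}" for z
  proof (cases "\<exists>a\<in>{1..k}. E a z")
    case True
    then have "\<exists>a. a \<in> {1..k} \<and> E a z" by blast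
    from LeastI_ex[OF this] show ?thesis using True by (simp add: \<psi>'_def)
  next
    case False
    then show ?thesis using k unfolding \<psi>'_def by (simp only: if_False) simp
  qed
  have dep: "depends_on (\<Union>a\<in>{1..k}. J a) \<psi>'"
    unfolding depends_on_def
  proof (intro allI impI)
    fix z z' :: profile assume eq: "\<forall>i\<in>(\<Union>a\<in>{1..k}. J a). z i = z' i"
    have "E a z = E a z'" if "a \<in> {1..k}" for a
      using eq that by (intro depends_onD[OF JE(2)[OF that]]) blast
    then have "(\<lambda>a. a \<in> {1..k} \<and> E a z) = (\<lambda>a. a \<in> {1..k} \<and> E a z')"
      and "(\<exists>a\<in>{1..k}. E a z) = (\<exists>a\<in>{1..k}. E a z')" by blast+
    then show "\<psi>' z = \<psi>' z'" unfolding \<psi>'_def by simp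
  qed
  have bad: "{z \<in> space M. \<psi> z \<noteq> \<psi>' z} \<subseteq> (\<Union>a\<in>{1..k}. sym_diff {z. \<psi> z = a} {z. E a z})"
  proof
    fix z assume z: "z \<in> {z \<in> space M. \<psi> z \<noteq> \<psi>' z}"
    show "z \<in> (\<Union>a\<in>{1..k}. sym_diff {z. \<psi> z = a} {z. E a z})"
    proof (rule ccontr)
      assume "z \<notin> (\<Union>a\<in>{1..k}. sym_diff {z. \<psi> z = a} {z. E a z})"
      then have "z \<notin> sym_diff {z. \<psi> z = a} {z. E a z}" if "a \<in> {1..k}" for a using that by blast
      then have E: "E a z \<longleftrightarrow> \<psi> z = a" if "a \<in> {1..k}" for a using that by blast
      have r: "\<psi> z \<in> {1..k}" using measurable_space[OF \<psi>, of z] z by simp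
      have "(LEAST a. a \<in> {1..k} \<and> E a z) = \<psi> z"
        by (rule Least_equality) (use E r in auto)
      then have "\<psi>' z = \<psi> z" unfolding \<psi>'_def using E r by (simp only: if_P bexI[of _ "\<psi> z"])
      then show False using z by simp
    qed
  qed
  have S: "sym_diff {z. \<psi> z = a} {z. E a z} \<in> sets M" if "a \<in> {1..k}" for a
    using A[OF that] depends_on_M[OF JE(1)[OF that] JE(2)[OF that]] by blast
  have "measure M {z \<in> space M. \<psi> z \<noteq> \<psi>' z} \<le> measure M (\<Union>a\<in>{1..k}. sym_diff {z. \<psi> z = a} {z. E a z})"
    by (rule finite_measure_mono[OF bad sets.finite_UN]) (use S in auto)
  also have "\<dots> \<le> (\<Sum>a\<in>{1..k}. measure M (sym_diff {z. \<psi> z = a} {z. E a z}))"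
    by (rule finite_measure_subadditive_finite) (use S in auto)
  also have "\<dots> \<le> (\<Sum>a\<in>{1..k}. \<epsilon> / real (Suc k))"
    by (rule sum_mono) (use JE(3) in \<open>auto intro: less_imp_le\<close>)
  also have "\<dots> < \<epsilon>" using \<epsilon> by (simp add: field_simps)
  finally show ?thesis using JE(1) dep range by (intro exI[of _ "\<Union>a\<in>{1..k}. J a"] exI[of _ \<psi>']) blast
qed

end

text \<open>Join each point to its image. Every point then has at most two neighbours, one image and
  one preimage, so a greedy colouring gets by with three colours.\<close>

lemma three_colouring:
  assumes "finite X" "inj_on h X"
  shows "\<exists>c :: 'x \<Rightarrow> nat. (\<forall>x. c x \<le> 2) \<and> (\<forall>x\<in>X. h x \<in> X \<longrightarrow> h x \<noteq> x \<longrightarrow> c (h x) \<noteq> c x)"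
  using assms
proof (induction X rule: finite_induct)
  case empty
  show ?case by (intro exI[of _ "\<lambda>_. 0"]) simp
next
  case (insert a X)
  then obtain c :: "'x \<Rightarrow> nat" where c: "\<And>x. c x \<le> 2" "\<And>x. x \<in> X \<Longrightarrow> h x \<in> X \<Longrightarrow> h x \<noteq> x \<Longrightarrow> c (h x) \<noteq> c x"
    by (auto simp: inj_on_insert)
  obtain b where b: "\<And>x. x \<in> X \<Longrightarrow> h x = a \<Longrightarrow> x = b"
  proof (cases "\<exists>x\<in>X. h x = a")
    case True
    then obtain y where "y \<in> X" "h y = a" by blast
    then show thesis using that[of y] insert.prems by (auto simp: inj_on_def)
  qed (use that in blast)
  have "card {c (h a), c b} < card {0, 1, 2 :: nat}"
    by (rule le_less_trans[of _ 2]) (auto simp: card_insert_if)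
  then have "\<not> {0, 1, 2} \<subseteq> {c (h a), c b}" using card_mono[of "{c (h a), c b}" "{0, 1, 2}"] by auto
  then obtain v where "v \<in> {0, 1, 2}" "v \<notin> {c (h a), c b}" by blast
  then have v: "v \<le> 2" "v \<noteq> c (h a)" "v \<noteq> c b" by auto
  show ?case
  proof (intro exI[of _ "c(a := v)"] conjI allI ballI impI)
    fix x show "(c(a := v)) x \<le> 2" using c(1) v(1) by simp
  next
    fix x assume x: "x \<in> insert a X" "h x \<in> insert a X" "h x \<noteq> x"
    consider "x = a" | "x \<noteq> a" "h x = a" | "x \<noteq> a" "h x \<noteq> a" by blast
    then show "(c(a := v)) (h x) \<noteq> (c(a := v)) x"
    proof cases
      case 1
      then show ?thesis using x v(2) by auto
    next
      case 2
      then show ?thesis using x v(3) b[of x] by auto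
    next
      case 3
      then show ?thesis using x c(2)[of x] by auto
    qed
  qed
qed

lemma pattern_cong:
  "(\<And>g. g \<in> U \<Longrightarrow> \<phi> (f g x) = \<psi> (f g x)) \<Longrightarrow> pattern U f \<phi> x = pattern U f \<psi> x"
  unfolding pattern_def by (auto intro!: restrict_ext)

lemma eventually_constant_of_bool:
  assumes "convergent (\<lambda>n. of_bool (P n) :: real)"
  shows "\<exists>n0. \<forall>n\<ge>n0. \<forall>m\<ge>n0. P n \<longleftrightarrow> P m"
proof -
  have "Cauchy (\<lambda>n. of_bool (P n) :: real)" using assms by (rule convergent_Cauchy)
  then obtain n0 where n0: "\<And>m n. m \<ge> n0 \<Longrightarrow> n \<ge> n0 \<Longrightarrow> dist (of_bool (P m) :: real) (of_bool (P n)) < 1"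
    unfolding Cauchy_def using zero_less_one by blast
  have "P n \<longleftrightarrow> P m" if "n \<ge> n0" "m \<ge> n0" for n m
    using n0[OF that] by (cases "P n"; cases "P m") (auto simp: dist_real_def)
  then show ?thesis by blast
qed

section \<open>Compactness: weak limits of finite systems\<close>

locale finite_systems = symmetric_generators G S
  for G :: "('a, 'm) monoid_scheme" (structure) and S +
  fixes X :: "nat \<Rightarrow> 'x set" and fs :: "nat \<Rightarrow> 'a \<Rightarrow> 'x \<Rightarrow> 'x"
  assumes X_fin: "\<And>n. finite (X n)"
    and sys: "\<And>n. pmp_system G (uniform_count_measure (X n)) (fs n)"
begin

definition freq :: "nat \<Rightarrow> nat \<Rightarrow> ('x \<Rightarrow> nat) \<Rightarrow> 'a set \<times> ('a \<Rightarrow> nat) \<Rightarrow> real" where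
  "freq n r \<phi> q = measure (uniform_count_measure (X n)) {x \<in> X n. pattern (big_ball G S r) (fs n) \<phi> x = q}"

text \<open>A target prescribes the pattern frequencies up to \<open>1 / N\<close>. There are countably many, so along a
  subsequence each is either attained by colourings of almost all systems or of almost none.\<close>

definition targets :: "(nat \<times> nat \<times> nat \<times> ('a set \<times> ('a \<Rightarrow> nat) \<Rightarrow> nat)) set" where
  "targets = (SIGMA r:UNIV. SIGMA k:UNIV. SIGMA N:UNIV. patterns (big_ball G S r) k \<rightarrow>\<^sub>E {..N})"

text \<open>Rounding down assigns to a colouring exactly one target for given \<open>r\<close>,
  \<open>k\<close> and \<open>N\<close>, so countably many possibilities are all that has to be
  controlled.\<close>

definition matches :: "nat \<Rightarrow> ('x \<Rightarrow> nat) \<Rightarrow> nat \<times> nat \<times> nat \<times> ('a set \<times> ('a \<Rightarrow> nat) \<Rightarrow> nat) \<Rightarrow> bool" where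
  "matches n \<phi> = (\<lambda>(r, k, N, p). \<phi> \<in> X n \<rightarrow> {1..k} \<and>
     (\<forall>q\<in>patterns (big_ball G S r) k. p q = nat \<lfloor>real N * freq n r \<phi> q\<rfloor>))"

lemma finite_target_set: "finite (patterns (big_ball G S r) k \<rightarrow>\<^sub>E {..N::nat})"
  using finite_patterns[OF finite_big_ball[OF S_fin]] by (intro finite_PiE) auto

lemma countable_targets: "countable targets"
  unfolding targets_def
  by (rule countable_SIGMA, simp, rule countable_SIGMA, simp, rule countable_SIGMA, simp,
      rule countable_finite, rule finite_target_set)

lemma freq_bounds: "0 \<le> freq n r \<phi> q" "freq n r \<phi> q \<le> 1"
proof -
  interpret pmp_system G "uniform_count_measure (X n)" "fs n" by (rule sys)
  show "0 \<le> freq n r \<phi> q" "freq n r \<phi> q \<le> 1" by (auto simp: freq_def)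
qed

lemma matches_close:
  assumes "matches n \<phi> (r, k, N, p)" "q \<in> patterns (big_ball G S r) k" "0 < N"
  shows "\<bar>freq n r \<phi> q - real (p q) / real N\<bar> \<le> 1 / real N"
proof -
  have "p q = nat \<lfloor>real N * freq n r \<phi> q\<rfloor>" using assms(1,2) by (simp add: matches_def)
  moreover have "0 \<le> real N * freq n r \<phi> q" using freq_bounds by simp
  ultimately have "\<bar>real N * freq n r \<phi> q - real (p q)\<bar> \<le> 1" by linarith
  then have "\<bar>real N * freq n r \<phi> q - real (p q)\<bar> / real N \<le> 1 / real N" by (intro divide_right_mono) auto
  moreover have "freq n r \<phi> q - real (p q) / real N = (real N * freq n r \<phi> q - real (p q)) / real N"
    using assms(3) by (simp add: field_simps)
  ultimately show ?thesis by (simp add: abs_divide)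
qed

lemma matches_exists:
  assumes "\<phi> \<in> X n \<rightarrow> {1..k}"
  obtains p where "p \<in> patterns (big_ball G S r) k \<rightarrow>\<^sub>E {..N}" "matches n \<phi> (r, k, N, p)"
proof
  let ?p = "restrict (\<lambda>q. nat \<lfloor>real N * freq n r \<phi> q\<rfloor>) (patterns (big_ball G S r) k)"
  have "nat \<lfloor>real N * freq n r \<phi> q\<rfloor> \<le> N" for q
  proof -
    have "real N * freq n r \<phi> q \<le> real N" using freq_bounds(2) by (simp add: mult_left_le)
    then show ?thesis by (simp add: nat_le_iff floor_le_iff)
  qed
  then show "?p \<in> patterns (big_ball G S r) k \<rightarrow>\<^sub>E {..N}" by auto
  show "matches n \<phi> (r, k, N, ?p)" using assms by (simp add: matches_def)
qed

text \<open>Once attainability has stabilised, a target attained at one late stage is attained at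
  all of them. In one direction, a colouring of a late system hits a target, and the colourings
  recorded for this target turn into a coordinate of the limit with nearly the same statistics. In
  the other, a colouring of the limit is approximated by a finite-dimensional one, which also
  colours a very late system; the target hit there is attained at every late stage.\<close>

theorem weak_limit_exists:
  "\<exists>(\<rho> :: nat \<Rightarrow> nat) (M :: profile measure) f. strict_mono \<rho> \<and> sets M = sets borel \<and> symmetric_system G M f S \<and>
    weakly_converges S (\<lambda>n. uniform_count_measure (X (\<rho> n))) (\<lambda>n. fs (\<rho> n)) M f"
proof -
  obtain \<tau> :: "nat \<Rightarrow> nat" where \<tau>: "strict_mono \<tau>"
    and conv: "\<And>j. j \<in> targets \<Longrightarrow> convergent (\<lambda>n. of_bool (\<exists>\<phi>. matches (\<tau> n) \<phi> j) :: real)"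
    using bounded_diagonal_subsequence[OF countable_targets, of "\<lambda>j n. of_bool (\<exists>\<phi>. matches n \<phi> j)" "\<lambda>_. 1"] by auto
  \<comment> \<open>The colouring recorded for a target; the constant 1 stands in where the target
    is not attained.\<close>
  define base where "base j n = (if \<exists>\<phi>. matches (\<tau> n) \<phi> j then SOME \<phi>. matches (\<tau> n) \<phi> j else (\<lambda>_. 1))" for j n
  have base: "matches (\<tau> n) (base j n) j" if "\<exists>\<phi>. matches (\<tau> n) \<phi> j" for j n
    using someI_ex[OF that] that by (simp add: base_def)
  have base_bound: "base (r, k, N, p) n x \<le> max k 1" if "x \<in> X (\<tau> n)" for r k N p n x
  proof (cases "\<exists>\<phi>. matches (\<tau> n) \<phi> (r, k, N, p)")
    case True
    from base[OF this] have "base (r, k, N, p) n \<in> X (\<tau> n) \<rightarrow> {1..k}" by (simp add: matches_def)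
    from funcset_mem[OF this that] show ?thesis by simp
  next
    case False
    then have "base (r, k, N, p) n = (\<lambda>_. 1)" unfolding base_def by (simp only: if_False)
    then show ?thesis by simp
  qed
  have "\<forall>g n. \<exists>c :: 'x \<Rightarrow> nat. (\<forall>x. c x \<le> 2) \<and> (g \<in> carrier G \<longrightarrow> (\<forall>x\<in>X (\<tau> n). fs (\<tau> n) g x \<noteq> x \<longrightarrow> c (fs (\<tau> n) g x) \<noteq> c x))"
  proof (intro allI)
    fix g n
    interpret pmp_system G "uniform_count_measure (X (\<tau> n))" "fs (\<tau> n)" by (rule sys)
    show "\<exists>c :: 'x \<Rightarrow> nat. (\<forall>x. c x \<le> 2) \<and> (g \<in> carrier G \<longrightarrow> (\<forall>x\<in>X (\<tau> n). fs (\<tau> n) g x \<noteq> x \<longrightarrow> c (fs (\<tau> n) g x) \<noteq> c x))"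
    proof (cases "g \<in> carrier G")
      case True
      have "inj_on (fs (\<tau> n) g) (X (\<tau> n))" using act.inj_prop[OF True] by (simp add: space_uniform_count_measure)
      from three_colouring[OF X_fin this] show ?thesis
        using f_space[OF True] by (auto simp: space_uniform_count_measure)
    qed (auto intro: exI[of _ "\<lambda>_. 0"])
  qed
  then obtain sc where sc: "\<And>g n x. sc g n x \<le> (2::nat)"
    and sc_sep: "\<And>g n x. g \<in> carrier G \<Longrightarrow> x \<in> X (\<tau> n) \<Longrightarrow> fs (\<tau> n) g x \<noteq> x \<Longrightarrow> sc g n (fs (\<tau> n) g x) \<noteq> sc g n x"
    by metis
  \<comment> \<open>Coordinates are named by targets and by group elements; the latter carry the
    separating three-colourings.\<close>
  define C where "C = Inl ` targets \<union> Inr ` carrier G"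
  have "countable (carrier G)"
  proof -
    have "carrier G = (\<Union>r. word_ball G S r)" using word_ball_exhausts word_ball_carrier by blast
    moreover have "countable (\<Union>r. word_ball G S r)"
      using finite_word_ball[OF S_fin] by (intro countable_UN) (auto intro: countable_finite)
    ultimately show ?thesis by simp
  qed
  then have C: "countable C" using countable_targets by (simp add: C_def)
  define en where "en = from_nat_into C"
  define code where "code = to_nat_on C"
  have en_code: "en (code a) = a" if "a \<in> C" for a
    using that C by (simp add: en_def code_def)
  define c where "c i n = (case en i of Inl j \<Rightarrow> base j n | Inr g \<Rightarrow> sc g n)" for i n
  \<comment> \<open>The maximum with 1 covers the default colouring in the case
    \<open>k = 0\<close>.\<close>
  define K where "K i = (case en i of Inl (r, k, N, p) \<Rightarrow> max k 1 | Inr g \<Rightarrow> 2)" for i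
  have cs: "coloured_sequence G S (\<lambda>n. X (\<tau> n)) (\<lambda>n. fs (\<tau> n)) c K (\<lambda>g. code (Inr g))"
  proof (intro coloured_sequence.intro symmetric_generators_axioms coloured_sequence_axioms.intro)
    show "c i n x \<le> K i" if "x \<in> X (\<tau> n)" for i n x
      using base_bound[OF that] sc unfolding c_def K_def by (auto split: sum.split)
    show "c (code (Inr g)) n (fs (\<tau> n) g x) \<noteq> c (code (Inr g)) n x"
      if "g \<in> carrier G" "x \<in> X (\<tau> n)" "fs (\<tau> n) g x \<noteq> x" for g n x
    proof -
      have "en (code (Inr g)) = Inr g" using that(1) by (intro en_code) (simp add: C_def)
      then show ?thesis using sc_sep[OF that] by (simp add: c_def)
    qed
  qed (use X_fin sys in auto)
  interpret Z: coloured_sequence G S "\<lambda>n. X (\<tau> n)" "\<lambda>n. fs (\<tau> n)" c K "\<lambda>g. code (Inr g)" by (rule cs)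
  obtain \<sigma> M where lim: "Z.limit_measure \<sigma> M" using Z.limit_measure_exists by blast
  interpret Z: coloured_limit G S "\<lambda>n. X (\<tau> n)" "\<lambda>n. fs (\<tau> n)" c K "\<lambda>g. code (Inr g)" \<sigma> M
    by (intro coloured_limit.intro cs coloured_limit_axioms.intro lim)
  interpret L: symmetric_system G M Z.act S by (rule Z.act_system)
  define \<rho> where "\<rho> n = \<tau> (\<sigma> n)" for n
  have \<rho>: "strict_mono \<rho>" using strict_mono_o[OF \<tau> Z.mono_\<sigma>] unfolding \<rho>_def[abs_def] o_def .
  \<comment> \<open>Finitely many targets share \<open>r\<close>, \<open>k\<close> and
    \<open>N\<close>, so one threshold serves them all.\<close>
  have const: "\<exists>n0. \<forall>n\<ge>n0. \<forall>m\<ge>n0. \<forall>p\<in>patterns (big_ball G S r) k \<rightarrow>\<^sub>E {..N}.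
      (\<exists>\<phi>. matches (\<rho> n) \<phi> (r, k, N, p)) \<longleftrightarrow> (\<exists>\<phi>. matches (\<rho> m) \<phi> (r, k, N, p))" for r k N
  proof -
    let ?P = "patterns (big_ball G S r) k \<rightarrow>\<^sub>E {..N}"
    have "\<forall>p. \<exists>n0. p \<in> ?P \<longrightarrow> (\<forall>n\<ge>n0. \<forall>m\<ge>n0. (\<exists>\<phi>. matches (\<tau> n) \<phi> (r, k, N, p)) \<longleftrightarrow> (\<exists>\<phi>. matches (\<tau> m) \<phi> (r, k, N, p)))"
    proof
      fix p
      show "\<exists>n0. p \<in> ?P \<longrightarrow> (\<forall>n\<ge>n0. \<forall>m\<ge>n0. (\<exists>\<phi>. matches (\<tau> n) \<phi> (r, k, N, p)) \<longleftrightarrow> (\<exists>\<phi>. matches (\<tau> m) \<phi> (r, k, N, p)))"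
        using eventually_constant_of_bool[OF conv[of "(r, k, N, p)"]] by (auto simp: targets_def)
    qed
    then obtain n0 where n0: "\<And>p n m. p \<in> ?P \<Longrightarrow> n \<ge> n0 p \<Longrightarrow> m \<ge> n0 p \<Longrightarrow>
        (\<exists>\<phi>. matches (\<tau> n) \<phi> (r, k, N, p)) \<longleftrightarrow> (\<exists>\<phi>. matches (\<tau> m) \<phi> (r, k, N, p))" by metis
    show ?thesis
    proof (intro exI[of _ "Max (n0 ` ?P)"] allI impI ballI)
      fix n m p assume nm: "n \<ge> Max (n0 ` ?P)" "m \<ge> Max (n0 ` ?P)" and p: "p \<in> ?P"
      have "n0 p \<le> Max (n0 ` ?P)" using finite_target_set p by (intro Max_ge) auto
      then have "n0 p \<le> \<sigma> n" "n0 p \<le> \<sigma> m" using nm seq_suble[OF Z.mono_\<sigma>, of n] seq_suble[OF Z.mono_\<sigma>, of m] by auto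
      then show "(\<exists>\<phi>. matches (\<rho> n) \<phi> (r, k, N, p)) \<longleftrightarrow> (\<exists>\<phi>. matches (\<rho> m) \<phi> (r, k, N, p))"
        unfolding \<rho>_def by (rule n0[OF p])
    qed
  qed
  define stat where "stat r \<psi> q = measure M {z \<in> space M. pattern (big_ball G S r) Z.act \<psi> z = q}" for r and \<psi> :: "profile \<Rightarrow> nat" and q
  have pl: "(\<lambda>m. freq (\<rho> m) r (\<lambda>x. \<psi> (Z.prof (\<sigma> m) x)) q) \<longlonglongrightarrow> stat r \<psi> q"
    if "finite J" "depends_on J \<psi>" "\<And>z. \<psi> z \<in> {1..k}" for J r \<psi> q and k :: nat
    using Z.pattern_limit[OF big_ball_carrier finite_big_ball[OF S_fin] that] unfolding freq_def \<rho>_def stat_def .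
  have tv: "tv_dist (local_statistics S (uniform_count_measure (X (\<rho> n))) (fs (\<rho> n)) \<phi> r) (local_statistics S M Z.act \<psi> r) \<le> \<epsilon>"
    if \<phi>: "\<phi> \<in> X (\<rho> n) \<rightarrow> {1..k}" and \<psi>: "\<psi> \<in> measurable M (count_space {1..k})"
      and close: "\<And>q. q \<in> patterns (big_ball G S r) k \<Longrightarrow> \<bar>freq (\<rho> n) r \<phi> q - stat r \<psi> q\<bar> \<le> d"
      and d: "real (card (patterns (big_ball G S r) k)) * d \<le> \<epsilon>" for n \<phi> r k \<psi> \<epsilon> d
  proof (rule local_statistics_tv[where k = k])
    show "symmetric_system G (uniform_count_measure (X (\<rho> n))) (fs (\<rho> n)) S" unfolding \<rho>_def by (rule Z.Ms_system)
    show "symmetric_system G M Z.act S" by (rule Z.act_system)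
    show "\<phi> \<in> measurable (uniform_count_measure (X (\<rho> n))) (count_space {1..k})"
      using \<phi> by (auto simp: measurable_def space_uniform_count_measure sets_uniform_count_measure)
    have "(\<Sum>q\<in>patterns (big_ball G S r) k. \<bar>freq (\<rho> n) r \<phi> q - stat r \<psi> q\<bar>) \<le> real (card (patterns (big_ball G S r) k)) * d"
      using close by (rule sum_bounded_above)
    then show "(\<Sum>q\<in>patterns (big_ball G S r) k. \<bar>measure (uniform_count_measure (X (\<rho> n))) {x \<in> space (uniform_count_measure (X (\<rho> n))). pattern (big_ball G S r) (fs (\<rho> n)) \<phi> x = q}
        - measure M {z \<in> space M. pattern (big_ball G S r) Z.act \<psi> z = q}\<bar>) \<le> \<epsilon>"
      using d by (simp add: freq_def stat_def space_uniform_count_measure)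
  qed (rule \<psi>)
  have meas_iff: "\<phi> \<in> measurable (uniform_count_measure (X n)) (count_space {1..k}) \<longleftrightarrow> \<phi> \<in> X n \<rightarrow> {1..k}" for \<phi> n k
    by (auto simp: measurable_def space_uniform_count_measure sets_uniform_count_measure)
  have N_exists: "\<exists>N>0. b / real N \<le> \<epsilon>" if "0 < \<epsilon>" for b \<epsilon> :: real
  proof -
    obtain N :: nat where N: "b / \<epsilon> < real N" using reals_Archimedean2 by blast
    have "b / real (Suc N) \<le> \<epsilon>" using N that by (simp add: field_simps)
    then show ?thesis by blast
  qed
  have "weakly_converges S (\<lambda>n. uniform_count_measure (X (\<rho> n))) (\<lambda>n. fs (\<rho> n)) M Z.act"
  proof (rule weakly_convergesI)
    show "symmetric_system G (uniform_count_measure (X (\<rho> n))) (fs (\<rho> n)) S" for n unfolding \<rho>_def by (rule Z.Ms_system)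
    show "symmetric_system G M Z.act S" by (rule Z.act_system)
  next
    fix r k :: nat and \<epsilon> :: real assume k: "1 \<le> k" and \<epsilon>: "0 < \<epsilon>"
    let ?P = "patterns (big_ball G S r) k"
    \<comment> \<open>Two errors of \<open>1 / N\<close> per pattern: the rounding for
      \<open>\<phi>\<close> and, in the limit, that for \<open>\<psi>\<close>.\<close>
    obtain N where N: "0 < N" "2 * real (card ?P) / real N \<le> \<epsilon>" using N_exists[OF \<epsilon>] by blast
    obtain n0 where n0': "\<forall>n\<ge>n0. \<forall>m\<ge>n0. \<forall>p\<in>?P \<rightarrow>\<^sub>E {..N}.
      (\<exists>\<phi>. matches (\<rho> n) \<phi> (r, k, N, p)) \<longleftrightarrow> (\<exists>\<phi>. matches (\<rho> m) \<phi> (r, k, N, p))" using const[of r k N] by (rule exE)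
    note n0 = n0'[rule_format]
    have res: "\<exists>\<psi>\<in>measurable M (count_space {1..k}). tv_dist (local_statistics S (uniform_count_measure (X (\<rho> n))) (fs (\<rho> n)) \<phi> r) (local_statistics S M Z.act \<psi> r) \<le> \<epsilon>"
      if n: "n \<ge> n0" and \<phi>m: "\<phi> \<in> measurable (uniform_count_measure (X (\<rho> n))) (count_space {1..k})" for n \<phi>
    proof -
      have \<phi>: "\<phi> \<in> X (\<rho> n) \<rightarrow> {1..k}" using \<phi>m meas_iff by blast
      obtain p where p: "p \<in> ?P \<rightarrow>\<^sub>E {..N}" "matches (\<rho> n) \<phi> (r, k, N, p)" using matches_exists[OF \<phi>] .
      let ?j = "(r, k, N, p)"
      have jC: "Inl ?j \<in> C" using p(1) by (auto simp: C_def targets_def)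
      have bm: "matches (\<rho> m) (base ?j (\<sigma> m)) ?j" if "m \<ge> n0" for m
        using base[of "\<sigma> m" ?j] n0[OF n that p(1)] p(2) unfolding \<rho>_def by blast
      \<comment> \<open>The colouring of the limit is the recorded coordinate at the identity;
        values outside the range, which some profiles have, are replaced by 1.\<close>
      define \<psi> where "\<psi> z = (if of_discrete (z (code (Inl ?j), Z.idx \<one>)) \<in> {1..k} then of_discrete (z (code (Inl ?j), Z.idx \<one>)) else 1)" for z :: profile
      have dep: "depends_on {(code (Inl ?j), Z.idx \<one>)} \<psi>" by (simp add: depends_on_def \<psi>_def)
      have ran: "\<psi> z \<in> {1..k}" for z
      proof (cases "of_discrete (z (code (Inl ?j), Z.idx \<one>)) \<in> {1..k}")
        case True
        then show ?thesis unfolding \<psi>_def by (simp only: if_True)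
      next
        case False
        then have "\<psi> z = 1" unfolding \<psi>_def by (simp only: if_False)
        then show ?thesis using k by simp
      qed
      have \<psi>_prof: "\<psi> (Z.prof (\<sigma> m) x) = base ?j (\<sigma> m) x" if "m \<ge> n0" "x \<in> X (\<rho> m)" for m x
      proof -
        interpret pmp_system G "uniform_count_measure (X (\<rho> m))" "fs (\<rho> m)" by (rule sys)
        have "fs (\<rho> m) \<one> x = x" using f_one[of x] that(2) by (simp add: space_uniform_count_measure)
        then have "of_discrete (Z.prof (\<sigma> m) x (code (Inl ?j), Z.idx \<one>)) = base ?j (\<sigma> m) x"
          using en_code[OF jC] by (simp add: Z.prof_coord discrete_inverse c_def \<rho>_def)
        moreover have "base ?j (\<sigma> m) x \<in> {1..k}" using bm[OF that(1)] that(2) unfolding matches_def by auto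
        ultimately show ?thesis unfolding \<psi>_def by (simp only: if_True)
      qed
      have fr: "freq (\<rho> m) r (\<lambda>x. \<psi> (Z.prof (\<sigma> m) x)) q = freq (\<rho> m) r (base ?j (\<sigma> m)) q" if "m \<ge> n0" for m q
      proof -
        interpret pmp_system G "uniform_count_measure (X (\<rho> m))" "fs (\<rho> m)" by (rule sys)
        have peq: "pattern (big_ball G S r) (fs (\<rho> m)) (\<lambda>x. \<psi> (Z.prof (\<sigma> m) x)) x = pattern (big_ball G S r) (fs (\<rho> m)) (base ?j (\<sigma> m)) x"
          if "x \<in> X (\<rho> m)" for x
        proof (rule pattern_cong)
          fix g assume "g \<in> big_ball G S r"
          then have "g \<in> carrier G" using big_ball_carrier by blast
          then have "fs (\<rho> m) g x \<in> X (\<rho> m)" using f_space[of g x] \<open>x \<in> X (\<rho> m)\<close> by (simp add: space_uniform_count_measure)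
          then show "\<psi> (Z.prof (\<sigma> m) (fs (\<rho> m) g x)) = base ?j (\<sigma> m) (fs (\<rho> m) g x)" using \<psi>_prof[OF \<open>m \<ge> n0\<close>] by blast
        qed
        have "{x \<in> X (\<rho> m). pattern (big_ball G S r) (fs (\<rho> m)) (\<lambda>x. \<psi> (Z.prof (\<sigma> m) x)) x = q}
            = {x \<in> X (\<rho> m). pattern (big_ball G S r) (fs (\<rho> m)) (base ?j (\<sigma> m)) x = q}"
          by (rule Collect_cong, rule conj_cong[OF HOL.refl]) (simp only: peq)
        then show ?thesis unfolding freq_def by simp
      qed
      \<comment> \<open>The recorded colourings match the target at all late stages, and the
        inequality survives the limit.\<close>
      have st: "\<bar>stat r \<psi> q - real (p q) / real N\<bar> \<le> 1 / real N" if q: "q \<in> ?P" for q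
      proof (rule LIMSEQ_le_const2)
        show "(\<lambda>m. \<bar>freq (\<rho> m) r (\<lambda>x. \<psi> (Z.prof (\<sigma> m) x)) q - real (p q) / real N\<bar>) \<longlonglongrightarrow> \<bar>stat r \<psi> q - real (p q) / real N\<bar>"
          by (intro tendsto_rabs tendsto_diff tendsto_const pl[OF _ dep ran]) simp
        show "\<exists>n1. \<forall>m\<ge>n1. \<bar>freq (\<rho> m) r (\<lambda>x. \<psi> (Z.prof (\<sigma> m) x)) q - real (p q) / real N\<bar> \<le> 1 / real N"
          using fr matches_close[OF bm q N(1)] by (intro exI[of _ n0]) simp
      qed
      have \<psi>m: "\<psi> \<in> measurable M (count_space {1..k})" by (rule Z.depends_on_measurable[OF _ dep ran]) simp
      have "tv_dist (local_statistics S (uniform_count_measure (X (\<rho> n))) (fs (\<rho> n)) \<phi> r) (local_statistics S M Z.act \<psi> r) \<le> \<epsilon>"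
      proof -
        have cl: "\<bar>freq (\<rho> n) r \<phi> q - stat r \<psi> q\<bar> \<le> 2 / real N" if q: "q \<in> ?P" for q
          using matches_close[OF p(2) q N(1)] st[OF q] by linarith
        have dd: "real (card ?P) * (2 / real N) \<le> \<epsilon>" using N(2) by (simp add: mult.commute)
        show ?thesis by (rule tv[OF \<phi> \<psi>m cl dd])
      qed
      then show ?thesis using \<psi>m by blast
    qed
    show "\<forall>\<^sub>F n in sequentially. \<forall>\<phi>\<in>measurable (uniform_count_measure (X (\<rho> n))) (count_space {1..k}).
        \<exists>\<psi>\<in>measurable M (count_space {1..k}). tv_dist (local_statistics S (uniform_count_measure (X (\<rho> n))) (fs (\<rho> n)) \<phi> r) (local_statistics S M Z.act \<psi> r) \<le> \<epsilon>"
      unfolding eventually_sequentially by (intro exI[of _ n0] allI impI ballI res)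
  next
    fix r k :: nat and \<epsilon> :: real assume k: "1 \<le> k" and \<epsilon>: "0 < \<epsilon>"
    let ?P = "patterns (big_ball G S r) k" and ?U = "big_ball G S r"
    have \<epsilon>2: "0 < \<epsilon> / 2" using \<epsilon> by simp
    \<comment> \<open>Per pattern \<open>1 / N\<close> is lost three times: rounding at stage
      \<open>n\<close>, rounding at stage \<open>m\<close>, and passing from stage \<open>m\<close>
      to the limit. \<open>N'\<close> controls the replacement of \<open>\<psi>\<close> by a
      finite-dimensional colouring.\<close>
    obtain N where N: "0 < N" "3 * real (card ?P) / real N \<le> \<epsilon> / 2" using N_exists[OF \<epsilon>2] by blast
    obtain N' where N': "0 < N'" "(real (card ?P) * real (card ?U)) / real N' \<le> \<epsilon> / 2" using N_exists[OF \<epsilon>2] by blast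
    obtain n0 where n0': "\<forall>n\<ge>n0. \<forall>m\<ge>n0. \<forall>p\<in>?P \<rightarrow>\<^sub>E {..N}.
      (\<exists>\<phi>. matches (\<rho> n) \<phi> (r, k, N, p)) \<longleftrightarrow> (\<exists>\<phi>. matches (\<rho> m) \<phi> (r, k, N, p))" using const[of r k N] by (rule exE)
    note n0 = n0'[rule_format]
    have res: "\<exists>\<phi>\<in>measurable (uniform_count_measure (X (\<rho> n))) (count_space {1..k}). tv_dist (local_statistics S (uniform_count_measure (X (\<rho> n))) (fs (\<rho> n)) \<phi> r) (local_statistics S M Z.act \<psi> r) \<le> \<epsilon>"
      if n: "n \<ge> n0" and \<psi>: "\<psi> \<in> measurable M (count_space {1..k})" for n \<psi>
    proof -
      obtain J \<psi>' where J: "finite J" "depends_on J \<psi>'" and ran: "\<And>z. \<psi>' z \<in> {1..k}"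
        and err: "measure M {z \<in> space M. \<psi> z \<noteq> \<psi>' z} < 1 / real N'"
        using Z.colouring_approximation[OF \<psi> _ k, of "1 / real N'"] N'(1) by auto
      have \<psi>'m: "\<psi>' \<in> measurable M (count_space {1..k})" by (rule Z.depends_on_measurable[OF J ran])
      have bad_sets: "{z \<in> space M. \<psi> z \<noteq> \<psi>' z} \<in> sets M"
        using L.countable_eq_sets(2)[of \<psi> \<psi>'] measurable_compose[OF \<psi>, of "\<lambda>x. x" "count_space UNIV"]
          measurable_compose[OF \<psi>'m, of "\<lambda>x. x" "count_space UNIV"] by simp
      \<comment> \<open>The two patterns of a point differ only if some element of the ball carries
        it into the set where the colourings differ, and the preimages of this set all have the same
        measure.\<close>
      have pe: "\<bar>stat r \<psi> q - stat r \<psi>' q\<bar> \<le> real (card ?U) / real N'" for q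
      proof -
        let ?D = "\<Union>g\<in>?U. (Z.act g -` {z \<in> space M. \<psi> z \<noteq> \<psi>' z} \<inter> space M)"
        let ?A = "\<lambda>\<psi>. {z \<in> space M. pattern ?U Z.act \<psi> z = q}"
        have gU: "g \<in> carrier G" if "g \<in> ?U" for g using that big_ball_carrier by blast
        have Ds: "Z.act g -` {z \<in> space M. \<psi> z \<noteq> \<psi>' z} \<inter> space M \<in> sets M" if "g \<in> ?U" for g
          using measurable_sets[OF L.f_measurable[OF gU[OF that]] bad_sets] .
        have fU: "finite ?U" by (rule finite_big_ball[OF S_fin])
        have D: "?D \<in> sets M" using Ds fU by (intro sets.finite_UN) auto
        have As: "?A \<psi> \<in> sets M" "?A \<psi>' \<in> sets M" using L.pattern_sets[OF big_ball_carrier fU] \<psi> \<psi>'m by blast+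
        have inD: "z \<in> ?D" if z: "z \<in> space M" "pattern ?U Z.act \<psi> z \<noteq> pattern ?U Z.act \<psi>' z" for z
        proof (rule ccontr)
          assume nD: "z \<notin> ?D"
          have "\<psi> (Z.act g z) = \<psi>' (Z.act g z)" if "g \<in> ?U" for g
          proof (rule ccontr)
            assume "\<psi> (Z.act g z) \<noteq> \<psi>' (Z.act g z)"
            then have "z \<in> Z.act g -` {z \<in> space M. \<psi> z \<noteq> \<psi>' z} \<inter> space M"
              using z(1) L.f_space[OF gU[OF that] z(1)] by simp
            then show False using nD that by blast
          qed
          from pattern_cong[of ?U \<psi> Z.act z \<psi>', OF this] z(2) show False by simp
        qed
        have sub1: "?A \<psi>1 \<subseteq> ?A \<psi>2 \<union> ?D" if "{\<psi>1, \<psi>2} = {\<psi>, \<psi>'}" for \<psi>1 \<psi>2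
        proof
          fix z assume z: "z \<in> ?A \<psi>1"
          show "z \<in> ?A \<psi>2 \<union> ?D"
          proof (cases "pattern ?U Z.act \<psi>1 z = pattern ?U Z.act \<psi>2 z")
            case False
            then have "pattern ?U Z.act \<psi> z \<noteq> pattern ?U Z.act \<psi>' z" using that by (auto simp: doubleton_eq_iff)
            from inD[OF _ this] z show ?thesis by simp
          qed (use z in simp)
        qed
        have sub: "?A \<psi> \<subseteq> ?A \<psi>' \<union> ?D" "?A \<psi>' \<subseteq> ?A \<psi> \<union> ?D"
          by (rule sub1, simp, rule sub1, rule insert_commute)
        have "measure M ?D \<le> (\<Sum>g\<in>?U. measure M (Z.act g -` {z \<in> space M. \<psi> z \<noteq> \<psi>' z} \<inter> space M))"
          using Ds fU by (intro L.finite_measure_subadditive_finite) auto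
        also have "\<dots> = (\<Sum>g\<in>?U. measure M {z \<in> space M. \<psi> z \<noteq> \<psi>' z})"
          by (rule sum.cong) (use L.measure_vimage[OF gU bad_sets] in auto)
        also have "\<dots> \<le> (\<Sum>g\<in>?U. 1 / real N')" using err by (intro sum_mono) simp
        finally have mD: "measure M ?D \<le> real (card ?U) / real N'" by simp
        have "measure M (?A \<psi>) \<le> measure M (?A \<psi>') + measure M ?D"
          using L.finite_measure_mono[OF sub(1) sets.Un[OF As(2) D]] measure_Un_le[OF As(2) D] by linarith
        moreover have "measure M (?A \<psi>') \<le> measure M (?A \<psi>) + measure M ?D"
          using L.finite_measure_mono[OF sub(2) sets.Un[OF As(1) D]] measure_Un_le[OF As(1) D] by linarith
        ultimately show ?thesis using mD unfolding stat_def by linarith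
      qed
      have "\<forall>\<^sub>F m in sequentially. \<forall>q\<in>?P. \<bar>freq (\<rho> m) r (\<lambda>x. \<psi>' (Z.prof (\<sigma> m) x)) q - stat r \<psi>' q\<bar> < 1 / real N"
      proof (rule eventually_ball_finite[OF finite_patterns[OF finite_big_ball[OF S_fin]]], rule ballI)
        fix q
        show "\<forall>\<^sub>F m in sequentially. \<bar>freq (\<rho> m) r (\<lambda>x. \<psi>' (Z.prof (\<sigma> m) x)) q - stat r \<psi>' q\<bar> < 1 / real N"
          using tendstoD[OF pl[OF J ran], of "1 / real N"] N(1) by (simp add: dist_real_def)
      qed
      then have "\<forall>\<^sub>F m in sequentially. m \<ge> n0 \<and> (\<forall>q\<in>?P. \<bar>freq (\<rho> m) r (\<lambda>x. \<psi>' (Z.prof (\<sigma> m) x)) q - stat r \<psi>' q\<bar> < 1 / real N)"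
        using eventually_ge_at_top[of n0] by eventually_elim blast
      then obtain m where m: "m \<ge> n0" "\<And>q. q \<in> ?P \<Longrightarrow> \<bar>freq (\<rho> m) r (\<lambda>x. \<psi>' (Z.prof (\<sigma> m) x)) q - stat r \<psi>' q\<bar> < 1 / real N"
        using eventually_happens'[OF sequentially_bot] by blast
      have "(\<lambda>x. \<psi>' (Z.prof (\<sigma> m) x)) \<in> X (\<rho> m) \<rightarrow> {1..k}" using ran by blast
      then obtain p where p: "p \<in> ?P \<rightarrow>\<^sub>E {..N}" "matches (\<rho> m) (\<lambda>x. \<psi>' (Z.prof (\<sigma> m) x)) (r, k, N, p)"
        by (rule matches_exists)
      \<comment> \<open>The stage \<open>m\<close> depends on \<open>\<psi>\<close>, but
        \<open>n0\<close> does not: the target hit at stage \<open>m\<close> is attained at every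
        \<open>n\<close> from \<open>n0\<close> on, which makes the estimate uniform in
        \<open>\<psi>\<close>.\<close>
      then obtain \<phi> where \<phi>: "matches (\<rho> n) \<phi> (r, k, N, p)" using n0[OF m(1) n p(1)] by blast
      have \<phi>r: "\<phi> \<in> X (\<rho> n) \<rightarrow> {1..k}" using \<phi> by (simp add: matches_def)
      have "tv_dist (local_statistics S (uniform_count_measure (X (\<rho> n))) (fs (\<rho> n)) \<phi> r) (local_statistics S M Z.act \<psi> r) \<le> \<epsilon>"
      proof -
        have cl: "\<bar>freq (\<rho> n) r \<phi> q - stat r \<psi> q\<bar> \<le> 3 / real N + real (card ?U) / real N'" if q: "q \<in> ?P" for q
        proof -
          have "3 / real N = 1 / real N + 1 / real N + 1 / real N" by simp
          then show ?thesis
            using matches_close[OF \<phi> q N(1)] matches_close[OF p(2) q N(1)] m(2)[OF q] pe[of q] by linarith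
        qed
        have dd: "real (card ?P) * (3 / real N + real (card ?U) / real N') \<le> \<epsilon>"
          using N(2) N'(2) by (simp add: algebra_simps)
        show ?thesis by (rule tv[OF \<phi>r \<psi> cl dd])
      qed
      then show ?thesis using \<phi>r meas_iff by blast
    qed
    show "\<forall>\<^sub>F n in sequentially. \<forall>\<psi>\<in>measurable M (count_space {1..k}).
        \<exists>\<phi>\<in>measurable (uniform_count_measure (X (\<rho> n))) (count_space {1..k}). tv_dist (local_statistics S (uniform_count_measure (X (\<rho> n))) (fs (\<rho> n)) \<phi> r) (local_statistics S M Z.act \<psi> r) \<le> \<epsilon>"
      unfolding eventually_sequentially by (intro exI[of _ n0] allI impI ballI res)
  qed
  then show ?thesis using \<rho> Z.sets_M Z.act_system by blast
qed

end

section \<open>Moving the limit to the real numbers\<close>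

lemma profile_injection: "\<exists>j :: profile \<Rightarrow> real. inj j"
proof -
  obtain b :: "nat set \<Rightarrow> real" where b: "bij_betw b UNIV UNIV"
    using nat_sets_eqpoll_reals unfolding eqpoll_def by blast
  \<comment> \<open>A profile is encoded by its graph, as a set of natural numbers, and there are as
    many such sets as real numbers.\<close>
  let ?c = "\<lambda>z :: profile. range (\<lambda>p. to_nat (p, of_discrete (z p)))"
  have "inj ?c"
  proof (rule injI, rule ext)
    fix z z' :: profile and p assume "?c z = ?c z'"
    then have "to_nat (p, of_discrete (z p)) \<in> ?c z'" by blast
    then obtain p' where "to_nat (p, of_discrete (z p)) = to_nat (p', of_discrete (z' p'))" by blast
    then have "(p, of_discrete (z p)) = (p', of_discrete (z' p'))" by (rule injD[OF inj_to_nat])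
    then have p: "p = p'" and e: "of_discrete (z p) = of_discrete (z' p')" unfolding prod.inject by (rule conjunct1, rule conjunct2)
    from e show "z p = z' p" unfolding of_discrete_inject p .
  qed
  then have "inj (b \<circ> ?c)" using bij_betw_imp_inj_on[OF b] by (intro inj_compose)
  then show ?thesis by blast
qed

text \<open>\<open>j\<close> is an arbitrary injection. Measurable sets, measure and action are
  carried over by it and need not relate to any structure of the target type;
  \<open>standard_borel\<close> asks for some suitable topology on the image.\<close>

locale transported_system = symmetric_system G M f S
  for G :: "('a, 'm) monoid_scheme" (structure) and M :: "'b :: polish_space measure" and f and S +
  fixes j :: "'b \<Rightarrow> 'c"
  assumes sets_borel: "sets M = sets borel" and inj_j: "inj j"
begin

abbreviation "N \<equiv> embed_measure M j"

definition h :: "'a \<Rightarrow> 'c \<Rightarrow> 'c" where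
  "h g = (\<lambda>x\<in>range j. j (f g (inv_into UNIV j x)))"

lemma space_UNIV: "space M = UNIV" using sets_eq_imp_space_eq[OF sets_borel] by simp

lemma space_N: "space N = range j" by (simp add: space_embed_measure space_UNIV)

lemma inv_j [simp]: "inv_into UNIV j (j z) = z" using inj_j by simp

lemma h_j [simp]: "h g (j z) = j (f g z)" by (simp add: h_def)

lemma j_measurable: "j \<in> measurable M N" by (rule measurable_embed_measure2[OF inj_j])

lemma N_distr: "N = distr M N j" by (rule embed_measure_eq_distr[OF inj_j])

lemma inv_measurable: "inv_into UNIV j \<in> measurable N M"
  by (rule measurable_embed_measure1) simp

lemma h_measurable: "g \<in> carrier G \<Longrightarrow> h g \<in> measurable N N"
  by (rule measurable_embed_measure1) (simp add: measurable_compose[OF f_measurable j_measurable])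

lemma h_pmp: "pmp_action G N h"
  unfolding pmp_action_def
proof (intro conjI ballI)
  show "prob_space N" using prob_space_distr[OF j_measurable] N_distr by simp
  show "group_action G (space N) h"
    unfolding space_N
  proof (rule group_actionI[OF grp.is_group])
    fix g g' x assume "g \<in> carrier G" "g' \<in> carrier G" "x \<in> range j"
    then show "h (g \<otimes> g') x = h g (h g' x)" by (auto simp: f_mult space_UNIV)
  next
    fix g show "h g \<in> extensional (range j)" by (simp add: h_def)
  qed (auto simp: f_one space_UNIV)
next
  fix g assume g: "g \<in> carrier G"
  show "h g \<in> measurable N N" by (rule h_measurable[OF g])
  have fg: "distr M M (f g) = M" using pmp g by (simp add: pmp_action_def)
  have "distr N N (h g) = distr (distr M N j) N (h g)" using N_distr by simp
  also have "\<dots> = distr M N (h g \<circ> j)" by (rule distr_distr[OF h_measurable[OF g] j_measurable])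
  also have "h g \<circ> j = j \<circ> f g" by (simp add: fun_eq_iff)
  also have "distr M N (j \<circ> f g) = distr (distr M M (f g)) N j"
    by (rule distr_distr[OF j_measurable f_measurable[OF g], symmetric])
  also have "\<dots> = N" unfolding fg using N_distr by simp
  finally show "distr N N (h g) = N" .
qed

lemma h_system: "symmetric_system G N h S"
proof (intro symmetric_system.intro fixed_point_measurable.intro pmp_system.intro h_pmp
      fixed_point_measurable_axioms.intro symmetric_generators_axioms)
  fix g assume g: "g \<in> carrier G"
  have "{x \<in> space N. h g x = x} = j ` {z \<in> space M. f g z = z}"
    using inj_j by (auto simp: space_N space_UNIV inj_eq)
  then show "{x \<in> space N. h g x = x} \<in> sets N" using in_sets_embed_measure[OF fixed_sets[OF g], of j] by simp
qed

text \<open>The topology pulled back along the inverse of \<open>j\<close> makes \<open>j\<close> a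
  homeomorphism onto its image.\<close>

lemma standard_borel_N: "standard_borel N"
proof -
  let ?T = "pullback_topology (range j) (inv_into UNIV j) (euclidean :: 'b topology)"
  have top: "topspace ?T = range j" by (simp add: topspace_pullback_topology)
  have op: "openin ?T U \<longleftrightarrow> (\<exists>V. open V \<and> U = inv_into UNIV j -` V \<inter> range j)" for U
    by (simp add: openin_pullback_topology)
  have hm: "homeomorphic_maps (euclidean :: 'b topology) ?T j (inv_into UNIV j)"
    unfolding homeomorphic_maps_def
  proof (intro conjI ballI)
    show "continuous_map (euclidean :: 'b topology) ?T j"
      unfolding continuous_map top
    proof (intro conjI allI impI)
      fix U assume "openin ?T U"
      then obtain V where V: "open V" "U = inv_into UNIV j -` V \<inter> range j" using op by blast
      then have "{x \<in> topspace (euclidean :: 'b topology). j x \<in> U} = V" by auto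
      then show "openin (euclidean :: 'b topology) {x \<in> topspace euclidean. j x \<in> U}" using V(1) by simp
    qed auto
    show "continuous_map ?T (euclidean :: 'b topology) (inv_into UNIV j)"
      unfolding continuous_map top
    proof (intro conjI allI impI)
      fix V :: "'b set" assume "openin euclidean V"
      then show "openin ?T {x \<in> range j. inv_into UNIV j x \<in> V}"
        unfolding op by (intro exI[of _ V]) auto
    qed auto
  qed (auto simp: top)
  then have hs: "(euclidean :: 'b topology) homeomorphic_space ?T" unfolding homeomorphic_space_def by blast
  have "completely_metrizable_space ?T"
    using homeomorphic_completely_metrizable_space[OF hs] completely_metrizable_space_euclidean by blast
  moreover have "second_countable (euclidean :: 'b topology)"
  proof -
    obtain B :: "'b set set" where B: "countable B" "topological_basis B" using ex_countable_basis by blast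
    show ?thesis unfolding second_countable_def open_openin[symmetric]
    proof (intro exI[of _ B] conjI ballI allI impI)
      show "open V" if "V \<in> B" for V using topological_basis_open[OF B(2) that] .
      show "\<exists>V\<in>B. x \<in> V \<and> V \<subseteq> U" if "open U \<and> x \<in> U" for U x
        using topological_basisE[OF B(2), of U x] that by metis
    qed (rule B(1))
  qed
  then have "second_countable ?T" using homeomorphic_space_second_countability[OF hs] by blast
  moreover have "sets N = sigma_sets (space N) {U. openin ?T U}"
  proof -
    have j_im: "j ` A = inv_into UNIV j -` A \<inter> range j" for A by auto
    have b: "sets M = sigma_sets UNIV {V. open V}" unfolding sets_borel borel_def by (simp add: sets_measure_of)
    have "sets N = {inv_into UNIV j -` A \<inter> range j |A. A \<in> sigma_sets UNIV {V. open V}}"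
      unfolding sets_embed_measure[OF inj_j] b unfolding j_im[symmetric] ..
    also have "\<dots> = sigma_sets (range j) {inv_into UNIV j -` A \<inter> range j |A. A \<in> {V. open V}}"
      by (rule sigma_sets_vimage_commute) simp
    also have "{inv_into UNIV j -` A \<inter> range j |A. A \<in> {V. open V}} = {U. openin ?T U}"
      unfolding op by auto
    finally show ?thesis unfolding space_N .
  qed
  ultimately show ?thesis unfolding standard_borel_def using top space_N by (intro exI[of _ ?T]) simp
qed

text \<open>Corresponding points have the same stabilizers and colours, hence the same ball
  types.\<close>

lemma local_statistics_transport:
  assumes "\<phi> \<in> measurable N (count_space {1..k})"
  shows "local_statistics S N h \<phi> r = local_statistics S M f (\<phi> \<circ> j) r"
proof -
  interpret H: symmetric_system G N h S by (rule h_system)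
  have "ball_type S (space N) h \<phi> r (j z) = ball_type S (space M) f (\<phi> \<circ> j) r z" for z
    by (rule ball_type_eqI[OF H.pmp_system_axioms pmp_system_axioms symmetric_generators_axioms])
      (auto simp: space_N space_UNIV inj_eq[OF inj_j])
  then have eq: "ball_type S (space N) h \<phi> r \<circ> j = ball_type S (space M) f (\<phi> \<circ> j) r" by (simp add: fun_eq_iff)
  have "local_statistics S N h \<phi> r = distr (distr M N j) (count_space UNIV) (ball_type S (space N) h \<phi> r)"
    unfolding local_statistics_def N_distr[symmetric] ..
  also have "\<dots> = distr M (count_space UNIV) (ball_type S (space N) h \<phi> r \<circ> j)"
    by (rule distr_distr[OF H.ball_type_measurable[OF assms] j_measurable])
  finally show ?thesis unfolding eq local_statistics_def .
qed

lemma colour_statistics_transport: "colour_statistics S N h k r = colour_statistics S M f k r"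
proof -
  have "(\<exists>\<phi>\<in>measurable N (count_space {1..k}). tv_dist P (local_statistics S N h \<phi> r) < \<epsilon>)
      \<longleftrightarrow> (\<exists>\<phi>\<in>measurable M (count_space {1..k}). tv_dist P (local_statistics S M f \<phi> r) < \<epsilon>)" for P \<epsilon>
  proof
    assume "\<exists>\<phi>\<in>measurable N (count_space {1..k}). tv_dist P (local_statistics S N h \<phi> r) < \<epsilon>"
    then obtain \<phi> where \<phi>: "\<phi> \<in> measurable N (count_space {1..k})" "tv_dist P (local_statistics S N h \<phi> r) < \<epsilon>" by blast
    then show "\<exists>\<phi>\<in>measurable M (count_space {1..k}). tv_dist P (local_statistics S M f \<phi> r) < \<epsilon>"
      using local_statistics_transport[OF \<phi>(1)] measurable_comp[OF j_measurable \<phi>(1)] by (intro bexI[of _ "\<phi> \<circ> j"]) simp_all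
  next
    assume "\<exists>\<phi>\<in>measurable M (count_space {1..k}). tv_dist P (local_statistics S M f \<phi> r) < \<epsilon>"
    then obtain \<phi> where \<phi>: "\<phi> \<in> measurable M (count_space {1..k})" "tv_dist P (local_statistics S M f \<phi> r) < \<epsilon>" by blast
    have m: "\<phi> \<circ> inv_into UNIV j \<in> measurable N (count_space {1..k})" by (rule measurable_comp[OF inv_measurable \<phi>(1)])
    have "\<phi> \<circ> inv_into UNIV j \<circ> j = \<phi>" by (simp add: fun_eq_iff)
    then show "\<exists>\<phi>\<in>measurable N (count_space {1..k}). tv_dist P (local_statistics S N h \<phi> r) < \<epsilon>"
      using local_statistics_transport[OF m] \<phi>(2) m by (intro bexI[of _ "\<phi> \<circ> inv_into UNIV j"]) simp_all
  qed
  then show ?thesis unfolding colour_statistics_def by (simp only:)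
qed

lemma weakly_converges_transport: "weakly_converges S Ms fs M f \<Longrightarrow> weakly_converges S Ms fs N h"
  unfolding weakly_converges_def colour_statistics_transport .

end

theorem (in finite_systems) real_weak_limit_exists:
  "\<exists>(\<rho> :: nat \<Rightarrow> nat) (M :: real measure) f. strict_mono \<rho> \<and> standard_borel M \<and> symmetric_system G M f S \<and>
    weakly_converges S (\<lambda>n. uniform_count_measure (X (\<rho> n))) (\<lambda>n. fs (\<rho> n)) M f"
proof -
  obtain \<rho> :: "nat \<Rightarrow> nat" and M :: "profile measure" and f where \<rho>: "strict_mono \<rho>" and M: "sets M = sets borel"
    and sys': "symmetric_system G M f S"
    and conv: "weakly_converges S (\<lambda>n. uniform_count_measure (X (\<rho> n))) (\<lambda>n. fs (\<rho> n)) M f"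
    using weak_limit_exists by blast
  obtain j :: "profile \<Rightarrow> real" where "inj j" using profile_injection by blast
  then interpret T: transported_system G M f S j
    using sys' M by (intro transported_system.intro transported_system_axioms.intro)
  show ?thesis using \<rho> T.standard_borel_N T.h_system T.weakly_converges_transport[OF conv] by blast
qed

section \<open>Coset actions\<close>

lemma pmp_system_uniform_count:
  assumes "finite X" "X \<noteq> {}" and act: "group_action G X f"
  shows "pmp_system G (uniform_count_measure X) f"
proof (rule pmp_system.intro)
  interpret group_action G X f by (rule act)
  show "pmp_action G (uniform_count_measure X) f"
    unfolding pmp_action_def space_uniform_count_measure
  proof (intro conjI ballI)
    show "prob_space (uniform_count_measure X)" using assms(1,2) by (rule prob_space_uniform_count_measure)
    show "group_action G X f" by (rule act)
  next
    fix g assume g: "g \<in> carrier G"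
    have b: "bij_betw (f g) X X" using bij_prop0[OF g] by (simp add: Bij_def)
    then have maps: "f g ` X = X" and inj: "inj_on (f g) X" by (auto simp: bij_betw_def)
    show m: "f g \<in> measurable (uniform_count_measure X) (uniform_count_measure X)"
      using maps by (auto simp: measurable_def space_uniform_count_measure sets_uniform_count_measure)
    show "distr (uniform_count_measure X) (uniform_count_measure X) (f g) = uniform_count_measure X"
    proof (rule measure_eqI)
      fix A assume "A \<in> sets (distr (uniform_count_measure X) (uniform_count_measure X) (f g))"
      then have A: "A \<subseteq> X" by (simp add: sets_uniform_count_measure)
      have "f g ` (f g -` A \<inter> X) = A \<inter> f g ` X" by blast
      also have "\<dots> = A" unfolding maps by (rule Int_absorb2[OF A])
      finally have "card (f g -` A \<inter> X) = card A"
        using card_image[OF inj_on_subset[OF inj Int_lower2], of "f g -` A"] by (simp only:)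
      then show "emeasure (distr (uniform_count_measure X) (uniform_count_measure X) (f g)) A
          = emeasure (uniform_count_measure X) A"
        using A assms(1) by (simp add: emeasure_distr[OF m] sets_uniform_count_measure
            space_uniform_count_measure emeasure_uniform_count_measure)
    qed simp
  qed
qed

lemma coset_system:
  assumes "group G" "finite_index G H"
  shows "lcosets\<^bsub>G\<^esub> H \<noteq> {}" "pmp_system G (uniform_count_measure (lcosets\<^bsub>G\<^esub> H)) (coset_action G H)"
proof -
  interpret group G by fact
  have H: "subgroup H G" and fin: "finite (lcosets\<^bsub>G\<^esub> H)" using assms(2) by (auto simp: finite_index_def)
  have sub: "x \<subseteq> carrier G" if "x \<in> lcosets\<^bsub>G\<^esub> H" for x
    using subgroup.lcosets_carrier[OF H is_group that] .
  have mem: "g <#\<^bsub>G\<^esub> x \<in> lcosets\<^bsub>G\<^esub> H" if "g \<in> carrier G" "x \<in> lcosets\<^bsub>G\<^esub> H" for g x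
    using that subgroup.subset[OF H] by (auto simp: LCOSETS_def lcos_m_assoc)
  show ne: "lcosets\<^bsub>G\<^esub> H \<noteq> {}" by (auto simp: LCOSETS_def)
  have "group_action G (lcosets\<^bsub>G\<^esub> H) (coset_action G H)"
    by (rule group_actionI[OF is_group]) (auto simp: coset_action_def mem sub lcos_mult_one lcos_m_assoc)
  then show "pmp_system G (uniform_count_measure (lcosets\<^bsub>G\<^esub> H)) (coset_action G H)"
    by (rule pmp_system_uniform_count[OF fin ne])
qed

lemma (in finite_systems) uniform_system: "symmetric_system G (uniform_count_measure (X n)) (fs n) S"
  by (intro symmetric_system.intro fixed_point_measurable.intro fixed_point_measurable_axioms.intro
      sys symmetric_generators_axioms) (auto simp: space_uniform_count_measure sets_uniform_count_measure)

text \<open>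
  A colour pattern that fails on a set of small measure in the limit can only fail for few points of
  the finite systems: it is tested on the ball types \<^emph>\<open>satisfying\<close> it, because balls of the finite
  systems need not occur in the limit at all.
\<close>

theorem (in finite_systems) small_almost_invariant_partitions:
  fixes M :: "'y measure" and t :: real
  assumes M: "symmetric_system G M f S"
    and conv: "weakly_converges S (\<lambda>n. uniform_count_measure (X n)) fs M f"
    and no: "\<not> (\<exists>Y. invariant_set G M f Y \<and> 0 < measure M Y \<and>
      ergodic G (normalized_restriction M Y) (restrict_action f Y) \<and>
      strongly_ergodic G (normalized_restriction M Y) (restrict_action f Y))"
    and F: "finite F" "F \<subseteq> carrier G" and t: "0 < t"
  shows "\<exists>K. \<forall>\<^sub>F n in sequentially. \<exists>\<phi> :: 'x \<Rightarrow> nat. (\<forall>x\<in>X n. \<phi> x \<le> K) \<and>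
    (\<forall>i. card {x \<in> X n. \<phi> x = i} \<le> 2 * t * card (X n)) \<and>
    (\<forall>g\<in>F. card {x \<in> X n. \<phi> (fs n g x) \<noteq> \<phi> x} \<le> 2 * t * card (X n))"
proof -
  interpret L: symmetric_system G M f S by (rule M)
  interpret P: pmp_generated G M f S
    by (intro pmp_generated.intro L.pmp_system_axioms pmp_generated_axioms.intro S_fin S_carrier S_gen)
  obtain \<phi>0 where \<phi>0: "L.colouring \<phi>0" and small: "\<And>i. measure M {x \<in> space M. \<phi>0 x = i} \<le> t"
    and inv: "\<And>g. g \<in> F \<Longrightarrow> L.discrepancy g \<phi>0 \<le> t"
    using P.small_almost_invariant_colouring[OF no F t t] by blast
  have \<phi>0m: "\<phi>0 \<in> measurable M (count_space UNIV)" using \<phi>0 by (simp add: L.colouring_def)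
  obtain K where K: "\<And>x. x \<in> space M \<Longrightarrow> \<phi>0 x < K" using \<phi>0 by (auto simp: L.colouring_def)
  have "1 \<le> K" using K L.not_empty by fastforce
  \<comment> \<open>The colours are shifted by one in order to lie in \<open>{1..K}\<close>.\<close>
  define \<psi> where "\<psi> = Suc \<circ> \<phi>0"
  have \<psi>m: "\<psi> \<in> measurable M (count_space {1..K})"
  proof (rule measurableI)
    fix A
    have "\<psi> -` A \<inter> space M = \<phi>0 -` (Suc -` A) \<inter> space M" by (auto simp: \<psi>_def)
    then show "\<psi> -` A \<inter> space M \<in> sets M" using measurable_sets[OF \<phi>0m, of "Suc -` A"] by simp
  qed (auto simp: \<psi>_def Suc_le_eq K)
  \<comment> \<open>The balls must be large enough to show what the elements of \<open>F\<close> do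
    to the colour of the centre.\<close>
  obtain r where r: "F \<subseteq> word_ball G S r" using finite_subset_word_ball[OF F] by blast
  have one: "\<one> \<in> word_ball G S r" using word_ball_mono[of 0 r G S] by auto
  show ?thesis
  proof (intro exI[of _ K], rule eventually_mono[OF weakly_convergesD[OF uniform_system M conv \<open>1 \<le> K\<close> t \<psi>m, of r]])
    fix n
    let ?N = "uniform_count_measure (X n)"
    interpret N: symmetric_system G ?N "fs n" S by (rule uniform_system)
    have sp: "space ?N = X n" by (rule space_uniform_count_measure)
    assume "\<exists>\<phi>\<in>measurable ?N (count_space {1..K}).
        tv_dist (local_statistics S ?N (fs n) \<phi> r) (local_statistics S M f \<psi> r) < t"
    then obtain \<phi> where \<phi>: "\<phi> \<in> measurable ?N (count_space {1..K})"
      and tv: "tv_dist (local_statistics S ?N (fs n) \<phi> r) (local_statistics S M f \<psi> r) < t" by blast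
    let ?T = "ball_type S (space ?N) (fs n) \<phi> r" and ?U = "ball_type S (space M) f \<psi> r"
    \<comment> \<open>A transfer principle: \<open>Q\<close> fails in the limit with measure at most
      \<open>t\<close>, the total variation distance adds another \<open>t\<close>, and equal ball
      types carry \<open>Q\<close> over to \<open>R\<close>.\<close>
    have few: "card {x \<in> X n. \<not> R x} \<le> 2 * t * card (X n)"
      if Q: "{z \<in> space M. \<not> Q z} \<in> sets M" "measure M {z \<in> space M. \<not> Q z} \<le> t"
        and QR: "\<And>x z. x \<in> X n \<Longrightarrow> z \<in> space M \<Longrightarrow> ?T x = ?U z \<Longrightarrow> Q z \<Longrightarrow> R x" for Q R
    proof -
      define D where "D = ?U ` {z \<in> space M. Q z}"
      have UD: "{z \<in> space M. ?U z \<in> D} \<in> sets M"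
        using measurable_sets[OF L.ball_type_measurable[OF \<psi>m], of D r] by (simp add: vimage_def Int_def conj_commute)
      have "measure M (space M - {z \<in> space M. ?U z \<in> D}) \<le> measure M {z \<in> space M. \<not> Q z}"
        by (rule L.finite_measure_mono[OF _ Q(1)]) (auto simp: D_def)
      then have "1 - measure M {z \<in> space M. ?U z \<in> D} \<le> t"
        using Q(2) L.prob_compl[OF UD] by linarith
      moreover have "\<bar>measure (local_statistics S ?N (fs n) \<phi> r) D - measure (local_statistics S M f \<psi> r) D\<bar> < t"
        using tv_dist_ge[OF N.local_statistics_prob[OF \<phi>] L.local_statistics_prob[OF \<psi>m], of D r r] tv
        by (simp add: local_statistics_def)
      ultimately have "1 - 2 * t \<le> measure ?N {x \<in> X n. ?T x \<in> D}"
        unfolding L.local_statistics_measure[OF \<psi>m] N.local_statistics_measure[OF \<phi>] sp by linarith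
      also have "\<dots> \<le> measure ?N {x \<in> X n. R x}"
        by (rule N.finite_measure_mono) (auto simp: D_def sets_uniform_count_measure intro: QR)
      also have "\<dots> = 1 - measure ?N (X n - {x \<in> X n. R x})"
        using N.prob_compl[of "{x \<in> X n. R x}"] by (simp add: sp sets_uniform_count_measure)
      also have "X n - {x \<in> X n. R x} = {x \<in> X n. \<not> R x}" by blast
      finally have "card {x \<in> X n. \<not> R x} / card (X n) \<le> 2 * t"
        using X_fin[of n] by (simp add: measure_uniform_count_measure)
      moreover have "0 < card (X n)" using X_fin[of n] N.not_empty by (simp add: sp card_gt_0_iff)
      ultimately show ?thesis by (simp add: pos_divide_le_eq)
    qed
    have same: "\<phi> (fs n g x) = \<psi> (f g z)"
      if "x \<in> X n" "z \<in> space M" "?T x = ?U z" "g \<in> word_ball G S r" for x z g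
      by (rule ball_type_colour[OF N.pmp_system_axioms L.pmp_system_axioms symmetric_generators_axioms])
        (use that in \<open>simp_all add: sp\<close>)
    have same': "\<phi> x = \<psi> z" if "x \<in> X n" "z \<in> space M" "?T x = ?U z" for x z
      using same[OF that one] that N.f_one[of x] L.f_one[of z] by (simp add: sp)
    have "\<phi> x \<le> K" if "x \<in> X n" for x using measurable_space[OF \<phi>, of x] that by (simp add: sp)
    moreover have "card {x \<in> X n. \<phi> x = i} \<le> 2 * t * card (X n)" for i
    proof -
      have "{z \<in> space M. \<psi> z = i} = \<phi>0 -` (Suc -` {i}) \<inter> space M" by (auto simp: \<psi>_def)
      then have s: "{z \<in> space M. \<psi> z = i} \<in> sets M" using measurable_sets[OF \<phi>0m, of "Suc -` {i}"] by simp
      have "measure M {z \<in> space M. \<psi> z = i} \<le> t"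
      proof (cases i)
        case 0
        then show ?thesis using t by (simp add: \<psi>_def)
      next
        case (Suc j)
        then show ?thesis using small[of j] by (simp add: \<psi>_def)
      qed
      with s show ?thesis using few[of "\<lambda>z. \<psi> z \<noteq> i" "\<lambda>x. \<phi> x \<noteq> i"] same' by simp
    qed
    moreover have "card {x \<in> X n. \<phi> (fs n g x) \<noteq> \<phi> x} \<le> 2 * t * card (X n)" if g: "g \<in> F" for g
    proof (rule few[of "\<lambda>z. \<psi> (f g z) = \<psi> z"])
      have gc: "g \<in> carrier G" using g F(2) by blast
      have "{z \<in> space M. \<psi> (f g z) \<noteq> \<psi> z} = {z \<in> space M. \<phi>0 (f g z) \<noteq> \<phi>0 z}" by (simp add: \<psi>_def)
      then show "{z \<in> space M. \<psi> (f g z) \<noteq> \<psi> z} \<in> sets M" "measure M {z \<in> space M. \<psi> (f g z) \<noteq> \<psi> z} \<le> t"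
        using L.countable_eq_sets(2)[OF measurable_compose[OF L.f_measurable[OF gc] \<phi>0m] \<phi>0m] inv[OF g]
        by (simp_all add: L.discrepancy_def)
    next
      fix x z assume "x \<in> X n" "z \<in> space M" "?T x = ?U z" "\<psi> (f g z) = \<psi> z"
      then show "\<phi> (fs n g x) = \<phi> x" using same[of x z g] same'[of x z] g r by auto
    qed
    ultimately show "\<exists>\<phi>. (\<forall>x\<in>X n. \<phi> x \<le> K) \<and> (\<forall>i. card {x \<in> X n. \<phi> x = i} \<le> 2 * t * card (X n)) \<and>
        (\<forall>g\<in>F. card {x \<in> X n. \<phi> (fs n g x) \<noteq> \<phi> x} \<le> 2 * t * card (X n))" by blast
  qed
qed

theorem theorem7:
  fixes \<Gamma> :: "('a, 'm) monoid_scheme" and S :: "'a set" and \<Gamma>n :: "nat \<Rightarrow> 'a set"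
  assumes "group \<Gamma>"
    and "finitely_presented \<Gamma>"
    and "finite S" and "S \<subseteq> carrier \<Gamma>" and "\<forall>s\<in>S. inv\<^bsub>\<Gamma>\<^esub> s \<in> S"
    and "generate \<Gamma> S = carrier \<Gamma>"
    and "\<forall>n. finite_index \<Gamma> (\<Gamma>n n)"
  shows "\<not> dispersive \<Gamma> S \<Gamma>n
       \<or> has_rank_gradient \<Gamma> \<Gamma>n 0
       \<or> (\<exists>n. nontrivial_amalgamated_product (\<Gamma>\<lparr>carrier := \<Gamma>n n\<rparr>))"
proof (rule ccontr)
  assume neg: "\<not> ?thesis"
  let ?d = "\<lambda>n. min_generators \<Gamma> (\<Gamma>n n)" and ?c = "\<lambda>n. card (lcosets\<^bsub>\<Gamma>\<^esub> (\<Gamma>n n))"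
  interpret G: symmetric_generators \<Gamma> S
    using assms by (intro symmetric_generators.intro symmetric_generators_axioms.intro) auto
  have fi: "finite_index \<Gamma> (\<Gamma>n n)" for n using assms(7) by blast
  have fin: "finite (lcosets\<^bsub>\<Gamma>\<^esub> (\<Gamma>n n))" for n using fi[of n] by (simp add: finite_index_def)
  have pos: "0 < ?c n" for n using fin[of n] coset_system(1)[OF assms(1) fi] by (simp add: card_gt_0_iff)
  \<comment> \<open>Failure of convergence to 0 gives a fixed \<open>\<epsilon>\<close> that is
    reached infinitely often. The absolute value stays, as a trivial subgroup has 0 generators and a
    negative quotient.\<close>
  obtain \<epsilon> where \<epsilon>: "0 < \<epsilon>" and "\<exists>\<^sub>F n in sequentially. \<epsilon> \<le> \<bar>(real (?d n) - 1) / real (?c n)\<bar>"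
    using neg unfolding has_rank_gradient_def tendsto_iff
    by (auto simp: dist_real_def not_eventually not_less)
  then have "infinite {n. \<epsilon> \<le> \<bar>(real (?d n) - 1) / real (?c n)\<bar>}"
    by (simp add: frequently_cofinite flip: cofinite_eq_sequentially)
  then obtain \<alpha> :: "nat \<Rightarrow> nat" where \<alpha>: "strict_mono \<alpha>"
    and large: "\<And>n. \<epsilon> \<le> \<bar>(real (?d (\<alpha> n)) - 1) / real (?c (\<alpha> n))\<bar>"
    using infinite_enumerate by blast
  interpret A: finite_systems \<Gamma> S "\<lambda>n. lcosets\<^bsub>\<Gamma>\<^esub> (\<Gamma>n (\<alpha> n))" "\<lambda>n. coset_action \<Gamma> (\<Gamma>n (\<alpha> n))"
    by (intro finite_systems.intro finite_systems_axioms.intro G.symmetric_generators_axioms fin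
        coset_system(2)[OF assms(1) fi])
  obtain \<rho> :: "nat \<Rightarrow> nat" and M :: "real measure" and f where \<rho>: "strict_mono \<rho>" and sb: "standard_borel M"
    and M: "symmetric_system \<Gamma> M f S"
    and conv: "weakly_converges S (\<lambda>n. uniform_count_measure (lcosets\<^bsub>\<Gamma>\<^esub> (\<Gamma>n (\<alpha> (\<rho> n)))))
      (\<lambda>n. coset_action \<Gamma> (\<Gamma>n (\<alpha> (\<rho> n)))) M f"
    using A.real_weak_limit_exists by blast
  define \<sigma> where "\<sigma> = \<alpha> \<circ> \<rho>"
  have "strict_mono \<sigma>" unfolding \<sigma>_def by (rule strict_mono_o[OF \<alpha> \<rho>])
  let ?X = "\<lambda>n. lcosets\<^bsub>\<Gamma>\<^esub> (\<Gamma>n (\<sigma> n))" and ?f = "\<lambda>n. coset_action \<Gamma> (\<Gamma>n (\<sigma> n))"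
  interpret B: finite_systems \<Gamma> S ?X ?f
    by (intro finite_systems.intro finite_systems_axioms.intro G.symmetric_generators_axioms fin
        coset_system(2)[OF assms(1) fi])
  interpret L: symmetric_system \<Gamma> M f S by (rule M)
  have conv': "weakly_converges S (\<lambda>n. uniform_count_measure (?X n)) ?f M f"
    using conv by (simp add: \<sigma>_def)
  have no: "\<not> (\<exists>Y. invariant_set \<Gamma> M f Y \<and> 0 < measure M Y \<and>
      ergodic \<Gamma> (normalized_restriction M Y) (restrict_action f Y) \<and>
      strongly_ergodic \<Gamma> (normalized_restriction M Y) (restrict_action f Y))"
  proof -
    have "dispersive \<Gamma> S \<Gamma>n" using neg by blast
    note d = this[unfolded dispersive_def, THEN spec, THEN spec, THEN spec, THEN mp]
    show ?thesis
      by (rule d[OF conjI[OF \<open>strict_mono \<sigma>\<close> conjI[OF sb conjI[OF L.pmp conv'[folded coset_space_def]]]]])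
  qed
  obtain m :: nat and F where F: "finite F" "F \<subseteq> carrier \<Gamma>" and bound:
    "\<And>H k part. finite_index \<Gamma> H \<Longrightarrow> (\<And>x. x \<in> lcosets\<^bsub>\<Gamma>\<^esub> H \<Longrightarrow> part x < k) \<Longrightarrow>
       \<not> nontrivial_amalgamated_product (\<Gamma>\<lparr>carrier := H\<rparr>) \<Longrightarrow>
       \<exists>j<k. min_generators \<Gamma> H \<le> m * (card {x \<in> lcosets\<^bsub>\<Gamma>\<^esub> H. part x = j}
           + card {x \<in> lcosets\<^bsub>\<Gamma>\<^esub> H. \<exists>g\<in>F. part (l_coset \<Gamma> g x) \<noteq> part x}) + k"
    by (rule finitely_presented_few_generators[OF assms(1,2)]) blast
  \<comment> \<open>Counts \<open>m\<close> generators per vertex, for one colour class and for the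
    points moved to another colour by an element of \<open>F\<close>; the added ones keep
    \<open>p\<close> positive. With \<open>t\<close> below, both contributions together cost at most
    half of \<open>\<epsilon>\<close> per coset.\<close>
  define p where "p = real (m + 1) * real (card F + 1)"
  have p: "0 < p" unfolding p_def by (intro mult_pos_pos) simp_all
  define t where "t = \<epsilon> / (4 * p)"
  have t: "0 < t" using \<epsilon> p by (simp add: t_def)
  have mt: "real m * (2 * t + real (card F) * (2 * t)) \<le> \<epsilon> / 2"
  proof -
    have "real m * (2 * t + real (card F) * (2 * t)) = (real m * real (card F + 1)) * (2 * t)"
      by (simp add: algebra_simps)
    also have "\<dots> \<le> p * (2 * t)" unfolding p_def using t by (intro mult_right_mono) auto
    also have "\<dots> = \<epsilon> / 2" using p by (simp add: t_def)
    finally show ?thesis .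
  qed
  obtain K where K: "\<forall>\<^sub>F n in sequentially. \<exists>\<phi> :: 'a set \<Rightarrow> nat. (\<forall>x\<in>?X n. \<phi> x \<le> K) \<and>
    (\<forall>i. card {x \<in> ?X n. \<phi> x = i} \<le> 2 * t * card (?X n)) \<and>
    (\<forall>g\<in>F. card {x \<in> ?X n. \<phi> (?f n g x) \<noteq> \<phi> x} \<le> 2 * t * card (?X n))"
    using B.small_almost_invariant_partitions[OF M conv' no F t] by blast
  \<comment> \<open>Solves \<open>\<epsilon> * c \<le> \<epsilon> / 2 * c + K + 2\<close> for the
    index \<open>c\<close>.\<close>
  define C where "C = 2 * (real K + 2) / \<epsilon>"
  have bounded: "\<forall>\<^sub>F n in sequentially. real (?c (\<sigma> n)) \<le> C"
    using K
  proof eventually_elim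
    case (elim n)
    let ?c' = "real (card (?X n))"
    obtain \<phi> :: "'a set \<Rightarrow> nat" where \<phi>: "\<And>x. x \<in> ?X n \<Longrightarrow> \<phi> x \<le> K"
      "\<And>i. card {x \<in> ?X n. \<phi> x = i} \<le> 2 * t * ?c'"
      "\<And>g. g \<in> F \<Longrightarrow> card {x \<in> ?X n. \<phi> (?f n g x) \<noteq> \<phi> x} \<le> 2 * t * ?c'" using elim by blast
    let ?D = "{x \<in> ?X n. \<exists>g\<in>F. \<phi> (l_coset \<Gamma> g x) \<noteq> \<phi> x}"
    have "?D = (\<Union>g\<in>F. {x \<in> ?X n. \<phi> (?f n g x) \<noteq> \<phi> x})" by (auto simp: coset_action_def)
    then have "card ?D \<le> (\<Sum>g\<in>F. card {x \<in> ?X n. \<phi> (?f n g x) \<noteq> \<phi> x})"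
      using card_UN_le[OF F(1)] by simp
    then have "real (card ?D) \<le> (\<Sum>g\<in>F. real (card {x \<in> ?X n. \<phi> (?f n g x) \<noteq> \<phi> x}))"
      using of_nat_mono by fastforce
    also have "\<dots> \<le> real (card F) * (2 * t * ?c')" using \<phi>(3) by (intro sum_bounded_above)
    finally have D: "real (card ?D) \<le> real (card F) * (2 * t * ?c')" .
    have "\<exists>j<Suc K. ?d (\<sigma> n) \<le> m * (card {x \<in> ?X n. \<phi> x = j} + card ?D) + Suc K"
      by (rule bound[OF fi]) (use \<phi>(1) neg in \<open>auto simp: less_Suc_eq_le\<close>)
    then obtain j where "?d (\<sigma> n) \<le> m * (card {x \<in> ?X n. \<phi> x = j} + card ?D) + Suc K" by blast
    then have "real (?d (\<sigma> n)) \<le> real (m * (card {x \<in> ?X n. \<phi> x = j} + card ?D) + Suc K)" by (rule of_nat_mono)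
    also have "\<dots> = real m * (real (card {x \<in> ?X n. \<phi> x = j}) + real (card ?D)) + real K + 1" by simp
    also have "\<dots> \<le> real m * (2 * t * ?c' + real (card F) * (2 * t * ?c')) + real K + 1"
      by (intro add_right_mono mult_left_mono add_mono \<phi>(2) D) simp
    also have "\<dots> = (real m * (2 * t + real (card F) * (2 * t))) * ?c' + real K + 1" by (simp add: algebra_simps)
    also have "\<dots> \<le> \<epsilon> / 2 * ?c' + real K + 1" by (intro add_right_mono mult_right_mono mt) simp
    finally have d: "real (?d (\<sigma> n)) \<le> \<epsilon> / 2 * ?c' + real K + 1" .
    have "\<epsilon> \<le> \<bar>real (?d (\<sigma> n)) - 1\<bar> / ?c'" using large[of "\<rho> n"] by (simp add: \<sigma>_def)
    then have "\<epsilon> * ?c' \<le> \<bar>real (?d (\<sigma> n)) - 1\<bar>" using pos[of "\<sigma> n"] by (simp add: pos_le_divide_eq)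
    also have "\<dots> \<le> real (?d (\<sigma> n)) + 1" by (simp add: abs_le_iff)
    also have "\<dots> \<le> \<epsilon> / 2 * ?c' + real K + 2" using d by simp
    finally have "\<epsilon> * ?c' \<le> 2 * (real K + 2)" by simp
    then show ?case using \<epsilon> by (simp add: C_def pos_le_divide_eq mult.commute)
  qed
  \<comment> \<open>So small that a colour class has fewer than one element once the index is at
    most \<open>C\<close>.\<close>
  define u where "u = 1 / (4 * (C + 1))"
  have "0 \<le> C" using \<epsilon> by (simp add: C_def)
  then have u: "0 < u" "2 * u * C < 1" by (simp_all add: u_def field_simps)
  have "\<forall>\<^sub>F n in sequentially. \<exists>\<phi> :: 'a set \<Rightarrow> nat. \<forall>i. card {x \<in> ?X n. \<phi> x = i} \<le> 2 * u * card (?X n)"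
  proof -
    obtain K' where "\<forall>\<^sub>F n in sequentially. \<exists>\<phi> :: 'a set \<Rightarrow> nat. (\<forall>x\<in>?X n. \<phi> x \<le> K') \<and>
      (\<forall>i. card {x \<in> ?X n. \<phi> x = i} \<le> 2 * u * card (?X n)) \<and>
      (\<forall>g\<in>F. card {x \<in> ?X n. \<phi> (?f n g x) \<noteq> \<phi> x} \<le> 2 * u * card (?X n))"
      using B.small_almost_invariant_partitions[OF M conv' no F u(1)] by blast
    then show ?thesis by (rule eventually_mono) blast
  qed
  with bounded have "\<forall>\<^sub>F n in sequentially. False"
  proof eventually_elim
    case (elim n)
    then obtain \<phi> :: "'a set \<Rightarrow> nat" where \<phi>: "\<And>i. card {x \<in> ?X n. \<phi> x = i} \<le> 2 * u * card (?X n)" by blast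
    obtain x where x: "x \<in> ?X n" using coset_system(1)[OF assms(1) fi] by blast
    have "2 * u * card (?X n) \<le> 2 * u * C" using elim(1) u(1) by (intro mult_left_mono) auto
    then have "card {y \<in> ?X n. \<phi> y = \<phi> x} < 1" using \<phi>[of "\<phi> x"] u(2) by linarith
    then show False using x fin[of "\<sigma> n"] by auto
  qed
  then show False by simp
qed

end
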